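(* Let $n\in\{1,2,3\}$, let $\Omega\subset\mathbb{R}^n$ be a bounded open connected set with Lipschitz boundary, and let $A(x,x')=\tilde A(|x-x'|)$ be a strictly positive definite kernel. Assume that $A\in L^2(\Omega\times\Omega)$. Then $H^1_0(\Omega;\mathbb{R}^n)$ is compactly embedded into $V_A$.
   Context: $\tilde A:\mathbb{R}\to\mathbb{R}$ is an even function (defined on $[0,\infty)$ and extended evenly), and $A(x,x')=\tilde A(|x-x'|)$. The kernel $A\in L^1(\Omega\times\Omega)$ is called strictly positive definite if $\int_\Omega\int_\Omega A(x,x')\phi(x)\phi(x')\,dx'\,dx>0$ for all $\phi\in C_c^\infty(\Omega)\setminus\{0\}$ (real-valued $\phi$). For such $A$, $(u,v)_A=\int_\Omega\int_\Omega A(x,x')\,\nabla u(x):\nabla v(x')\,dx'\,dx$ is an inner product on $C_c^\infty(\Omega;\mathbb{R}^n)$, where $\alpha:\beta=\sum_{k,m}\alpha_{km}\beta_{km}$ is the Frobenius product; $\|\cdot\|_A$ is the induced norm, and $V_A$ is the Hilbert space completion of $C_c^\infty(\Omega;\mathbb{R}^n)$ with respect to it. "$H^1_0(\Omega;\mathbb{R}^n)$ is compactly embedded into $V_A$" means that the identity map on $C_c^\infty(\Omega;\mathbb{R}^n)$, which is dense in both spaces, extends by continuity to a compact linear operator $H^1_0(\Omega;\mathbb{R}^n)\to V_A$. *)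

theory Defs
  imports "HOL-Analysis.Analysis"
begin

section \<open>Test functions\<close>

text \<open>\<open>C_k k f\<close>: \<open>f\<close> is \<open>k\<close> times continuously differentiable on the whole space. A function is of
  class $C^{k+1}$ iff it is differentiable and all its first partial derivatives are of class $C^k$.\<close>

primrec C_k :: "nat \<Rightarrow> ('a::euclidean_space \<Rightarrow> 'b::real_normed_vector) \<Rightarrow> bool" where
  "C_k 0 f \<longleftrightarrow> continuous_on UNIV f"
| "C_k (Suc k) f \<longleftrightarrow>
     (\<forall>x. f differentiable (at x)) \<and> (\<forall>b\<in>Basis. C_k k (\<lambda>x. frechet_derivative f (at x) b))"

text \<open>\<open>C_c^\<infinity>(\<Omega>)\<close>; its elements are extended by zero to the whole space.\<close>

definition test_functions :: "'a::euclidean_space set \<Rightarrow> ('a \<Rightarrow> 'b::real_normed_vector) set" where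
  "test_functions \<Omega> =
     {f. (\<forall>k. C_k k f) \<and> compact (closure {x. f x \<noteq> 0}) \<and> closure {x. f x \<noteq> 0} \<subseteq> \<Omega>}"


section \<open>Lipschitz domains\<close>

text \<open>Near each boundary point, \<open>\<Omega>\<close> is the strict epigraph, in the direction of some unit vector \<open>e\<close>,
  of a Lipschitz function on the hyperplane orthogonal to \<open>e\<close>.\<close>

definition lipschitz_boundary :: "'a::euclidean_space set \<Rightarrow> bool" where
  "lipschitz_boundary \<Omega> \<longleftrightarrow>
     (\<forall>p\<in>frontier \<Omega>. \<exists>r>0. \<exists>e (\<gamma> :: 'a \<Rightarrow> real) L.
        norm e = 1 \<and> L-lipschitz_on {y. y \<bullet> e = 0} \<gamma> \<and>
        \<Omega> \<inter> ball p r = {x \<in> ball p r. \<gamma> (x - (x \<bullet> e) *\<^sub>R e) < x \<bullet> e})"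


section \<open>Lebesgue and Sobolev spaces\<close>

text \<open>Elements of \<open>L^2\<close> and of the Sobolev spaces are represented by functions; equality in these
  spaces is equality almost everywhere on \<open>\<Omega>\<close>, and values outside \<open>\<Omega>\<close> are irrelevant.\<close>

definition L2_on :: "'a::euclidean_space set \<Rightarrow> ('a \<Rightarrow> 'b::euclidean_space) set" where
  "L2_on \<Omega> = {f. set_borel_measurable lebesgue \<Omega> f \<and>
                  set_integrable lebesgue \<Omega> (\<lambda>x. (norm (f x))\<^sup>2)}"

definition is_weak_gradient ::
    "(real^'n) set \<Rightarrow> (real^'n \<Rightarrow> real^'n) \<Rightarrow> (real^'n \<Rightarrow> real^'n^'n) \<Rightarrow> bool" where
  "is_weak_gradient \<Omega> u G \<longleftrightarrow>
     (\<forall>\<phi> \<in> (test_functions \<Omega> :: (real^'n \<Rightarrow> real) set). \<forall>k m.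
        (LINT x:\<Omega>|lebesgue. u x $ k * frechet_derivative \<phi> (at x) (axis m 1)) =
        - (LINT x:\<Omega>|lebesgue. G x $ k $ m * \<phi> x))"

definition H1 :: "(real^'n) set \<Rightarrow> (real^'n \<Rightarrow> real^'n) set" where
  "H1 \<Omega> = {u \<in> L2_on \<Omega>. \<exists>G \<in> L2_on \<Omega>. is_weak_gradient \<Omega> u G}"

text \<open>The weak gradient is unique up to null sets; an arbitrary version of it is chosen.\<close>

definition weak_gradient :: "(real^'n) set \<Rightarrow> (real^'n \<Rightarrow> real^'n) \<Rightarrow> real^'n \<Rightarrow> real^'n^'n" where
  "weak_gradient \<Omega> u = (SOME G. G \<in> L2_on \<Omega> \<and> is_weak_gradient \<Omega> u G)"

definition H1_norm :: "(real^'n) set \<Rightarrow> (real^'n \<Rightarrow> real^'n) \<Rightarrow> real" where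
  "H1_norm \<Omega> u = sqrt ((LINT x:\<Omega>|lebesgue. (norm (u x))\<^sup>2) +
                       (LINT x:\<Omega>|lebesgue. (norm (weak_gradient \<Omega> u x))\<^sup>2))"

text \<open>The closure of the test functions in \<open>H^1\<close>.\<close>

definition H10 :: "(real^'n) set \<Rightarrow> (real^'n \<Rightarrow> real^'n) set" where
  "H10 \<Omega> = {u \<in> H1 \<Omega>. \<exists>\<phi>. (\<forall>k. \<phi> k \<in> test_functions \<Omega>) \<and>
                          (\<lambda>k::nat. H1_norm \<Omega> (\<lambda>x. \<phi> k x - u x)) \<longlonglongrightarrow> 0}"


section \<open>Completion of an inner product space of functions\<close>

text \<open>Let \<open>S\<close> be a linear space of functions (with pointwise operations) and \<open>ip\<close> an inner product
  on \<open>S\<close>. Its completion consists of the Cauchy sequences in \<open>S\<close> modulo null sequences. The inner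
  product and the linear operations are induced by those of \<open>S\<close> on representatives.\<close>

type_synonym ('a, 'b) completion_point = "(nat \<Rightarrow> 'a \<Rightarrow> 'b) set"

definition ip_norm :: "(('a \<Rightarrow> 'b) \<Rightarrow> ('a \<Rightarrow> 'b) \<Rightarrow> real) \<Rightarrow> ('a \<Rightarrow> 'b) \<Rightarrow> real" where
  "ip_norm ip f = sqrt (ip f f)"

definition cauchy_seqs ::
    "('a \<Rightarrow> 'b::real_vector) set \<Rightarrow> (('a \<Rightarrow> 'b) \<Rightarrow> ('a \<Rightarrow> 'b) \<Rightarrow> real) \<Rightarrow> (nat \<Rightarrow> 'a \<Rightarrow> 'b) set" where
  "cauchy_seqs S ip =
     {s. (\<forall>k. s k \<in> S) \<and>
         (\<forall>\<epsilon>>0. \<exists>N. \<forall>i\<ge>N. \<forall>j\<ge>N. ip_norm ip (\<lambda>x. s i x - s j x) < \<epsilon>)}"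

definition null_rel ::
    "('a \<Rightarrow> 'b::real_vector) set \<Rightarrow> (('a \<Rightarrow> 'b) \<Rightarrow> ('a \<Rightarrow> 'b) \<Rightarrow> real) \<Rightarrow>
     ((nat \<Rightarrow> 'a \<Rightarrow> 'b) \<times> (nat \<Rightarrow> 'a \<Rightarrow> 'b)) set" where
  "null_rel S ip =
     {(s, t). s \<in> cauchy_seqs S ip \<and> t \<in> cauchy_seqs S ip \<and>
              (\<lambda>k. ip_norm ip (\<lambda>x. s k x - t k x)) \<longlonglongrightarrow> 0}"

definition completion ::
    "('a \<Rightarrow> 'b::real_vector) set \<Rightarrow> (('a \<Rightarrow> 'b) \<Rightarrow> ('a \<Rightarrow> 'b) \<Rightarrow> real) \<Rightarrow>
     ('a, 'b) completion_point set" where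
  "completion S ip = cauchy_seqs S ip // null_rel S ip"

definition compl_embed ::
    "('a \<Rightarrow> 'b::real_vector) set \<Rightarrow> (('a \<Rightarrow> 'b) \<Rightarrow> ('a \<Rightarrow> 'b) \<Rightarrow> real) \<Rightarrow>
     ('a \<Rightarrow> 'b) \<Rightarrow> ('a, 'b) completion_point" where
  "compl_embed S ip f = null_rel S ip `` {\<lambda>k. f}"

definition compl_add ::
    "('a \<Rightarrow> 'b::real_vector) set \<Rightarrow> (('a \<Rightarrow> 'b) \<Rightarrow> ('a \<Rightarrow> 'b) \<Rightarrow> real) \<Rightarrow>
     ('a, 'b) completion_point \<Rightarrow> ('a, 'b) completion_point \<Rightarrow> ('a, 'b) completion_point" where
  "compl_add S ip X Y = (\<Union>s\<in>X. \<Union>t\<in>Y. null_rel S ip `` {\<lambda>k x. s k x + t k x})"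

definition compl_scale ::
    "('a \<Rightarrow> 'b::real_vector) set \<Rightarrow> (('a \<Rightarrow> 'b) \<Rightarrow> ('a \<Rightarrow> 'b) \<Rightarrow> real) \<Rightarrow>
     real \<Rightarrow> ('a, 'b) completion_point \<Rightarrow> ('a, 'b) completion_point" where
  "compl_scale S ip c X = (\<Union>s\<in>X. null_rel S ip `` {\<lambda>k x. c *\<^sub>R s k x})"

definition compl_inner ::
    "(('a \<Rightarrow> 'b) \<Rightarrow> ('a \<Rightarrow> 'b) \<Rightarrow> real) \<Rightarrow>
     ('a, 'b) completion_point \<Rightarrow> ('a, 'b) completion_point \<Rightarrow> real" where
  "compl_inner ip X Y = (THE l. \<forall>s\<in>X. \<forall>t\<in>Y. (\<lambda>k. ip (s k) (t k)) \<longlonglongrightarrow> l)"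

definition compl_norm ::
    "(('a \<Rightarrow> 'b) \<Rightarrow> ('a \<Rightarrow> 'b) \<Rightarrow> real) \<Rightarrow> ('a, 'b) completion_point \<Rightarrow> real" where
  "compl_norm ip X = sqrt (compl_inner ip X X)"

definition compl_dist ::
    "('a \<Rightarrow> 'b::real_vector) set \<Rightarrow> (('a \<Rightarrow> 'b) \<Rightarrow> ('a \<Rightarrow> 'b) \<Rightarrow> real) \<Rightarrow>
     ('a, 'b) completion_point \<Rightarrow> ('a, 'b) completion_point \<Rightarrow> real" where
  "compl_dist S ip X Y = compl_norm ip (compl_add S ip X (compl_scale S ip (-1) Y))"


section \<open>Kernels and the space \<open>V_A\<close>\<close>

definition strictly_positive_definite ::
    "'a::euclidean_space set \<Rightarrow> ('a \<Rightarrow> 'a \<Rightarrow> real) \<Rightarrow> bool" where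
  "strictly_positive_definite \<Omega> A \<longleftrightarrow>
     set_integrable lebesgue (\<Omega> \<times> \<Omega>) (\<lambda>(x, x'). A x x') \<and>
     (\<forall>\<phi> \<in> test_functions \<Omega> - {\<lambda>x. 0 :: real}.
        (LINT x:\<Omega>|lebesgue. (LINT x':\<Omega>|lebesgue. A x x' * \<phi> x * \<phi> x')) > 0)"

text \<open>The gradient of \<open>u\<close> is its Jacobian matrix, with entry \<open>\<partial>\<^sub>m u\<^sub>k\<close> in row \<open>k\<close> and column \<open>m\<close>. The
  inner product of the type \<open>real^'n^'n\<close> is the Frobenius product of matrices, and its norm (used
  in \<open>H1_norm\<close>) is the Frobenius norm.\<close>

definition kernel_inner ::
    "(real^'n) set \<Rightarrow> (real^'n \<Rightarrow> real^'n \<Rightarrow> real) \<Rightarrow>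
     (real^'n \<Rightarrow> real^'n) \<Rightarrow> (real^'n \<Rightarrow> real^'n) \<Rightarrow> real" where
  "kernel_inner \<Omega> A u v =
     (LINT x:\<Omega>|lebesgue. (LINT x':\<Omega>|lebesgue.
        A x x' * (jacobian u (at x) \<bullet> jacobian v (at x'))))"

definition V_space ::
    "(real^'n) set \<Rightarrow> (real^'n \<Rightarrow> real^'n \<Rightarrow> real) \<Rightarrow> (real^'n, real^'n) completion_point set" where
  "V_space \<Omega> A = completion (test_functions \<Omega>) (kernel_inner \<Omega> A)"

abbreviation "V_embed \<Omega> A \<equiv> compl_embed (test_functions \<Omega>) (kernel_inner \<Omega> A)"
abbreviation "V_add \<Omega> A \<equiv> compl_add (test_functions \<Omega>) (kernel_inner \<Omega> A)"
abbreviation "V_scale \<Omega> A \<equiv> compl_scale (test_functions \<Omega>) (kernel_inner \<Omega> A)"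
abbreviation "V_norm \<Omega> A \<equiv> compl_norm (kernel_inner \<Omega> A)"
abbreviation "V_dist \<Omega> A \<equiv> compl_dist (test_functions \<Omega>) (kernel_inner \<Omega> A)"


section \<open>Compact embedding\<close>

text \<open>Bounded linear operators from \<open>H^1_0\<close> to \<open>V_A\<close>. The second condition says that the operator is
  well defined on almost-everywhere classes.\<close>

definition bounded_linear_H10_V ::
    "(real^'n) set \<Rightarrow> (real^'n \<Rightarrow> real^'n \<Rightarrow> real) \<Rightarrow>
     ((real^'n \<Rightarrow> real^'n) \<Rightarrow> (real^'n, real^'n) completion_point) \<Rightarrow> bool" where
  "bounded_linear_H10_V \<Omega> A T \<longleftrightarrow>
     (\<forall>u\<in>H10 \<Omega>. T u \<in> V_space \<Omega> A) \<and>
     (\<forall>u\<in>H10 \<Omega>. \<forall>v\<in>H10 \<Omega>. (AE x in lebesgue. x \<in> \<Omega> \<longrightarrow> u x = v x) \<longrightarrow> T u = T v) \<and>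
     (\<forall>u\<in>H10 \<Omega>. \<forall>v\<in>H10 \<Omega>. T (\<lambda>x. u x + v x) = V_add \<Omega> A (T u) (T v)) \<and>
     (\<forall>c. \<forall>u\<in>H10 \<Omega>. T (\<lambda>x. c *\<^sub>R u x) = V_scale \<Omega> A c (T u)) \<and>
     (\<exists>C. \<forall>u\<in>H10 \<Omega>. V_norm \<Omega> A (T u) \<le> C * H1_norm \<Omega> u)"

definition compact_operator_H10_V ::
    "(real^'n) set \<Rightarrow> (real^'n \<Rightarrow> real^'n \<Rightarrow> real) \<Rightarrow>
     ((real^'n \<Rightarrow> real^'n) \<Rightarrow> (real^'n, real^'n) completion_point) \<Rightarrow> bool" where
  "compact_operator_H10_V \<Omega> A T \<longleftrightarrow>
     bounded_linear_H10_V \<Omega> A T \<and>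
     (\<forall>u. (\<forall>k::nat. u k \<in> H10 \<Omega>) \<and> (\<exists>C. \<forall>k. H1_norm \<Omega> (u k) \<le> C) \<longrightarrow>
        (\<exists>X \<in> V_space \<Omega> A. \<exists>r. strict_mono r \<and>
           (\<lambda>k. V_dist \<Omega> A (T (u (r k))) X) \<longlonglongrightarrow> 0))"

definition H10_compactly_embedded_in_V ::
    "(real^'n) set \<Rightarrow> (real^'n \<Rightarrow> real^'n \<Rightarrow> real) \<Rightarrow> bool" where
  "H10_compactly_embedded_in_V \<Omega> A \<longleftrightarrow>
     (\<exists>T. compact_operator_H10_V \<Omega> A T \<and> (\<forall>\<phi>\<in>test_functions \<Omega>. T \<phi> = V_embed \<Omega> A \<phi>))"

end

theory Submission
  imports Defs "HOL-Complex_Analysis.Great_Picard"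
begin

text \<open>
Let \<open>K\<close> be the integral operator with kernel \<open>A\<close> on \<open>\<Omega>\<close>. For test functions the norm of \<open>V_A\<close> is given
by the \<open>L\<^sup>2\<close> inner product of \<open>\<nabla>u\<close> with \<open>K \<nabla>u\<close>. As \<open>A\<close> is square integrable, \<open>K\<close> is a Hilbert-Schmidt
operator, and this has two consequences.

\<^item> \<open>K\<close> is bounded on \<open>L\<^sup>2\<close>, so the norm of \<open>V_A\<close> is at most a constant times the \<open>L\<^sup>2\<close> norm of the gradient
  (\<open>V_nrm_le\<close>). Every \<open>u\<close> in \<open>H10 \<Omega>\<close> is approximated by test functions whose gradients converge in \<open>L\<^sup>2\<close>;
  these test functions form a Cauchy sequence for the norm of \<open>V_A\<close>, and the class of this sequence
  is the image of \<open>u\<close>.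

\<^item> \<open>K\<close> is compact (\<open>integral_operator_compact\<close>). A bounded sequence of gradients has a weakly convergent
  subsequence (\<open>weakly_convergent_subsequence\<close>). Almost every section \<open>A x\<close> is square integrable, so
  \<open>K\<close> turns weak convergence into pointwise convergence almost everywhere, and the images are dominated
  by a multiple of the function that maps \<open>x\<close> to the \<open>L\<^sup>2\<close> norm of \<open>A x\<close>; hence they converge in \<open>L\<^sup>2\<close>.
  By the Cauchy-Schwarz inequality the squared norm of \<open>u\<^sub>i - u\<^sub>j\<close> in \<open>V_A\<close> is at most the \<open>L\<^sup>2\<close> norm of
  \<open>\<nabla>u\<^sub>i - \<nabla>u\<^sub>j\<close>, which is bounded, times that of \<open>K \<nabla>u\<^sub>i - K \<nabla>u\<^sub>j\<close>, which tends to zero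
  (\<open>V_nrm_compact\<close>). So the subsequence is Cauchy, and its class is the limit in the completion.

The norm of \<open>H1 \<Omega>\<close> refers to a weak gradient that is only chosen, not computed. To identify it with the
Jacobian matrix on test functions, and to make it linear up to null sets, weak gradients must be
unique almost everywhere. This is the fundamental lemma of the calculus of variations
(\<open>test_functions_separate\<close>), which rests on smooth functions that approximate the indicators of boxes.
That the Jacobian matrix is a weak gradient is integration by parts; here the vanishing of the
integral of a partial derivative is obtained from the translation invariance of the Lebesgue measure.

The integrals over \<open>\<Omega>\<close> are taken with respect to the completed Lebesgue measure, whereas Fubini's
theorem is applied to Borel functions. For this reason \<open>A\<close> is replaced by a Borel function that agrees
with it almost everywhere on \<open>\<Omega> \<times> \<Omega>\<close> and vanishes almost everywhere outside (locale \<open>kernel_on\<close>).\<close>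

section \<open>Semi-inner products and completions\<close>

text \<open>The form may vanish on nonzero functions. This covers square integrable functions that are not
identified when they agree almost everywhere, and it covers the kernel form on test functions, so
that the Cauchy-Schwarz and triangle inequalities are proved once for both.\<close>

locale semi_inner_space =
  fixes S :: "('a \<Rightarrow> 'b::real_vector) set" and ip :: "('a \<Rightarrow> 'b) \<Rightarrow> ('a \<Rightarrow> 'b) \<Rightarrow> real"
  assumes add_mem: "f \<in> S \<Longrightarrow> g \<in> S \<Longrightarrow> (\<lambda>x. f x + g x) \<in> S"
    and scale_mem: "f \<in> S \<Longrightarrow> (\<lambda>x. c *\<^sub>R f x) \<in> S"
    and ip_commute: "f \<in> S \<Longrightarrow> g \<in> S \<Longrightarrow> ip f g = ip g f"
    and ip_add_left: "f \<in> S \<Longrightarrow> g \<in> S \<Longrightarrow> h \<in> S \<Longrightarrow> ip (\<lambda>x. f x + g x) h = ip f h + ip g h"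
    and ip_scale_left: "f \<in> S \<Longrightarrow> g \<in> S \<Longrightarrow> ip (\<lambda>x. c *\<^sub>R f x) g = c * ip f g"
    and ip_nonneg: "f \<in> S \<Longrightarrow> 0 \<le> ip f f"
begin

abbreviation nrm :: "('a \<Rightarrow> 'b) \<Rightarrow> real" where "nrm \<equiv> ip_norm ip"

lemma diff_mem: "f \<in> S \<Longrightarrow> g \<in> S \<Longrightarrow> (\<lambda>x. f x - g x) \<in> S"
  using add_mem[of f "\<lambda>x. (-1) *\<^sub>R g x"] scale_mem[of g "-1"] by simp

lemma ip_add_right: "f \<in> S \<Longrightarrow> g \<in> S \<Longrightarrow> h \<in> S \<Longrightarrow> ip h (\<lambda>x. f x + g x) = ip h f + ip h g"
  by (simp add: ip_commute[of h] ip_add_left add_mem)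

lemma ip_scale_right: "f \<in> S \<Longrightarrow> g \<in> S \<Longrightarrow> ip g (\<lambda>x. c *\<^sub>R f x) = c * ip g f"
  by (simp add: ip_commute[of g] ip_scale_left scale_mem)

lemma ip_diff_left: "f \<in> S \<Longrightarrow> g \<in> S \<Longrightarrow> h \<in> S \<Longrightarrow> ip (\<lambda>x. f x - g x) h = ip f h - ip g h"
  using ip_add_left[of f "\<lambda>x. (-1) *\<^sub>R g x" h] ip_scale_left[of g h "-1"] scale_mem[of g "-1"] by simp

lemma ip_diff_right: "f \<in> S \<Longrightarrow> g \<in> S \<Longrightarrow> h \<in> S \<Longrightarrow> ip h (\<lambda>x. f x - g x) = ip h f - ip h g"
  using ip_add_right[of f "\<lambda>x. (-1) *\<^sub>R g x" h] ip_scale_right[of g h "-1"] scale_mem[of g "-1"] by simp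

lemma nrm_nonneg: "f \<in> S \<Longrightarrow> 0 \<le> nrm f"
  by (simp add: ip_norm_def ip_nonneg)

lemma nrm_square: "f \<in> S \<Longrightarrow> (nrm f)\<^sup>2 = ip f f"
  by (simp add: ip_norm_def ip_nonneg)

lemma nrm_scale: "f \<in> S \<Longrightarrow> nrm (\<lambda>x. c *\<^sub>R f x) = \<bar>c\<bar> * nrm f"
  using ip_scale_left[of f "\<lambda>x. c *\<^sub>R f x" c] ip_scale_right[of f f c] scale_mem[of f c]
  by (simp add: ip_norm_def real_sqrt_mult flip: power2_eq_square mult.assoc)

lemma nrm_zero: "f \<in> S \<Longrightarrow> nrm (\<lambda>x. 0) = 0"
  using nrm_scale[of f 0] by simp

lemma nrm_commute: assumes "f \<in> S" "g \<in> S" shows "nrm (\<lambda>x. f x - g x) = nrm (\<lambda>x. g x - f x)"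
  using nrm_scale[OF diff_mem[OF assms], of "-1"] by simp

lemma nrm_tendsto_zeroI:
  assumes "\<And>k. d k \<in> S" and "\<And>k. nrm (d k) \<le> e k" and "(e \<longlongrightarrow> 0) F"
  shows "((\<lambda>k. nrm (d k)) \<longlongrightarrow> 0) F"
  by (rule Lim_null_comparison[OF _ assms(3)]) (use assms(1,2) nrm_nonneg in auto)

lemma Cauchy_Schwarz:
  assumes f: "f \<in> S" and g: "g \<in> S"
  shows "\<bar>ip f g\<bar> \<le> nrm f * nrm g"
proof -
  have quad: "0 \<le> ip f f - 2 * c * ip f g + c\<^sup>2 * ip g g" for c
  proof -
    have "0 \<le> ip (\<lambda>x. f x - c *\<^sub>R g x) (\<lambda>x. f x - c *\<^sub>R g x)"
      by (intro ip_nonneg diff_mem scale_mem f g)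
    also have "\<dots> = ip f f - 2 * c * ip f g + c\<^sup>2 * ip g g"
      using f g by (simp add: ip_diff_left ip_diff_right diff_mem scale_mem ip_scale_left
          ip_scale_right ip_commute[OF g f] power2_eq_square algebra_simps)
    finally show ?thesis .
  qed
  have "(ip f g)\<^sup>2 \<le> ip f f * ip g g"
  proof (cases "ip g g = 0")
    case True
    have "ip f g = 0"
    proof (rule ccontr)
      assume nz: "ip f g \<noteq> 0"
      show False
        \<comment> \<open>For this parameter the quadratic, which is linear here, takes the value \<open>- 1\<close>.\<close>
        using quad[of "(ip f f + 1) / (2 * ip f g)"] True nz by simp
    qed
    then show ?thesis using True by simp
  next
    case False
    then have pos: "ip g g > 0" using ip_nonneg[OF g] by simp
    show ?thesis
      \<comment> \<open>The minimum of the quadratic.\<close>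
      using quad[of "ip f g / ip g g"] pos by (simp add: field_simps power2_eq_square)
  qed
  then have "sqrt ((ip f g)\<^sup>2) \<le> sqrt (ip f f * ip g g)"
    by (rule real_sqrt_le_mono)
  then show ?thesis by (simp add: ip_norm_def real_sqrt_mult)
qed

lemma nrm_triangle:
  assumes f: "f \<in> S" and g: "g \<in> S"
  shows "nrm (\<lambda>x. f x + g x) \<le> nrm f + nrm g"
proof (rule power2_le_imp_le)
  have "(nrm (\<lambda>x. f x + g x))\<^sup>2 = (nrm f)\<^sup>2 + 2 * ip f g + (nrm g)\<^sup>2"
    using f g by (simp add: nrm_square add_mem ip_add_left ip_add_right ip_commute[OF g f])
  also have "\<dots> \<le> (nrm f)\<^sup>2 + 2 * (nrm f * nrm g) + (nrm g)\<^sup>2"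
    using Cauchy_Schwarz[OF f g] by linarith
  finally show "(nrm (\<lambda>x. f x + g x))\<^sup>2 \<le> (nrm f + nrm g)\<^sup>2"
    by (simp add: power2_sum)
qed (use nrm_nonneg f g in auto)

lemma nrm_diff_triangle:
  assumes "f \<in> S" "g \<in> S" "h \<in> S"
  shows "nrm (\<lambda>x. f x - h x) \<le> nrm (\<lambda>x. f x - g x) + nrm (\<lambda>x. g x - h x)"
  using nrm_triangle[of "\<lambda>x. f x - g x" "\<lambda>x. g x - h x"] assms by (simp add: diff_mem)

lemma nrm_reverse_triangle:
  assumes "f \<in> S" "g \<in> S"
  shows "\<bar>nrm f - nrm g\<bar> \<le> nrm (\<lambda>x. f x - g x)"
  using nrm_triangle[of "\<lambda>x. f x - g x" g] nrm_triangle[of "\<lambda>x. g x - f x" f]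
    nrm_commute[OF assms] assms by (simp add: diff_mem)

abbreviation CS where "CS \<equiv> cauchy_seqs S ip"
abbreviation cls :: "(nat \<Rightarrow> 'a \<Rightarrow> 'b) \<Rightarrow> (nat \<Rightarrow> 'a \<Rightarrow> 'b) set"
  where "cls s \<equiv> null_rel S ip `` {s}"

lemma cauchy_mem: "s \<in> CS \<Longrightarrow> s k \<in> S"
  by (simp add: cauchy_seqs_def)

lemma cauchyD:
  assumes "s \<in> CS" "0 < \<epsilon>"
  shows "\<exists>N. \<forall>i\<ge>N. \<forall>j\<ge>N. nrm (\<lambda>x. s i x - s j x) < \<epsilon>"
  using assms by (auto simp: cauchy_seqs_def)

text \<open>Meant for sequences that converge to an object outside of \<open>S\<close>: if \<open>e k\<close> bounds the distance from
\<open>s k\<close> to the limit, then the triangle inequality through the limit has the form of the last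
hypothesis.\<close>

lemma cauchyI:
  assumes "\<And>k. s k \<in> S" and "e \<longlonglongrightarrow> 0"
    and le: "\<And>i j. nrm (\<lambda>x. s i x - s j x) \<le> e i + e j"
  shows "s \<in> CS"
proof -
  have "\<exists>N. \<forall>i\<ge>N. \<forall>j\<ge>N. nrm (\<lambda>x. s i x - s j x) < \<epsilon>" if "\<epsilon> > 0" for \<epsilon>
  proof -
    have "\<forall>\<^sub>F k in sequentially. e k < \<epsilon> / 2"
      using assms(2) that by (intro order_tendstoD) auto
    then obtain N where N: "\<And>k. k \<ge> N \<Longrightarrow> e k < \<epsilon> / 2"
      by (auto simp: eventually_sequentially)
    have "nrm (\<lambda>x. s i x - s j x) < \<epsilon>" if "i \<ge> N" "j \<ge> N" for i j
      using le[of i j] N[OF that(1)] N[OF that(2)] by linarith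
    then show ?thesis by blast
  qed
  then show ?thesis using assms(1) by (auto simp: cauchy_seqs_def)
qed

lemma cauchy_add:
  assumes s: "s \<in> CS" and t: "t \<in> CS"
  shows "(\<lambda>k x. s k x + t k x) \<in> CS"
proof -
  have "\<exists>N. \<forall>i\<ge>N. \<forall>j\<ge>N. nrm (\<lambda>x. s i x + t i x - (s j x + t j x)) < \<epsilon>" if "\<epsilon> > 0" for \<epsilon>
  proof -
    have "\<epsilon> / 2 > 0" using that by simp
    obtain N1 where N1: "\<And>i j. i \<ge> N1 \<Longrightarrow> j \<ge> N1 \<Longrightarrow> nrm (\<lambda>x. s i x - s j x) < \<epsilon> / 2"
      using cauchyD[OF s \<open>\<epsilon> / 2 > 0\<close>] by blast
    obtain N2 where N2: "\<And>i j. i \<ge> N2 \<Longrightarrow> j \<ge> N2 \<Longrightarrow> nrm (\<lambda>x. t i x - t j x) < \<epsilon> / 2"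
      using cauchyD[OF t \<open>\<epsilon> / 2 > 0\<close>] by blast
    have "nrm (\<lambda>x. s i x + t i x - (s j x + t j x)) < \<epsilon>" if "i \<ge> max N1 N2" "j \<ge> max N1 N2" for i j
      using nrm_triangle[of "\<lambda>x. s i x - s j x" "\<lambda>x. t i x - t j x"] that N1[of i j] N2[of i j]
      by (simp add: diff_mem cauchy_mem s t algebra_simps)
    then show ?thesis by blast
  qed
  then show ?thesis using add_mem[OF cauchy_mem[OF s] cauchy_mem[OF t]]
    by (auto simp: cauchy_seqs_def)
qed

lemma cauchy_scale:
  assumes s: "s \<in> CS"
  shows "(\<lambda>k x. c *\<^sub>R s k x) \<in> CS"
proof -
  have "\<exists>N. \<forall>i\<ge>N. \<forall>j\<ge>N. nrm (\<lambda>x. c *\<^sub>R s i x - c *\<^sub>R s j x) < \<epsilon>" if "\<epsilon> > 0" for \<epsilon>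
  proof -
    have "\<epsilon> / (\<bar>c\<bar> + 1) > 0" using that by simp
    then obtain N where N: "\<And>i j. i \<ge> N \<Longrightarrow> j \<ge> N \<Longrightarrow> nrm (\<lambda>x. s i x - s j x) < \<epsilon> / (\<bar>c\<bar> + 1)"
      using cauchyD[OF s \<open>\<epsilon> / (\<bar>c\<bar> + 1) > 0\<close>] by blast
    have "nrm (\<lambda>x. c *\<^sub>R s i x - c *\<^sub>R s j x) < \<epsilon>" if "i \<ge> N" "j \<ge> N" for i j
    proof -
      have "nrm (\<lambda>x. c *\<^sub>R s i x - c *\<^sub>R s j x) = \<bar>c\<bar> * nrm (\<lambda>x. s i x - s j x)"
        using nrm_scale[OF diff_mem[OF cauchy_mem[OF s] cauchy_mem[OF s]], of c i j]
        by (simp add: scaleR_diff_right)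
      also have "\<dots> \<le> (\<bar>c\<bar> + 1) * nrm (\<lambda>x. s i x - s j x)"
        using nrm_nonneg[OF diff_mem[OF cauchy_mem[OF s] cauchy_mem[OF s]], of i j]
        by (simp add: mult_right_mono)
      also have "\<dots> < \<epsilon>"
        using N[OF that] by (simp add: field_simps add_pos_nonneg)
      finally show ?thesis .
    qed
    then show ?thesis by blast
  qed
  then show ?thesis using scale_mem[OF cauchy_mem[OF s]]
    by (auto simp: cauchy_seqs_def)
qed

lemma cauchy_diff:
  assumes s: "s \<in> CS" and t: "t \<in> CS"
  shows "(\<lambda>k x. s k x - t k x) \<in> CS"
  using cauchy_add[OF s cauchy_scale[OF t, of "-1"]] by simp

lemma nrm_convergent:
  assumes s: "s \<in> CS"
  shows "convergent (\<lambda>k. nrm (s k))"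
proof (rule real_Cauchy_convergent, rule metric_CauchyI)
  fix \<epsilon> :: real assume "0 < \<epsilon>"
  then obtain N where N: "\<And>i j. i \<ge> N \<Longrightarrow> j \<ge> N \<Longrightarrow> nrm (\<lambda>x. s i x - s j x) < \<epsilon>"
    using cauchyD[OF s \<open>0 < \<epsilon>\<close>] by blast
  have "dist (nrm (s i)) (nrm (s j)) < \<epsilon>" if "i \<ge> N" "j \<ge> N" for i j
    using nrm_reverse_triangle[OF cauchy_mem[OF s] cauchy_mem[OF s], of i j] N[OF that]
    by (simp add: dist_real_def)
  then show "\<exists>M. \<forall>i\<ge>M. \<forall>j\<ge>M. dist (nrm (s i)) (nrm (s j)) < \<epsilon>" by blast
qed

lemma null_rel_iff:
  "(s, t) \<in> null_rel S ip \<longleftrightarrow> s \<in> CS \<and> t \<in> CS \<and> (\<lambda>k. nrm (\<lambda>x. s k x - t k x)) \<longlonglongrightarrow> 0"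
  by (simp add: null_rel_def)

lemma null_rel_equiv: "equiv CS (null_rel S ip)"
proof (rule equivI)
  show "null_rel S ip \<subseteq> CS \<times> CS" by (auto simp: null_rel_def)
  show "refl_on CS (null_rel S ip)"
    by (auto simp: refl_on_def null_rel_def nrm_zero[OF cauchy_mem])
  show "sym (null_rel S ip)"
  proof (rule symI)
    fix s t assume "(s, t) \<in> null_rel S ip"
    then show "(t, s) \<in> null_rel S ip"
      using nrm_commute[OF cauchy_mem[of s] cauchy_mem[of t]] by (simp add: null_rel_iff)
  qed
  show "trans (null_rel S ip)"
  proof (rule transI)
    fix s t u assume st: "(s, t) \<in> null_rel S ip" and tu: "(t, u) \<in> null_rel S ip"
    then have mem: "s k \<in> S" "t k \<in> S" "u k \<in> S" for k
      by (auto simp: null_rel_iff cauchy_mem)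
    have "(\<lambda>k. nrm (\<lambda>x. s k x - u k x)) \<longlonglongrightarrow> 0"
    proof (rule nrm_tendsto_zeroI)
      show "(\<lambda>k. nrm (\<lambda>x. s k x - t k x) + nrm (\<lambda>x. t k x - u k x)) \<longlonglongrightarrow> 0"
        using st tu by (auto simp: null_rel_iff intro: tendsto_add_zero)
    qed (intro nrm_diff_triangle diff_mem mem)+
    then show "(s, u) \<in> null_rel S ip" using st tu by (simp add: null_rel_iff)
  qed
qed

lemma cls_eq_iff: "s \<in> CS \<Longrightarrow> t \<in> CS \<Longrightarrow> cls s = cls t \<longleftrightarrow> (\<lambda>k. nrm (\<lambda>x. s k x - t k x)) \<longlonglongrightarrow> 0"
  by (simp add: eq_equiv_class_iff[OF null_rel_equiv] null_rel_iff)

lemma cls_in_completion: "s \<in> CS \<Longrightarrow> cls s \<in> completion S ip"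
  by (simp add: completion_def quotientI)

text \<open>The union in the definition of the sum ranges over all pairs of representatives. It is a single
class because each pair yields the same one.\<close>

lemma add_cls:
  assumes s: "s \<in> CS" and t: "t \<in> CS"
  shows "compl_add S ip (cls s) (cls t) = cls (\<lambda>k x. s k x + t k x)"
proof -
  have "cls (\<lambda>k x. s' k x + t' k x) = cls (\<lambda>k x. s k x + t k x)"
    if "s' \<in> cls s" "t' \<in> cls t" for s' t'
  proof -
    have c: "s' \<in> CS" "t' \<in> CS" and lim: "(\<lambda>k. nrm (\<lambda>x. s k x - s' k x)) \<longlonglongrightarrow> 0"
      "(\<lambda>k. nrm (\<lambda>x. t k x - t' k x)) \<longlonglongrightarrow> 0"
      using that by (auto simp: null_rel_iff)
    have "nrm (\<lambda>x. s k x + t k x - (s' k x + t' k x)) \<le>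
        nrm (\<lambda>x. s k x - s' k x) + nrm (\<lambda>x. t k x - t' k x)" for k
      using nrm_triangle[of "\<lambda>x. s k x - s' k x" "\<lambda>x. t k x - t' k x"]
      by (simp add: diff_mem cauchy_mem s t c algebra_simps)
    then have "(\<lambda>k. nrm (\<lambda>x. s k x + t k x - (s' k x + t' k x))) \<longlonglongrightarrow> 0"
      by (intro nrm_tendsto_zeroI[OF _ _ tendsto_add_zero[OF lim]] diff_mem add_mem cauchy_mem s t c)
    then show ?thesis using cls_eq_iff s t c cauchy_add by blast
  qed
  moreover have "s \<in> cls s" "t \<in> cls t"
    using s t equiv_class_self[OF null_rel_equiv] by blast+
  ultimately show ?thesis unfolding compl_add_def by blast
qed

lemma scale_cls:
  assumes s: "s \<in> CS"
  shows "compl_scale S ip c (cls s) = cls (\<lambda>k x. c *\<^sub>R s k x)"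
proof -
  have "cls (\<lambda>k x. c *\<^sub>R s' k x) = cls (\<lambda>k x. c *\<^sub>R s k x)"
    if "s' \<in> cls s" for s'
  proof -
    have c: "s' \<in> CS" and lim: "(\<lambda>k. nrm (\<lambda>x. s k x - s' k x)) \<longlonglongrightarrow> 0"
      using that by (auto simp: null_rel_iff)
    have "nrm (\<lambda>x. c *\<^sub>R s k x - c *\<^sub>R s' k x) = \<bar>c\<bar> * nrm (\<lambda>x. s k x - s' k x)" for k
      using nrm_scale[of "\<lambda>x. s k x - s' k x" c]
      by (simp add: diff_mem cauchy_mem s c algebra_simps)
    then have "(\<lambda>k. nrm (\<lambda>x. c *\<^sub>R s k x - c *\<^sub>R s' k x)) \<longlonglongrightarrow> 0"
      using tendsto_mult_right_zero[OF lim] by simp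
    then show ?thesis using cls_eq_iff s c cauchy_scale by blast
  qed
  moreover have "s \<in> cls s"
    using s equiv_class_self[OF null_rel_equiv] by blast
  ultimately show ?thesis unfolding compl_scale_def by blast
qed

text \<open>The inner product of the completion is a definite description. It denotes something only because
the inner products converge for every pair of representatives, to a limit that does not depend on
the pair.\<close>

lemma norm_cls:
  assumes s: "s \<in> CS"
  shows "(\<lambda>k. nrm (s k)) \<longlonglongrightarrow> compl_norm ip (cls s)"
proof -
  obtain l where l: "(\<lambda>k. nrm (s k)) \<longlonglongrightarrow> l"
    using nrm_convergent[OF s] by (auto simp: convergent_def)
  have l0: "l \<ge> 0"
    using l by (rule LIMSEQ_le_const) (auto intro!: nrm_nonneg cauchy_mem s)
  have lim: "(\<lambda>k. ip (t k) (t' k)) \<longlonglongrightarrow> l\<^sup>2" if "t \<in> cls s" "t' \<in> cls s" for t t'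
  proof -
    have c: "t \<in> CS" "t' \<in> CS" and d: "(\<lambda>k. nrm (\<lambda>x. s k x - t k x)) \<longlonglongrightarrow> 0"
      "(\<lambda>k. nrm (\<lambda>x. s k x - t' k x)) \<longlonglongrightarrow> 0"
      using that by (auto simp: null_rel_iff)
    have conv: "(\<lambda>k. nrm (t' k)) \<longlonglongrightarrow> l"
    proof -
      have "(\<lambda>k. nrm (s k) - nrm (t' k)) \<longlonglongrightarrow> 0"
        by (rule Lim_null_comparison[OF _ d(2)])
          (auto intro!: always_eventually nrm_reverse_triangle cauchy_mem s c)
      then have "(\<lambda>k. nrm (s k) - (nrm (s k) - nrm (t' k))) \<longlonglongrightarrow> l - 0"
        by (intro tendsto_diff l)
      then show ?thesis by simp
    qed
    have "(\<lambda>k. ip (\<lambda>x. t k x - s k x) (t' k)) \<longlonglongrightarrow> 0"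
    proof (rule Lim_null_comparison)
      show "(\<lambda>k. nrm (\<lambda>x. s k x - t k x) * nrm (t' k)) \<longlonglongrightarrow> 0"
        using tendsto_mult[OF d(1) conv] by simp
      show "\<forall>\<^sub>F k in sequentially. norm (ip (\<lambda>x. t k x - s k x) (t' k))
          \<le> nrm (\<lambda>x. s k x - t k x) * nrm (t' k)"
        using Cauchy_Schwarz by (auto intro!: always_eventually
            simp: nrm_commute[OF cauchy_mem[OF s] cauchy_mem[OF c(1)]] diff_mem cauchy_mem s c)
    qed
    moreover have "(\<lambda>k. ip (s k) (\<lambda>x. t' k x - s k x)) \<longlonglongrightarrow> 0"
    proof (rule Lim_null_comparison)
      show "(\<lambda>k. nrm (s k) * nrm (\<lambda>x. s k x - t' k x)) \<longlonglongrightarrow> 0"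
        using tendsto_mult[OF l d(2)] by simp
      show "\<forall>\<^sub>F k in sequentially. norm (ip (s k) (\<lambda>x. t' k x - s k x))
          \<le> nrm (s k) * nrm (\<lambda>x. s k x - t' k x)"
        using Cauchy_Schwarz by (auto intro!: always_eventually
            simp: nrm_commute[OF cauchy_mem[OF s] cauchy_mem[OF c(2)]] diff_mem cauchy_mem s c)
    qed
    moreover have "(\<lambda>k. (nrm (s k))\<^sup>2) \<longlonglongrightarrow> l\<^sup>2" by (intro tendsto_power l)
    ultimately have "(\<lambda>k. ip (\<lambda>x. t k x - s k x) (t' k) + ip (s k) (\<lambda>x. t' k x - s k x)
        + (nrm (s k))\<^sup>2) \<longlonglongrightarrow> 0 + 0 + l\<^sup>2" by (intro tendsto_add)
    moreover have "ip (\<lambda>x. t k x - s k x) (t' k) + ip (s k) (\<lambda>x. t' k x - s k x)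
        + (nrm (s k))\<^sup>2 = ip (t k) (t' k)" for k
      by (simp add: ip_diff_left ip_diff_right nrm_square cauchy_mem s c)
    ultimately show ?thesis by simp
  qed
  have self: "s \<in> cls s"
    using s equiv_class_self[OF null_rel_equiv] by blast
  have "compl_inner ip (cls s) (cls s) = l\<^sup>2"
    unfolding compl_inner_def
  proof (rule the_equality)
    show "\<forall>s'\<in>cls s. \<forall>t\<in>cls s. (\<lambda>k. ip (s' k) (t k)) \<longlonglongrightarrow> l\<^sup>2" using lim by blast
    show "l' = l\<^sup>2" if "\<forall>s'\<in>cls s. \<forall>t\<in>cls s. (\<lambda>k. ip (s' k) (t k)) \<longlonglongrightarrow> l'" for l'
      using that lim[OF self self] self LIMSEQ_unique by blast
  qed
  then show ?thesis using l l0 by (simp add: compl_norm_def)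
qed

lemma dist_cls:
  assumes s: "s \<in> CS" and t: "t \<in> CS"
  shows "(\<lambda>k. nrm (\<lambda>x. s k x - t k x)) \<longlonglongrightarrow> compl_dist S ip (cls s) (cls t)"
  using norm_cls[OF cauchy_diff[OF s t]]
  unfolding compl_dist_def scale_cls[OF t] add_cls[OF s cauchy_scale[OF t]] by simp

end

section \<open>Functions of class \<open>C_k\<close>\<close>

lemma C_k_differentiable: "C_k (Suc k) f \<Longrightarrow> f differentiable (at x)"
  by simp

lemma C_k_partial: "C_k (Suc k) f \<Longrightarrow> b \<in> Basis \<Longrightarrow> C_k k (\<lambda>x. frechet_derivative f (at x) b)"
  by simp

lemma C_k_decr: "C_k (Suc k) f \<Longrightarrow> C_k k f"
proof (induction k arbitrary: f)
  case 0
  then show ?case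
    by (auto intro!: continuous_at_imp_continuous_on differentiable_imp_continuous_within)
next
  case (Suc k)
  show ?case unfolding C_k.simps(2)[of k f]
  proof (intro conjI ballI allI)
    fix b :: 'a assume "b \<in> Basis"
    then show "C_k k (\<lambda>x. frechet_derivative f (at x) b)"
      by (intro Suc.IH C_k_partial[OF Suc.prems])
  qed (use Suc.prems C_k_differentiable in blast)
qed

lemma has_frechet_derivative:
  "C_k (Suc k) f \<Longrightarrow> (f has_derivative frechet_derivative f (at x)) (at x)"
  using frechet_derivative_works C_k_differentiable by blast

lemma C_k_SucI:
  assumes "\<And>x. (f has_derivative D x) (at x)" and "\<And>b. b \<in> Basis \<Longrightarrow> C_k k (\<lambda>x. D x b)"
  shows "C_k (Suc k) f"
proof -
  have "frechet_derivative f (at x) = D x" for x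
    using frechet_derivative_at[OF assms(1)] by simp
  then show ?thesis using assms by (auto simp: differentiable_def)
qed

lemma C_k_bounded_linear:
  assumes h: "bounded_linear h"
  shows "C_k k f \<Longrightarrow> C_k k (\<lambda>x. h (f x))"
proof (induction k arbitrary: f)
  case 0
  then show ?case by (auto intro: bounded_linear.continuous_on h)
next
  case (Suc k)
  show ?case
  proof (rule C_k_SucI)
    show "((\<lambda>x. h (f x)) has_derivative (\<lambda>v. h (frechet_derivative f (at x) v))) (at x)" for x
      by (intro bounded_linear.has_derivative[OF h] has_frechet_derivative[OF Suc.prems])
    show "C_k k (\<lambda>x. h (frechet_derivative f (at x) b))" if "b \<in> Basis" for b
      by (intro Suc.IH C_k_partial Suc.prems that)
  qed
qed

lemma C_k_const: "C_k k (\<lambda>x. c)"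
proof (induction k arbitrary: c)
  case (Suc k)
  show ?case by (rule C_k_SucI[where D = "\<lambda>x v. 0"]) (auto intro: Suc)
qed simp

lemma C_k_add: "C_k k f \<Longrightarrow> C_k k g \<Longrightarrow> C_k k (\<lambda>x. f x + g x)"
proof (induction k arbitrary: f g)
  case 0
  then show ?case by (auto intro: continuous_on_add)
next
  case (Suc k)
  show ?case
  proof (rule C_k_SucI)
    show "((\<lambda>x. f x + g x) has_derivative
        (\<lambda>v. frechet_derivative f (at x) v + frechet_derivative g (at x) v)) (at x)" for x
      by (intro has_derivative_add has_frechet_derivative[OF Suc.prems(1)] has_frechet_derivative[OF Suc.prems(2)])
    show "C_k k (\<lambda>x. frechet_derivative f (at x) b + frechet_derivative g (at x) b)"
      if "b \<in> Basis" for b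
      by (intro Suc.IH C_k_partial Suc.prems that)
  qed
qed

lemma C_k_mult:
  fixes f g :: "'a::euclidean_space \<Rightarrow> real"
  shows "C_k k f \<Longrightarrow> C_k k g \<Longrightarrow> C_k k (\<lambda>x. f x * g x)"
proof (induction k arbitrary: f g)
  case 0
  then show ?case by (auto intro: continuous_on_mult)
next
  case (Suc k)
  show ?case
  proof (rule C_k_SucI)
    show "((\<lambda>x. f x * g x) has_derivative
        (\<lambda>v. f x * frechet_derivative g (at x) v + frechet_derivative f (at x) v * g x)) (at x)" for x
      by (intro has_derivative_mult has_frechet_derivative[OF Suc.prems(1)] has_frechet_derivative[OF Suc.prems(2)])
    show "C_k k (\<lambda>x. f x * frechet_derivative g (at x) b + frechet_derivative f (at x) b * g x)"
      if "b \<in> Basis" for b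
      by (intro C_k_add Suc.IH C_k_partial Suc.prems that C_k_decr)
  qed
qed

lemma C_k_prod:
  fixes f :: "'i \<Rightarrow> 'a::euclidean_space \<Rightarrow> real"
  shows "finite I \<Longrightarrow> (\<And>i. i \<in> I \<Longrightarrow> C_k k (f i)) \<Longrightarrow> C_k k (\<lambda>x. \<Prod>i\<in>I. f i x)"
  by (induction I rule: finite_induct) (auto intro: C_k_const C_k_mult)

text \<open>Smoothness of a function of one variable enters as the whole sequence of its derivatives. The
induction step passes from \<open>D n\<close> to \<open>D (Suc n)\<close>, so the first-order chain rule suffices.\<close>

lemma C_k_affine:
  fixes D :: "nat \<Rightarrow> real \<Rightarrow> real" and v :: "'a::euclidean_space"
  assumes D: "\<And>n t. (D n has_real_derivative D (Suc n) t) (at t)"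
  shows "C_k k (\<lambda>x. D n (x \<bullet> v + c))"
proof (induction k arbitrary: n)
  case 0
  have "continuous_on UNIV (D n)"
    using D by (auto intro!: continuous_at_imp_continuous_on DERIV_isCont)
  then show ?case
    unfolding C_k.simps by (rule continuous_on_compose2) (auto intro!: continuous_intros)
next
  case (Suc k)
  show ?case
  proof (rule C_k_SucI)
    show "((\<lambda>x. D n (x \<bullet> v + c)) has_derivative (\<lambda>w. (w \<bullet> v) * D (Suc n) (x \<bullet> v + c))) (at x)" for x
      by (rule has_derivative_eq_rhs, rule DERIV_compose_FDERIV[OF D])
        (auto intro!: derivative_eq_intros)
    show "C_k k (\<lambda>x. (b \<bullet> v) * D (Suc n) (x \<bullet> v + c))" for b
      by (intro C_k_mult C_k_const Suc.IH)
  qed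
qed

section \<open>Test functions\<close>

lemma test_functionsI:
  assumes "\<And>k. C_k k f" and "compact K" "K \<subseteq> \<Omega>" and "\<And>x. x \<notin> K \<Longrightarrow> f x = 0"
  shows "f \<in> test_functions \<Omega>"
proof -
  have "closure {x. f x \<noteq> 0} \<subseteq> K"
    using assms(2,4) by (intro closure_minimal compact_imp_closed) auto
  moreover from this have "compact (closure {x. f x \<noteq> 0})"
    using compact_Int_closed[OF assms(2), of "closure {x. f x \<noteq> 0}"] by (simp add: inf.absorb2)
  ultimately show ?thesis using assms(1,3) by (auto simp: test_functions_def)
qed

lemma test_functionsE:
  assumes "f \<in> test_functions \<Omega>"
  obtains K where "compact K" "K \<subseteq> \<Omega>" "\<And>x. x \<notin> K \<Longrightarrow> f x = 0"
proof
  show "compact (closure {x. f x \<noteq> 0})" "closure {x. f x \<noteq> 0} \<subseteq> \<Omega>"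
    using assms unfolding test_functions_def by blast+
  show "f x = 0" if "x \<notin> closure {x. f x \<noteq> 0}" for x
    using that closure_subset[of "{x. f x \<noteq> 0}"] by auto
qed

lemma test_functions_C_k: "f \<in> test_functions \<Omega> \<Longrightarrow> C_k k f"
  by (simp add: test_functions_def)

lemma test_functions_outside: "f \<in> test_functions \<Omega> \<Longrightarrow> x \<notin> \<Omega> \<Longrightarrow> f x = 0"
  by (erule test_functionsE) auto

lemma test_functions_add:
  assumes f: "f \<in> test_functions \<Omega>" and g: "g \<in> test_functions \<Omega>"
  shows "(\<lambda>x. f x + g x) \<in> test_functions \<Omega>"
proof -
  obtain K where K: "compact K" "K \<subseteq> \<Omega>" "\<And>x. x \<notin> K \<Longrightarrow> f x = 0"
    using f by (rule test_functionsE) blast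
  obtain L where L: "compact L" "L \<subseteq> \<Omega>" "\<And>x. x \<notin> L \<Longrightarrow> g x = 0"
    using g by (rule test_functionsE) blast
  show ?thesis
    by (rule test_functionsI[of _ "K \<union> L"])
      (use K L f g in \<open>auto intro: C_k_add test_functions_C_k compact_Un\<close>)
qed

lemma test_functions_bounded_linear:
  assumes h: "bounded_linear h" and f: "f \<in> test_functions \<Omega>"
  shows "(\<lambda>x. h (f x)) \<in> test_functions \<Omega>"
proof -
  interpret h: bounded_linear h by fact
  obtain K where "compact K" "K \<subseteq> \<Omega>" "\<And>x. x \<notin> K \<Longrightarrow> f x = 0"
    using f by (rule test_functionsE) blast
  then show ?thesis
    by (intro test_functionsI[of _ K]) (auto intro: C_k_bounded_linear h test_functions_C_k f
        simp: h.zero)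
qed

lemma test_functions_partial:
  assumes f: "f \<in> test_functions \<Omega>" and b: "b \<in> Basis"
  shows "(\<lambda>x. frechet_derivative f (at x) b) \<in> test_functions \<Omega>"
proof -
  obtain K where K: "compact K" "K \<subseteq> \<Omega>" "\<And>x. x \<notin> K \<Longrightarrow> f x = 0"
    using f by (rule test_functionsE) blast
  show ?thesis
  proof (rule test_functionsI[OF _ K(1,2)])
    show "C_k k (\<lambda>x. frechet_derivative f (at x) b)" for k
      by (rule C_k_partial[OF test_functions_C_k[OF f] b])
    show "frechet_derivative f (at x) b = 0" if "x \<notin> K" for x
    proof -
      have "(f has_derivative (\<lambda>v. 0)) (at x)"
        by (rule has_derivative_transform_within_open[where f = "\<lambda>x. 0" and s = "- K"])
          (use K that in \<open>auto simp: compact_imp_closed open_Compl\<close>)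
      from frechet_derivative_at[OF this, symmetric] show ?thesis by simp
    qed
  qed
qed

lemma test_functions_continuous: "f \<in> test_functions \<Omega> \<Longrightarrow> continuous_on UNIV f"
  using test_functions_C_k[of f \<Omega> 0] by simp

section \<open>Smooth approximations of boxes\<close>

lemma poly_mult_exp_minus_tendsto_0:
  "((\<lambda>s::real. poly p s * exp (- s)) \<longlongrightarrow> 0) at_top"
proof -
  have "((\<lambda>s::real. \<Sum>i\<le>degree p. coeff p i * (s ^ i / exp s)) \<longlongrightarrow> (\<Sum>i\<le>degree p. coeff p i * 0)) at_top"
    by (intro tendsto_sum tendsto_mult tendsto_const tendsto_power_div_exp_0)
  then show ?thesis
    by (simp add: poly_altdef sum_distrib_right exp_minus divide_inverse mult.assoc)
qed

text \<open>Each derivative of \<open>exp (- 1 / t)\<close> is a polynomial in \<open>1 / t\<close> times \<open>exp (- 1 / t)\<close>, and this is the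
recursion for these polynomials.\<close>

fun bump_poly :: "nat \<Rightarrow> real poly" where
  "bump_poly 0 = 1"
| "bump_poly (Suc n) = [:0, 0, 1:] * (bump_poly n - pderiv (bump_poly n))"

definition bump :: "nat \<Rightarrow> real \<Rightarrow> real" where
  "bump n t = (if 0 < t then poly (bump_poly n) (1 / t) * exp (- (1 / t)) else 0)"

text \<open>The point \<open>t = 0\<close> is the one that matters. There the difference quotient from the right is, with
\<open>s = 1 / h\<close>, a polynomial in \<open>s\<close> times \<open>exp (- s)\<close>, and so tends to zero.\<close>

lemma bump_has_derivative: "(bump n has_real_derivative bump (Suc n) t) (at t)"
proof -
  consider "t < 0" | "t = 0" | "t > 0" by linarith
  then show ?thesis
  proof cases
    case 1
    have "((\<lambda>t. 0) has_real_derivative 0) (at t)" by simp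
    then have "(bump n has_real_derivative 0) (at t)"
      by (rule DERIV_cong_ev[THEN iffD1, rotated -1])
        (use 1 in \<open>auto simp: bump_def eventually_nhds intro!: exI[of _ "{..<0}"]\<close>)
    then show ?thesis using 1 by (simp add: bump_def)
  next
    case 2
    have "((\<lambda>h. bump n h / h) \<longlongrightarrow> 0) (at_right 0)"
      unfolding filterlim_at_right_to_top
    proof (rule Lim_transform_eventually)
      show "((\<lambda>s. poly (pCons 0 (bump_poly n)) s * exp (- s)) \<longlongrightarrow> 0) at_top"
        by (rule poly_mult_exp_minus_tendsto_0)
      show "\<forall>\<^sub>F s in at_top. poly (pCons 0 (bump_poly n)) s * exp (- s) =
          bump n (inverse s) / inverse s"
        using eventually_gt_at_top[of 0]
        by eventually_elim (simp add: bump_def divide_inverse)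
    qed
    moreover have "((\<lambda>h. bump n h / h) \<longlongrightarrow> 0) (at_left 0)"
      by (rule tendsto_eventually) (auto simp: eventually_at_left_field bump_def intro!: exI[of _ "-1"])
    ultimately have "((\<lambda>h. bump n h / h) \<longlongrightarrow> 0) (at 0)"
      by (simp add: filterlim_split_at)
    then show ?thesis using 2 by (simp add: DERIV_def bump_def)
  next
    case 3
    have "((\<lambda>t. poly (bump_poly n) (1 / t) * exp (- (1 / t))) has_real_derivative bump (Suc n) t) (at t)"
      using 3 by (auto intro!: derivative_eq_intros DERIV_chain'[OF _ poly_DERIV]
          simp: bump_def field_simps power2_eq_square)
    then show ?thesis
      by (rule DERIV_cong_ev[THEN iffD1, rotated -1])
        (use 3 in \<open>auto simp: bump_def eventually_nhds intro!: exI[of _ "{0<..}"]\<close>)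
  qed
qed

lemma bump_bounds: "0 \<le> bump 0 t" "bump 0 t \<le> 1"
  by (auto simp: bump_def)

lemma bump_scaled_tendsto: "(\<lambda>j. bump 0 (real (Suc j) * t)) \<longlonglongrightarrow> indicator {0<..} t"
proof (cases "0 < t")
  case True
  have "(\<lambda>j. inverse (real (Suc j)) * (1 / t)) \<longlonglongrightarrow> 0 * (1 / t)"
    by (intro tendsto_mult LIMSEQ_inverse_real_of_nat tendsto_const)
  then have "(\<lambda>j. exp (- (inverse (real (Suc j)) * (1 / t)))) \<longlonglongrightarrow> exp (- 0)"
    by (intro tendsto_exp tendsto_minus) simp
  then show ?thesis using True by (simp add: bump_def divide_inverse mult.commute)
next
  case False
  then have "bump 0 (real (Suc j) * t) = 0" for j
    by (simp add: bump_def zero_less_mult_iff)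
  then show ?thesis using False by simp
qed

text \<open>The factor \<open>Suc j\<close> inside the bump sends \<open>exp (- 1 / (Suc j * t))\<close> to \<open>1\<close> for every \<open>t > 0\<close>. The
products below therefore converge to the indicator of the open box, while their supports stay in
the closed box.\<close>

definition box_bump :: "'a::euclidean_space \<Rightarrow> 'a \<Rightarrow> nat \<Rightarrow> 'a \<Rightarrow> real" where
  "box_bump a b j x =
     (\<Prod>i\<in>Basis. bump 0 (real (Suc j) * (x \<bullet> i - a \<bullet> i)) * bump 0 (real (Suc j) * (b \<bullet> i - x \<bullet> i)))"

lemma box_bump_test_function:
  assumes "cbox a b \<subseteq> \<Omega>"
  shows "box_bump a b j \<in> test_functions \<Omega>"
proof (rule test_functionsI[OF _ compact_cbox assms])
  have "C_k k (\<lambda>x. bump 0 (x \<bullet> (real (Suc j) *\<^sub>R i) + - real (Suc j) * (a \<bullet> i)) *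
      bump 0 (x \<bullet> (- real (Suc j) *\<^sub>R i) + real (Suc j) * (b \<bullet> i)))" for k i
    by (intro C_k_mult C_k_affine bump_has_derivative)
  moreover have "real (Suc j) * (x \<bullet> i - a \<bullet> i) = x \<bullet> (real (Suc j) *\<^sub>R i) + - real (Suc j) * (a \<bullet> i)"
      "real (Suc j) * (b \<bullet> i - x \<bullet> i) = x \<bullet> (- real (Suc j) *\<^sub>R i) + real (Suc j) * (b \<bullet> i)" for x i
    by (simp_all add: algebra_simps)
  ultimately show "C_k k (box_bump a b j)" for k
    unfolding box_bump_def by (intro C_k_prod) auto
  show "box_bump a b j x = 0" if x: "x \<notin> cbox a b" for x
  proof -
    obtain i where "i \<in> Basis" "x \<bullet> i < a \<bullet> i \<or> b \<bullet> i < x \<bullet> i"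
      using x by (auto simp: mem_box not_le)
    then show ?thesis
      unfolding box_bump_def
      by (intro prod_zero) (auto intro!: bexI[of _ i] simp: bump_def zero_less_mult_iff)
  qed
qed

lemma box_bump_bounds: "0 \<le> box_bump a b j x" "box_bump a b j x \<le> 1"
  unfolding box_bump_def using bump_bounds
  by (auto intro!: prod_nonneg prod_le_1 mult_le_one)

lemma box_bump_tendsto: "(\<lambda>j. box_bump a b j x) \<longlonglongrightarrow> indicator (box a b) x"
proof -
  have "(\<lambda>j. box_bump a b j x) \<longlonglongrightarrow>
      (\<Prod>i\<in>Basis. indicator {0<..} (x \<bullet> i - a \<bullet> i) * indicator {0<..} (b \<bullet> i - x \<bullet> i))"
    unfolding box_bump_def by (intro tendsto_prod tendsto_mult bump_scaled_tendsto)
  also have "(\<Prod>i\<in>Basis. indicator {0<..} (x \<bullet> i - a \<bullet> i) * indicator {0<..} (b \<bullet> i - x \<bullet> i)) =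
      (indicator (box a b) x :: real)"
  proof (cases "x \<in> box a b")
    case True
    then show ?thesis by (simp add: mem_box)
  next
    case False
    then obtain i where "i \<in> Basis" "\<not> (a \<bullet> i < x \<bullet> i \<and> x \<bullet> i < b \<bullet> i)"
      by (auto simp: mem_box)
    then show ?thesis using False by (auto intro!: prod_zero bexI[of _ i])
  qed
  finally show ?thesis .
qed

section \<open>Square integrable functions\<close>

definition L2 :: "'a measure \<Rightarrow> ('a \<Rightarrow> 'b::euclidean_space) set" where
  "L2 M = {f \<in> borel_measurable M. integrable M (\<lambda>x. (norm (f x))\<^sup>2)}"

definition L2_inner :: "'a measure \<Rightarrow> ('a \<Rightarrow> 'b::euclidean_space) \<Rightarrow> ('a \<Rightarrow> 'b) \<Rightarrow> real" where
  "L2_inner M f g = (\<integral>x. f x \<bullet> g x \<partial>M)"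

abbreviation L2_norm :: "'a measure \<Rightarrow> ('a \<Rightarrow> 'b::euclidean_space) \<Rightarrow> real" where
  "L2_norm M \<equiv> ip_norm (L2_inner M)"

lemma L2_measurable [measurable_dest]: "f \<in> L2 M \<Longrightarrow> f \<in> borel_measurable M"
  by (simp add: L2_def)

lemma L2_integrable_square: "f \<in> L2 M \<Longrightarrow> integrable M (\<lambda>x. (norm (f x))\<^sup>2)"
  by (simp add: L2_def)

lemma L2_norm_eq: "L2_norm M f = sqrt (\<integral>x. (norm (f x))\<^sup>2 \<partial>M)"
  by (simp add: ip_norm_def L2_inner_def power2_norm_eq_inner)

lemma product_le_squares: "\<bar>a * b\<bar> \<le> a\<^sup>2 + b\<^sup>2" for a b :: real
  using sum_squares_bound[of "\<bar>a\<bar>" "\<bar>b\<bar>"] zero_le_power2[of "\<bar>a\<bar>"] zero_le_power2[of "\<bar>b\<bar>"]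
  unfolding abs_mult power2_abs by linarith

lemma L2_integrable_norm_mult:
  assumes f: "f \<in> L2 M" and g: "g \<in> L2 M"
  shows "integrable M (\<lambda>x. norm (f x) * norm (g x))"
proof (rule Bochner_Integration.integrable_bound)
  show "integrable M (\<lambda>x. (norm (f x))\<^sup>2 + (norm (g x))\<^sup>2)"
    using f g by (auto dest: L2_integrable_square)
  show "AE x in M. norm (norm (f x) * norm (g x)) \<le> norm ((norm (f x))\<^sup>2 + (norm (g x))\<^sup>2)"
    using product_le_squares[of "norm (f x)" "norm (g x)" for x] by (intro AE_I2) simp
qed (use f g in measurable)

lemma L2_integrable_inner:
  assumes "f \<in> L2 M" "g \<in> L2 M"
  shows "integrable M (\<lambda>x. f x \<bullet> g x)"
  by (rule Bochner_Integration.integrable_bound[OF L2_integrable_norm_mult[OF assms]])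
    (use assms in \<open>auto simp: Cauchy_Schwarz_ineq2 intro: borel_measurable_inner L2_measurable\<close>)

lemma L2_integrable_scaleR:
  fixes f :: "'a \<Rightarrow> real" and g :: "'a \<Rightarrow> 'b::euclidean_space"
  assumes f: "f \<in> L2 M" and g: "g \<in> L2 M"
  shows "integrable M (\<lambda>x. f x *\<^sub>R g x)"
  by (rule Bochner_Integration.integrable_bound[OF L2_integrable_norm_mult[OF assms]])
    (use assms in \<open>auto intro: borel_measurable_scaleR L2_measurable\<close>)

lemma L2_bound:
  assumes "g \<in> L2 M" and "f \<in> borel_measurable M" and "AE x in M. norm (f x) \<le> c * norm (g x)"
  shows "f \<in> L2 M"
proof -
  have "integrable M (\<lambda>x. (norm (f x))\<^sup>2)"
  proof (rule Bochner_Integration.integrable_bound)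
    show "integrable M (\<lambda>x. c\<^sup>2 * (norm (g x))\<^sup>2)"
      using assms(1) by (auto dest: L2_integrable_square)
    show "AE x in M. norm ((norm (f x))\<^sup>2) \<le> norm (c\<^sup>2 * (norm (g x))\<^sup>2)"
      using assms(3)
    proof eventually_elim
      case (elim x)
      then have "(norm (f x))\<^sup>2 \<le> (c * norm (g x))\<^sup>2" by (intro power_mono) auto
      then show ?case by (simp add: power_mult_distrib)
    qed
  qed (use assms(2) in measurable)
  then show ?thesis using assms(2) by (simp add: L2_def)
qed

lemma L2_scale: "f \<in> L2 M \<Longrightarrow> (\<lambda>x. c *\<^sub>R f x) \<in> L2 M"
  by (rule L2_bound[where c = "\<bar>c\<bar>"]) (auto intro: borel_measurable_scaleR L2_measurable)

lemma L2_add: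
  assumes f: "f \<in> L2 M" and g: "g \<in> L2 M"
  shows "(\<lambda>x. f x + g x) \<in> L2 M"
proof -
  have "integrable M (\<lambda>x. (norm (f x))\<^sup>2 + 2 * (f x \<bullet> g x) + (norm (g x))\<^sup>2)"
    using f g by (intro Bochner_Integration.integrable_add integrable_mult_right
        L2_integrable_inner L2_integrable_square)
  moreover have "(norm (f x))\<^sup>2 + 2 * (f x \<bullet> g x) + (norm (g x))\<^sup>2 = (norm (f x + g x))\<^sup>2" for x
    by (simp add: power2_norm_eq_inner inner_simps inner_commute)
  ultimately show ?thesis
    using borel_measurable_add[OF L2_measurable[OF f] L2_measurable[OF g]] by (simp add: L2_def)
qed

interpretation L2: semi_inner_space "L2 M" "L2_inner M" for M
proof
  fix f g h :: "'a \<Rightarrow> 'b" and c :: real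
  assume f: "f \<in> L2 M" and g: "g \<in> L2 M"
  show "(\<lambda>x. f x + g x) \<in> L2 M" by (rule L2_add[OF f g])
  show "L2_inner M f g = L2_inner M g f" by (simp add: L2_inner_def inner_commute)
  show "L2_inner M (\<lambda>x. c *\<^sub>R f x) g = c * L2_inner M f g" by (simp add: L2_inner_def)
  show "L2_inner M (\<lambda>x. f x + g x) h = L2_inner M f h + L2_inner M g h" if "h \<in> L2 M"
    using L2_integrable_inner[OF f that] L2_integrable_inner[OF g that]
    by (simp add: L2_inner_def inner_add_left)
qed (auto simp: L2_scale L2_inner_def intro: integral_nonneg_AE)

lemma L2_norm_cong_AE:
  assumes "f \<in> L2 M" "g \<in> L2 M" and ae: "AE x in M. f x = g x"
  shows "L2_norm M f = L2_norm M g"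
proof -
  have "(\<integral>x. (norm (f x))\<^sup>2 \<partial>M) = (\<integral>x. (norm (g x))\<^sup>2 \<partial>M)"
    using assms by (intro integral_cong_AE) (auto dest: L2_integrable_square)
  then show ?thesis by (simp add: L2_norm_eq)
qed

lemma L2_scaleR_integral_bound:
  fixes f :: "'a \<Rightarrow> real" and g :: "'a \<Rightarrow> 'b::euclidean_space"
  assumes f: "f \<in> L2 M" and g: "g \<in> L2 M"
  shows "norm (\<integral>x. f x *\<^sub>R g x \<partial>M) \<le> L2_norm M f * L2_norm M g"
proof -
  have L: "(\<lambda>x. norm (f x)) \<in> L2 M" "(\<lambda>x. norm (g x)) \<in> L2 M"
    using f g by (auto simp: L2_def)
  have "norm (\<integral>x. f x *\<^sub>R g x \<partial>M) \<le> (\<integral>x. norm (f x) * norm (g x) \<partial>M)"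
    using integral_norm_bound[of M "\<lambda>x. f x *\<^sub>R g x"] by simp
  also have "\<dots> = L2_inner M (\<lambda>x. norm (f x)) (\<lambda>x. norm (g x))"
    by (simp add: L2_inner_def)
  also have "\<dots> \<le> L2_norm M (\<lambda>x. norm (f x)) * L2_norm M (\<lambda>x. norm (g x))"
    using L2.Cauchy_Schwarz[OF L] by linarith
  also have "\<dots> = L2_norm M f * L2_norm M g"
    by (simp add: L2_norm_eq)
  finally show ?thesis .
qed

section \<open>Lebesgue integrals of functions with a Borel version\<close>

lemma integral_lebesgue_borel:
  fixes f :: "'a::euclidean_space \<Rightarrow> 'b::{banach, second_countable_topology}"
  assumes "f \<in> borel_measurable borel"
  shows "integral\<^sup>L lebesgue f = integral\<^sup>L lborel f"
  using assms by (intro integral_completion) simp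

lemma integrable_lebesgue_borel:
  fixes f :: "'a::euclidean_space \<Rightarrow> 'b::{banach, second_countable_topology}"
  assumes "f \<in> borel_measurable borel"
  shows "integrable lebesgue f \<longleftrightarrow> integrable lborel f"
  using assms by (intro integrable_completion) simp

lemma set_integral_eq_integral:
  assumes "\<And>x. x \<notin> \<Omega> \<Longrightarrow> f x = 0"
  shows "(LINT x:\<Omega>|M. f x) = (\<integral>x. f x \<partial>M)"
  unfolding set_lebesgue_integral_def
  by (intro Bochner_Integration.integral_cong) (use assms in \<open>auto simp: indicator_def\<close>)

lemma L2_lebesgue_borel:
  fixes f :: "'a::euclidean_space \<Rightarrow> 'b::euclidean_space"
  assumes "f \<in> L2 lborel"
  shows "f \<in> L2 lebesgue" and "L2_norm lebesgue f = L2_norm lborel f"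
proof -
  have m: "f \<in> borel_measurable borel" and i: "integrable lborel (\<lambda>x. (norm (f x))\<^sup>2)"
    using assms by (auto simp: L2_def)
  have n: "(\<lambda>x. (norm (f x))\<^sup>2) \<in> borel_measurable borel" using m by measurable
  show "f \<in> L2 lebesgue"
    using m i by (simp add: L2_def integrable_lebesgue_borel[OF n] measurable_completion)
  show "L2_norm lebesgue f = L2_norm lborel f"
    by (simp add: L2_norm_eq integral_lebesgue_borel[OF n])
qed

lemma (in complete_measure) measurable_cong_AE_complete:
  assumes g: "g \<in> measurable M N" and f: "f \<in> space M \<rightarrow> space N"
    and ae: "AE x in M. f x = g x"
  shows "f \<in> measurable M N"
proof (rule measurableI)
  fix A assume A: "A \<in> sets N"
  have "AE x in M. x \<in> g -` A \<inter> space M \<longleftrightarrow> x \<in> f -` A \<inter> space M"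
    using ae by eventually_elim auto
  then show "f -` A \<inter> space M \<in> sets M"
    by (rule in_sets_AE) (use measurable_sets[OF g A] in auto)
qed (use f in auto)

text \<open>Integrals with respect to the completed measure reduce to integrals of Borel functions, for which
product measures are available. The left-hand function is measurable because the measure is complete.\<close>

lemma integral_lebesgue_cong_AE:
  fixes f g :: "'a::euclidean_space \<Rightarrow> 'b::{banach, second_countable_topology}"
  assumes g: "g \<in> borel_measurable borel" and ae: "AE x in lborel. f x = g x"
  shows "integral\<^sup>L lebesgue f = integral\<^sup>L lborel g"
proof -
  have ae': "AE x in lebesgue. f x = g x" using ae by (rule AE_completion)
  have g': "g \<in> borel_measurable lebesgue" using g by (simp add: measurable_completion)
  have "f \<in> borel_measurable lebesgue"
    by (rule completion.measurable_cong_AE_complete[OF g' _ ae']) simp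
  then have "integral\<^sup>L lebesgue f = integral\<^sup>L lebesgue g"
    using g' ae' by (intro integral_cong_AE)
  then show ?thesis using g by (simp add: integral_lebesgue_borel)
qed

lemma L2_on_iff: "f \<in> L2_on \<Omega> \<longleftrightarrow> (\<lambda>x. indicator \<Omega> x *\<^sub>R f x) \<in> L2 lebesgue"
proof -
  have "(norm (indicator \<Omega> x *\<^sub>R f x))\<^sup>2 = indicator \<Omega> x *\<^sub>R (norm (f x))\<^sup>2" for x
    by (simp add: indicator_def)
  then show ?thesis
    by (simp add: L2_on_def L2_def set_borel_measurable_def set_integrable_def)
qed

lemma compact_support_integrable:
  fixes f :: "'a::euclidean_space \<Rightarrow> 'b::euclidean_space"
  assumes f: "continuous_on UNIV f" and K: "compact K" "\<And>x. x \<notin> K \<Longrightarrow> f x = 0"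
  shows "integrable lborel f"
proof -
  have "integrable lborel (\<lambda>x. indicator K x *\<^sub>R f x)"
    using f K by (intro borel_integrable_compact) (auto intro: continuous_on_subset)
  moreover have "indicator K x *\<^sub>R f x = f x" for x
    using K(2)[of x] by (simp add: indicator_def)
  ultimately show ?thesis by simp
qed

lemma compact_support_L2:
  fixes f :: "'a::euclidean_space \<Rightarrow> 'b::euclidean_space"
  assumes f: "continuous_on UNIV f" and K: "compact K" "\<And>x. x \<notin> K \<Longrightarrow> f x = 0"
  shows "f \<in> L2 lborel"
proof -
  have "integrable lborel (\<lambda>x. (norm (f x))\<^sup>2)"
    by (rule compact_support_integrable[OF _ K(1)]) (use K(2) f in \<open>auto intro!: continuous_intros\<close>)
  then show ?thesis
    using borel_measurable_continuous_onI[OF f] by (simp add: L2_def)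
qed

section \<open>Integration by parts\<close>

lemma integral_translate:
  fixes f :: "'a::euclidean_space \<Rightarrow> real"
  assumes "f \<in> borel_measurable borel"
  shows "(\<integral>x. f (x + c) \<partial>lborel) = (\<integral>x. f x \<partial>lborel)"
proof -
  have "(\<integral>x. f x \<partial>lborel) = (\<integral>x. f x \<partial>distr lborel borel ((+) c))"
    by (simp add: lborel_distr_plus)
  also have "\<dots> = (\<integral>x. f (c + x) \<partial>lborel)"
    using assms by (intro integral_distr) auto
  finally show ?thesis by (simp add: add.commute)
qed

text \<open>The difference quotients in direction \<open>b\<close> have integral zero, because the Lebesgue measure is
translation invariant. They converge to the partial derivative, they vanish outside a fixed ball,
and the mean value theorem bounds them uniformly, so the limit has integral zero as well.\<close>

lemma integral_partial_derivative_eq_0: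
  fixes f :: "'a::euclidean_space \<Rightarrow> real"
  assumes f: "C_k (Suc 0) f" and K: "compact K" "\<And>x. x \<notin> K \<Longrightarrow> f x = 0"
    and b: "b \<in> Basis"
  shows "(\<integral>x. frechet_derivative f (at x) b \<partial>lborel) = 0"
proof -
  define f' where "f' x = frechet_derivative f (at x) b" for x
  define F where "F n x = real (Suc n) * (f (x + inverse (real (Suc n)) *\<^sub>R b) - f x)" for n x
  have cf: "continuous_on UNIV f" and cf': "continuous_on UNIV f'"
    using C_k_decr[OF f] C_k_partial[OF f b] by (simp_all add: f'_def)
  have der: "((\<lambda>t. f (x + t *\<^sub>R b)) has_real_derivative f' (x + t *\<^sub>R b)) (at t)" for x t
  proof -
    have "((\<lambda>t. f (x + t *\<^sub>R b)) has_derivative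
        (\<lambda>s. frechet_derivative f (at (x + t *\<^sub>R b)) (s *\<^sub>R b))) (at t)"
      by (rule has_derivative_compose[OF _ has_frechet_derivative[OF f]])
        (auto intro!: derivative_eq_intros)
    moreover have "frechet_derivative f (at y) (s *\<^sub>R b) = f' y * s" for y s
      using linear_cmul[OF has_derivative_linear[OF has_frechet_derivative[OF f]]]
      by (simp add: f'_def mult.commute)
    ultimately show ?thesis by (simp add: has_field_derivative_def)
  qed
  obtain R where R: "0 < R" "K \<subseteq> cball 0 R"
    using compact_imp_bounded[OF K(1)] by (auto simp: bounded_pos subset_iff)
  have f0: "f x = 0" if "R < norm x" for x
    using K(2)[of x] subsetD[OF R(2), of x] that by fastforce
  \<comment> \<open>The quotients live in the ball of radius \<open>R + 1\<close>, and the mean value theorem looks one unit further.\<close>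
  obtain B where B: "\<And>x. norm x \<le> R + 1 + 1 \<Longrightarrow> \<bar>f' x\<bar> \<le> B"
  proof -
    have "bounded (f' ` cball 0 (R + 1 + 1))"
      by (intro compact_imp_bounded compact_continuous_image continuous_on_subset[OF cf'] compact_cball)
        auto
    then obtain B where "\<forall>x\<in>cball 0 (R + 1 + 1). norm (f' x) \<le> B"
      by (auto simp: bounded_iff)
    then show ?thesis using that[of B] by simp
  qed
  have F_bound: "\<bar>F n x\<bar> \<le> B * indicator (cball 0 (R + 1)) x" for n x
  proof -
    define h where "h = inverse (real (Suc n))"
    have h: "0 < h" "h \<le> 1" by (auto simp: h_def inverse_le_1_iff)
    have nb: "norm (t *\<^sub>R b) = \<bar>t\<bar>" for t using b by simp
    show ?thesis
    proof (cases "norm x \<le> R + 1")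
      case True
      obtain z where z: "0 < z" "z < h" "f (x + h *\<^sub>R b) - f (x + 0 *\<^sub>R b) = (h - 0) * f' (x + z *\<^sub>R b)"
        using MVT2[OF h(1) der] by blast
      have "norm (x + z *\<^sub>R b) \<le> R + 1 + 1"
        using norm_triangle_ineq[of x "z *\<^sub>R b"] nb[of z] z h True by linarith
      moreover have "F n x = f' (x + z *\<^sub>R b)"
        using z(3) h(1) by (simp add: F_def h_def)
      ultimately show ?thesis using B True by simp
    next
      case False
      have "norm x - h \<le> norm (x + h *\<^sub>R b)"
        using norm_diff_ineq[of x "h *\<^sub>R b"] nb[of h] h by linarith
      then have "F n x = 0" using f0[of x] f0[of "x + h *\<^sub>R b"] False h by (simp add: F_def h_def)
      then show ?thesis using False by simp
    qed
  qed
  have meas: "f \<in> borel_measurable borel" "f' \<in> borel_measurable borel"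
    using cf cf' by (auto intro: borel_measurable_continuous_onI)
  have int_f: "integrable lborel f"
    by (rule compact_support_integrable[OF cf K])
  have int_F: "(\<integral>x. F n x \<partial>lborel) = 0" for n
  proof -
    have "integrable lborel (\<lambda>x. f (x + inverse (real (Suc n)) *\<^sub>R b))"
    proof (rule compact_support_integrable)
      show "continuous_on UNIV (\<lambda>x. f (x + inverse (real (Suc n)) *\<^sub>R b))"
        by (rule continuous_on_compose2[OF cf]) (auto intro!: continuous_intros)
      show "compact ((\<lambda>x. x - inverse (real (Suc n)) *\<^sub>R b) ` K)"
        by (intro compact_continuous_image K continuous_intros)
      show "f (x + inverse (real (Suc n)) *\<^sub>R b) = 0"
        if "x \<notin> (\<lambda>x. x - inverse (real (Suc n)) *\<^sub>R b) ` K" for x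
      proof (rule K(2), rule notI)
        assume "x + inverse (real (Suc n)) *\<^sub>R b \<in> K"
        with that show False by (auto simp: image_iff)
      qed
    qed
    then show ?thesis
      unfolding F_def using int_f integral_translate[OF meas(1)] by simp
  qed
  have "(\<lambda>n. \<integral>x. F n x \<partial>lborel) \<longlonglongrightarrow> (\<integral>x. f' x \<partial>lborel)"
  proof (rule integral_dominated_convergence)
    show "F n \<in> borel_measurable lborel" for n
      unfolding F_def using meas(1) by measurable
    show "integrable lborel (\<lambda>x. B * indicator (cball 0 (R + 1)) x)"
      by (intro integrable_mult_right integrable_real_indicator)
        (use emeasure_bounded_finite[OF bounded_cball, of 0 "R + 1"] in auto)
    have "(\<lambda>n. F n x) \<longlonglongrightarrow> f' x" for x
    proof -
      have "((\<lambda>h. (f (x + h *\<^sub>R b) - f x) / h) \<longlongrightarrow> f' x) (at 0)"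
        using der[of x 0] by (simp add: DERIV_def)
      moreover have "filterlim (\<lambda>n. inverse (real (Suc n))) (at 0) sequentially"
        using LIMSEQ_inverse_real_of_nat by (simp add: filterlim_at)
      ultimately have "(\<lambda>n. (f (x + inverse (real (Suc n)) *\<^sub>R b) - f x) / inverse (real (Suc n)))
          \<longlonglongrightarrow> f' x"
        by (rule filterlim_compose)
      then show ?thesis by (simp add: F_def divide_inverse mult.commute)
    qed
    then show "AE x in lborel. (\<lambda>n. F n x) \<longlonglongrightarrow> f' x" by simp
    show "AE x in lborel. norm (F n x) \<le> B * indicator (cball 0 (R + 1)) x" for n
      using F_bound by simp
  qed (use meas in simp)
  then have "(\<integral>x. f' x \<partial>lborel) = 0"
    using int_F by (simp add: LIMSEQ_const_iff)
  then show ?thesis by (simp add: f'_def)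
qed

lemma integral_by_parts_test_function:
  fixes f \<phi> :: "'a::euclidean_space \<Rightarrow> real"
  assumes f: "f \<in> test_functions \<Omega>" and \<phi>: "\<phi> \<in> test_functions \<Omega>" and b: "b \<in> Basis"
  shows "(\<integral>x. f x * frechet_derivative \<phi> (at x) b \<partial>lborel) =
    - (\<integral>x. frechet_derivative f (at x) b * \<phi> x \<partial>lborel)"
proof -
  obtain K where K: "compact K" "K \<subseteq> \<Omega>" "\<And>x. x \<notin> K \<Longrightarrow> f x = 0"
    using f by (rule test_functionsE) blast
  obtain L where L: "compact L" "L \<subseteq> \<Omega>" "\<And>x. x \<notin> L \<Longrightarrow> \<phi> x = 0"
    using \<phi> by (rule test_functionsE) blast
  have Cf: "C_k (Suc 0) f" "C_k (Suc 0) \<phi>" using f \<phi> test_functions_C_k by blast+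
  note cont = test_functions_continuous[OF f] test_functions_continuous[OF \<phi>]
    test_functions_continuous[OF test_functions_partial[OF f b]]
    test_functions_continuous[OF test_functions_partial[OF \<phi> b]]
  have "((\<lambda>x. f x * \<phi> x) has_derivative (\<lambda>v. f x * frechet_derivative \<phi> (at x) v +
      frechet_derivative f (at x) v * \<phi> x)) (at x)" for x
    by (intro has_derivative_mult has_frechet_derivative[OF Cf(1)] has_frechet_derivative[OF Cf(2)])
  from frechet_derivative_at[OF this, symmetric]
  have "frechet_derivative (\<lambda>x. f x * \<phi> x) (at x) b =
      f x * frechet_derivative \<phi> (at x) b + frechet_derivative f (at x) b * \<phi> x" for x
    by simp
  moreover have "(\<integral>x. frechet_derivative (\<lambda>x. f x * \<phi> x) (at x) b \<partial>lborel) = 0"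
    by (rule integral_partial_derivative_eq_0[OF C_k_mult[OF Cf] K(1) _ b]) (simp add: K(3))
  moreover have "integrable lborel (\<lambda>x. f x * frechet_derivative \<phi> (at x) b)"
    by (rule compact_support_integrable[OF _ K(1)]) (auto simp: K(3) intro: continuous_on_mult cont)
  moreover have "integrable lborel (\<lambda>x. frechet_derivative f (at x) b * \<phi> x)"
    by (rule compact_support_integrable[OF _ L(1)]) (auto simp: L(3) intro: continuous_on_mult cont)
  ultimately show ?thesis by simp
qed


section \<open>Test functions determine integrable functions\<close>

text \<open>Orthogonality to the smooth approximations of the box passes to the limit by dominated convergence.\<close>

lemma test_functions_separate_boxes:
  fixes g :: "'a::euclidean_space \<Rightarrow> real"
  assumes g: "integrable lebesgue g"
    and orth: "\<And>\<phi>. \<phi> \<in> test_functions \<Omega> \<Longrightarrow> (\<integral>x. g x * \<phi> x \<partial>lebesgue) = 0"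
    and ab: "cbox a b \<subseteq> \<Omega>"
  shows "(\<integral>x. g x * indicator (box a b) x \<partial>lebesgue) = 0"
proof -
  have meas: "box_bump a b j \<in> borel_measurable lebesgue" for j
    using test_functions_continuous[OF box_bump_test_function[OF ab], of j]
    by (intro measurable_completion) (simp add: borel_measurable_continuous_onI)
  have "(\<lambda>j. \<integral>x. g x * box_bump a b j x \<partial>lebesgue) \<longlonglongrightarrow> (\<integral>x. g x * indicator (box a b) x \<partial>lebesgue)"
  proof (rule integral_dominated_convergence)
    show "integrable lebesgue (\<lambda>x. norm (g x))" using g by simp
    show "AE x in lebesgue. (\<lambda>j. g x * box_bump a b j x) \<longlonglongrightarrow> g x * indicator (box a b) x"
      by (intro AE_I2 tendsto_mult tendsto_const box_bump_tendsto)
    show "AE x in lebesgue. norm (g x * box_bump a b j x) \<le> norm (g x)" for j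
      using box_bump_bounds[of a b j] by (intro AE_I2) (simp add: abs_mult mult_left_le)
    show "(\<lambda>x. g x * indicator (box a b) x) \<in> borel_measurable lebesgue"
      using g by (intro borel_measurable_times borel_measurable_indicator) auto
  qed (use g meas in auto)
  then show ?thesis
    using orth[OF box_bump_test_function[OF ab]] by (simp add: LIMSEQ_const_iff)
qed

text \<open>Boxes are stable under intersection and generate the Borel sets. The sets with vanishing integral are
closed under complements, which uses the last hypothesis, and under countable disjoint unions.\<close>

lemma AE_eq_0_if_box_integrals_eq_0:
  fixes h :: "'a::euclidean_space \<Rightarrow> real"
  assumes h: "integrable lborel h"
    and box: "\<And>a b. (LINT x:box a b|lborel. h x) = 0" and UNIV: "(\<integral>x. h x \<partial>lborel) = 0"
  shows "AE x in lborel. h x = 0"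
proof (rule density_unique_real[OF h])
  fix E :: "'a set" assume "E \<in> sets lborel"
  have si: "set_integrable lborel A h" if "A \<in> sets borel" for A
    unfolding set_integrable_def using h that by (intro integrable_mult_indicator) auto
  let ?G = "range (\<lambda>(a, b). box a b :: 'a set)"
  have sets: "sigma_sets UNIV ?G = sets borel"
    by (subst borel_eq_box) simp
  have "(LINT x:E|lborel. h x) = 0"
  proof (rule sigma_sets_induct_disjoint[of ?G UNIV])
    show "Int_stable ?G" by (auto simp: Int_stable_def box_Int_box)
    show "E \<in> sigma_sets UNIV ?G" using \<open>E \<in> sets lborel\<close> sets by simp
  next
    fix A assume "A \<in> sigma_sets UNIV ?G" and A0: "(LINT x:A|lborel. h x) = 0"
    then have A: "A \<in> sets borel" using sets by simp
    have "(LINT x:(UNIV - A)|lborel. h x) = (\<integral>x. h x - indicator A x *\<^sub>R h x \<partial>lborel)"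
      unfolding set_lebesgue_integral_def
      by (intro Bochner_Integration.integral_cong) (auto simp: indicator_def)
    also have "\<dots> = 0"
      using si[OF A] h A0 UNIV by (simp add: set_integrable_def set_lebesgue_integral_def)
    finally show "(LINT x:(UNIV - A)|lborel. h x) = 0" .
  next
    fix A :: "nat \<Rightarrow> 'a set"
    assume disj: "disjoint_family A" and "range A \<subseteq> sigma_sets UNIV ?G"
      and 0: "\<And>i. (LINT x:A i|lborel. h x) = 0"
    then have A: "A i \<in> sets borel" for i using sets by auto
    have "(LINT x:(\<Union>i. A i)|lborel. h x) = (\<Sum>i. (LINT x:A i|lborel. h x))"
      using disj A by (intro lebesgue_integral_countable_add si)
        (auto simp: disjoint_family_on_def)
    then show "(LINT x:(\<Union>i. A i)|lborel. h x) = 0" using 0 by simp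
  qed (use box in \<open>auto simp: set_lebesgue_integral_def\<close>)
  then show "(LINT x:E|lborel. h x) = (LINT x:E|lborel. 0)" by simp
qed simp

text \<open>The function is first cut off to a box whose closure lies in \<open>\<Omega>\<close>. Every box meets this one in a box
whose closure also lies in \<open>\<Omega>\<close>, so all box integrals of the truncated function vanish. Countably many
such boxes exhaust \<open>\<Omega>\<close> up to a null set.\<close>

lemma test_functions_separate:
  fixes g :: "'a::euclidean_space \<Rightarrow> real"
  assumes \<Omega>: "open \<Omega>" and g: "integrable lebesgue g"
    and orth: "\<And>\<phi>. \<phi> \<in> test_functions \<Omega> \<Longrightarrow> (\<integral>x. g x * \<phi> x \<partial>lebesgue) = 0"
  shows "AE x in lebesgue. x \<in> \<Omega> \<longrightarrow> g x = 0"
proof -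
  have cbox: "AE x in lebesgue. x \<in> cbox a b \<longrightarrow> g x = 0" if ab: "cbox a b \<subseteq> \<Omega>" for a b
  proof -
    define k where "k x = g x * indicator (box a b) x" for x
    have k: "integrable lebesgue k"
      unfolding k_def using g by (intro integrable_real_mult_indicator) auto
    obtain h where h: "h \<in> borel_measurable lborel" "AE x in lborel. k x = h x"
      using completion_ex_borel_measurable_real[of k lborel] k by blast
    have hm: "h \<in> borel_measurable borel" using h by simp
    have "integrable lebesgue h"
      using k h by (intro integrable_cong_AE_imp[OF k]) (auto intro: measurable_completion AE_completion elim: eventually_mono)
    then have h_int: "integrable lborel h" by (simp add: integrable_lebesgue_borel[OF hm])
    have box: "(LINT x:box c d|lborel. h x) = 0" for c d
    proof -
      have "(LINT x:box c d|lborel. h x) = (\<integral>x. indicator (box c d) x *\<^sub>R k x \<partial>lebesgue)"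
        unfolding set_lebesgue_integral_def
        by (rule integral_lebesgue_cong_AE[symmetric])
          (use hm h(2) in \<open>auto elim: eventually_mono\<close>)
      also have "\<dots> = (\<integral>x. g x * indicator (box a b \<inter> box c d) x \<partial>lebesgue)"
        by (intro Bochner_Integration.integral_cong) (auto simp: k_def indicator_def)
      also have "\<dots> = 0"
        unfolding box_Int_box
        by (rule test_functions_separate_boxes[OF g orth]) (use ab in \<open>auto simp flip: Int_interval\<close>)
      finally show ?thesis .
    qed
    have "(\<integral>x. h x \<partial>lborel) = (\<integral>x. k x \<partial>lebesgue)"
      by (rule integral_lebesgue_cong_AE[symmetric]) (use hm h(2) in auto)
    also have "\<dots> = 0"
      unfolding k_def by (rule test_functions_separate_boxes[OF g orth ab])
    finally have "AE x in lborel. h x = 0"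
      by (intro AE_eq_0_if_box_integrals_eq_0 h_int box)
    with h(2) have "AE x in lborel. k x = 0" by eventually_elim simp
    then have "AE x in lebesgue. k x = 0" by (rule AE_completion)
    moreover have "AE x in lebesgue. x \<notin> cbox a b - box a b"
      using negligible_frontier_interval[of a b]
      by (intro AE_not_in) (simp add: negligible_iff_null_sets)
    ultimately show ?thesis by eventually_elim (auto simp: k_def)
  qed
  obtain D where D: "countable D" "D \<subseteq> Pow \<Omega>" "\<And>X. X \<in> D \<Longrightarrow> \<exists>a b. X = cbox a b" "\<Union>D = \<Omega>"
    using open_countable_Union_open_cbox[OF \<Omega>] by blast
  have "AE x in lebesgue. x \<in> X \<longrightarrow> g x = 0" if X: "X \<in> D" for X
  proof -
    obtain a b where "X = cbox a b" using D(3)[OF X] by blast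
    then show ?thesis using cbox[of a b] D(2) X by blast
  qed
  then have "AE x in lebesgue. \<forall>X\<in>D. x \<in> X \<longrightarrow> g x = 0"
    using AE_ball_countable[OF D(1), of "\<lambda>x X. x \<in> X \<longrightarrow> g x = 0"] by blast
  then show ?thesis by eventually_elim (use D(4) in auto)
qed

section \<open>The Jacobian matrix as a weak gradient\<close>

lemma jacobian_nth:
  fixes u :: "real^'n \<Rightarrow> real^'n"
  shows "jacobian u (at x) $ k $ m = frechet_derivative u (at x) (axis m 1) $ k"
  by (simp add: jacobian_def matrix_def)

lemma jacobian_test_function:
  fixes u :: "real^'n \<Rightarrow> real^'n"
  assumes u: "u \<in> test_functions \<Omega>"
  shows "continuous_on UNIV (\<lambda>x. jacobian u (at x))"
    and "(\<lambda>x. jacobian u (at x)) \<in> L2 lborel"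
    and "x \<notin> \<Omega> \<Longrightarrow> jacobian u (at x) = 0"
    and "(\<lambda>x. jacobian u (at x) $ k $ m) \<in> test_functions \<Omega>"
    and "frechet_derivative (\<lambda>x. u x $ k) (at x) (axis m 1) = jacobian u (at x) $ k $ m"
proof -
  have ax: "axis m (1::real) \<in> (Basis :: (real^'n) set)" for m :: 'n
    by (auto simp: Basis_vec_def)
  have comp: "(\<lambda>x. jacobian u (at x) $ k $ m) \<in> test_functions \<Omega>" for k m
    unfolding jacobian_nth
    by (rule test_functions_bounded_linear[OF bounded_linear_vec_nth test_functions_partial[OF u ax]])
  then show "(\<lambda>x. jacobian u (at x) $ k $ m) \<in> test_functions \<Omega>" .
  show cont: "continuous_on UNIV (\<lambda>x. jacobian u (at x))"
  proof -
    have "continuous_on UNIV (\<lambda>x. \<chi> k m. jacobian u (at x) $ k $ m)"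
      by (intro continuous_on_vec_lambda test_functions_continuous[OF comp])
    then show ?thesis by (simp add: vec_lambda_eta)
  qed
  obtain K where K: "compact K" "K \<subseteq> \<Omega>" "\<And>x. x \<notin> K \<Longrightarrow> u x = 0"
    using u by (rule test_functionsE) blast
  have 0: "jacobian u (at x) = 0" if "x \<notin> K" for x
  proof -
    have "u \<in> test_functions K"
      using K by (intro test_functionsI[of _ K] test_functions_C_k[OF u]) auto
    then have "frechet_derivative u (at x) (axis m 1) = 0" for m
      by (rule test_functions_outside[OF test_functions_partial[OF _ ax] that])
    then show ?thesis by (simp add: vec_eq_iff jacobian_nth)
  qed
  show "(\<lambda>x. jacobian u (at x)) \<in> L2 lborel"
    by (rule compact_support_L2[OF cont K(1) 0])
  show "jacobian u (at x) = 0" if "x \<notin> \<Omega>" using 0 that K(2) by blast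
  have "((\<lambda>x. u x $ k) has_derivative (\<lambda>v. frechet_derivative u (at x) v $ k)) (at x)"
    by (rule bounded_linear.has_derivative[OF bounded_linear_vec_nth
          has_frechet_derivative[OF test_functions_C_k[OF u, of "Suc 0"]]])
  from frechet_derivative_at[OF this, symmetric]
  show "frechet_derivative (\<lambda>x. u x $ k) (at x) (axis m 1) = jacobian u (at x) $ k $ m"
    by (simp add: jacobian_nth)
qed

lemma jacobian_is_weak_gradient:
  fixes u :: "real^'n \<Rightarrow> real^'n"
  assumes u: "u \<in> test_functions \<Omega>"
  shows "is_weak_gradient \<Omega> u (\<lambda>x. jacobian u (at x))"
  unfolding is_weak_gradient_def
proof (intro ballI allI)
  fix \<phi> :: "real^'n \<Rightarrow> real" and k m :: 'n assume \<phi>: "\<phi> \<in> test_functions \<Omega>"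
  have ax: "axis m (1::real) \<in> (Basis :: (real^'n) set)"
    by (auto simp: Basis_vec_def)
  have uk: "(\<lambda>x. u x $ k) \<in> test_functions \<Omega>"
    by (rule test_functions_bounded_linear[OF bounded_linear_vec_nth u])
  note cont = test_functions_continuous[OF uk] test_functions_continuous[OF \<phi>]
    test_functions_continuous[OF test_functions_partial[OF \<phi> ax]]
    test_functions_continuous[OF jacobian_test_function(4)[OF u, of k m]]
  have "(LINT x:\<Omega>|lebesgue. u x $ k * frechet_derivative \<phi> (at x) (axis m 1)) =
      (\<integral>x. u x $ k * frechet_derivative \<phi> (at x) (axis m 1) \<partial>lebesgue)"
    by (rule set_integral_eq_integral) (simp add: test_functions_outside[OF uk])
  also have "\<dots> = (\<integral>x. u x $ k * frechet_derivative \<phi> (at x) (axis m 1) \<partial>lborel)"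
    by (intro integral_lebesgue_borel borel_measurable_continuous_onI continuous_on_mult cont)
  also have "\<dots> = - (\<integral>x. jacobian u (at x) $ k $ m * \<phi> x \<partial>lborel)"
    using integral_by_parts_test_function[OF uk \<phi> ax]
    by (simp add: jacobian_test_function(5)[OF u])
  also have "(\<integral>x. jacobian u (at x) $ k $ m * \<phi> x \<partial>lborel) =
      (\<integral>x. jacobian u (at x) $ k $ m * \<phi> x \<partial>lebesgue)"
    by (intro integral_lebesgue_borel[symmetric] borel_measurable_continuous_onI continuous_on_mult cont)
  also have "\<dots> = (LINT x:\<Omega>|lebesgue. jacobian u (at x) $ k $ m * \<phi> x)"
    by (rule set_integral_eq_integral[symmetric]) (simp add: test_functions_outside[OF \<phi>])
  finally show "(LINT x:\<Omega>|lebesgue. u x $ k * frechet_derivative \<phi> (at x) (axis m 1)) =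
      - (LINT x:\<Omega>|lebesgue. jacobian u (at x) $ k $ m * \<phi> x)" .
qed

section \<open>Weak sequential compactness\<close>

lemma L2_dominated_convergence:
  fixes f :: "nat \<Rightarrow> 'a \<Rightarrow> 'b::euclidean_space" and g :: "'a \<Rightarrow> 'c::euclidean_space"
  assumes g: "g \<in> L2 M" and f: "\<And>i. f i \<in> borel_measurable M" and l: "l \<in> borel_measurable M"
    and lim: "AE x in M. (\<lambda>i. f i x) \<longlonglongrightarrow> l x"
    and le: "\<And>i. AE x in M. norm (f i x) \<le> c * norm (g x)"
  shows "l \<in> L2 M" and "(\<lambda>i. L2_norm M (\<lambda>x. f i x - l x)) \<longlonglongrightarrow> 0"
proof -
  have "AE x in M. \<forall>i. norm (f i x) \<le> c * norm (g x)"
    using le by (simp add: AE_all_countable)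
  with lim have l_le: "AE x in M. norm (l x) \<le> c * norm (g x)"
  proof eventually_elim
    case (elim x)
    then show ?case by (intro Lim_norm_ubound[OF _ elim(1)]) auto
  qed
  then show "l \<in> L2 M" by (rule L2_bound[OF g l])
  have "(\<lambda>i. \<integral>x. (norm (f i x - l x))\<^sup>2 \<partial>M) \<longlonglongrightarrow> (\<integral>x. 0 \<partial>M)"
  proof (rule integral_dominated_convergence)
    show "integrable M (\<lambda>x. (2 * c)\<^sup>2 * (norm (g x))\<^sup>2)"
      using g by (auto dest: L2_integrable_square)
    show "AE x in M. (\<lambda>i. (norm (f i x - l x))\<^sup>2) \<longlonglongrightarrow> 0"
      using lim
    proof eventually_elim
      case (elim x)
      have "(\<lambda>i. (norm (f i x - l x))\<^sup>2) \<longlonglongrightarrow> (norm (l x - l x))\<^sup>2"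
        by (intro tendsto_intros elim)
      then show ?case by simp
    qed
    show "AE x in M. norm ((norm (f i x - l x))\<^sup>2) \<le> (2 * c)\<^sup>2 * (norm (g x))\<^sup>2" for i
      using le[of i] l_le
    proof eventually_elim
      case (elim x)
      then have "norm (f i x - l x) \<le> 2 * c * norm (g x)"
        using norm_triangle_ineq4[of "f i x" "l x"] by linarith
      then have "(norm (f i x - l x))\<^sup>2 \<le> (2 * c * norm (g x))\<^sup>2" by (intro power_mono) auto
      then show ?case by (simp add: power_mult_distrib)
    qed
  qed (use f l in measurable)
  then have "(\<lambda>i. sqrt (\<integral>x. (norm (f i x - l x))\<^sup>2 \<partial>M)) \<longlonglongrightarrow> sqrt 0"
    by (intro tendsto_real_sqrt) simp
  then show "(\<lambda>i. L2_norm M (\<lambda>x. f i x - l x)) \<longlonglongrightarrow> 0"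
    by (simp add: L2_norm_eq)
qed

text \<open>Countability allows a diagonal subsequence along the generator; stability under intersections allows
Dynkin's argument to pass from the generator to all Borel sets.\<close>

lemma borel_countable_Int_stable_generator:
  obtains G :: "'a::second_countable_topology set set"
  where "countable G" "Int_stable G" "UNIV \<in> G" "sigma_sets UNIV G = sets borel"
proof -
  obtain B :: "'a set set" where B: "countable B" "topological_basis B"
    using ex_countable_basis by blast
  define G where "G = Inter ` {F. finite F \<and> F \<subseteq> B}"
  have "countable G"
    unfolding G_def by (intro countable_image countable_Collect_finite_subset B)
  moreover have "Int_stable G"
  proof (rule Int_stableI)
    fix X Y assume "X \<in> G" "Y \<in> G"
    then obtain F F' where "finite F" "F \<subseteq> B" "X = \<Inter>F" "finite F'" "F' \<subseteq> B" "Y = \<Inter>F'"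
      by (auto simp: G_def)
    then show "X \<inter> Y \<in> G"
      unfolding G_def by (intro image_eqI[of _ _ "F \<union> F'"]) auto
  qed
  moreover have "UNIV \<in> G"
    unfolding G_def by (rule image_eqI[of _ _ "{}"]) auto
  moreover have "sigma_sets UNIV G = sets borel"
  proof
    have "G \<subseteq> sets borel"
      unfolding G_def
      by (safe intro!: borel_open open_Inter) (use topological_basis_open[OF B(2)] in auto)
    then show "sigma_sets UNIV G \<subseteq> sets borel"
      using sets.sigma_sets_subset[of G borel] by simp
    have "B \<subseteq> G"
    proof
      fix X assume "X \<in> B"
      then show "X \<in> G" unfolding G_def by (intro image_eqI[of _ _ "{X}"]) auto
    qed
    then have "sigma_sets UNIV B \<subseteq> sigma_sets UNIV G"
      by (rule sigma_sets_mono')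
    then show "sets borel \<subseteq> sigma_sets UNIV G"
      by (subst borel_eq_countable_basis[OF B]) simp
  qed
  ultimately show thesis by (rule that)
qed

text \<open>By the Cauchy-Schwarz inequality, replacing \<open>f\<close> by \<open>h i\<close> changes all the integrals by an amount that is
small uniformly in \<open>k\<close>, because the \<open>p k\<close> are bounded.\<close>

lemma weak_convergence_closed:
  fixes p :: "nat \<Rightarrow> 'a \<Rightarrow> 'b::euclidean_space" and f :: "'a \<Rightarrow> real"
  assumes p: "\<And>k. p k \<in> L2 M" and C: "\<And>k. L2_norm M (p k) \<le> C"
    and f: "f \<in> L2 M" and h: "\<And>i. h i \<in> L2 M" and lim: "(\<lambda>i. L2_norm M (\<lambda>x. h i x - f x)) \<longlonglongrightarrow> 0"
    and conv: "\<And>i. convergent (\<lambda>k. \<integral>x. h i x *\<^sub>R p k x \<partial>M)"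
  shows "convergent (\<lambda>k. \<integral>x. f x *\<^sub>R p k x \<partial>M)"
proof (rule Cauchy_convergent, rule metric_CauchyI)
  fix \<epsilon> :: real assume "0 < \<epsilon>"
  have C0: "0 \<le> C" using C[of 0] L2.nrm_nonneg[OF p[of 0]] by linarith
  \<comment> \<open>\<open>C\<close> may be zero, so the error is measured against \<open>C + 1\<close>.\<close>
  define D where "D = C + 1"
  have D: "0 < D" "C \<le> D" using C0 by (simp_all add: D_def)
  have "\<forall>\<^sub>F i in sequentially. L2_norm M (\<lambda>x. h i x - f x) < \<epsilon> / (3 * D)"
    using \<open>0 < \<epsilon>\<close> D by (intro order_tendstoD(2)[OF lim]) auto
  then obtain i where i: "L2_norm M (\<lambda>x. h i x - f x) < \<epsilon> / (3 * D)"
    by (auto simp: eventually_sequentially)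
  have close: "dist (\<integral>x. h i x *\<^sub>R p k x \<partial>M) (\<integral>x. f x *\<^sub>R p k x \<partial>M) < \<epsilon> / 3" for k
  proof -
    have "(\<integral>x. h i x *\<^sub>R p k x \<partial>M) - (\<integral>x. f x *\<^sub>R p k x \<partial>M) = (\<integral>x. (h i x - f x) *\<^sub>R p k x \<partial>M)"
      using L2_integrable_scaleR[OF h p] L2_integrable_scaleR[OF f p]
      by (simp add: scaleR_diff_left)
    then have "dist (\<integral>x. h i x *\<^sub>R p k x \<partial>M) (\<integral>x. f x *\<^sub>R p k x \<partial>M) \<le>
        L2_norm M (\<lambda>x. h i x - f x) * L2_norm M (p k)"
      using L2_scaleR_integral_bound[OF L2.diff_mem[OF h[of i] f] p[of k]] by (simp add: dist_norm)
    also have "\<dots> \<le> L2_norm M (\<lambda>x. h i x - f x) * D"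
      using C[of k] D L2.nrm_nonneg[OF L2.diff_mem[OF h[of i] f]] by (intro mult_left_mono) auto
    also have "\<dots> < \<epsilon> / (3 * D) * D"
      using i D by (intro mult_strict_right_mono) auto
    also have "\<dots> = \<epsilon> / 3" using D by simp
    finally show ?thesis .
  qed
  obtain N where N: "\<And>k l. k \<ge> N \<Longrightarrow> l \<ge> N \<Longrightarrow>
      dist (\<integral>x. h i x *\<^sub>R p k x \<partial>M) (\<integral>x. h i x *\<^sub>R p l x \<partial>M) < \<epsilon> / 3"
    using metric_CauchyD[OF convergent_Cauchy[OF conv[of i]], of "\<epsilon> / 3"] \<open>0 < \<epsilon>\<close> by auto
  have "dist (\<integral>x. f x *\<^sub>R p k x \<partial>M) (\<integral>x. f x *\<^sub>R p l x \<partial>M) < \<epsilon>" if "k \<ge> N" "l \<ge> N" for k l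
    using N[OF that] close[of k] close[of l]
      dist_triangle[of "\<integral>x. f x *\<^sub>R p k x \<partial>M" "\<integral>x. f x *\<^sub>R p l x \<partial>M" "\<integral>x. h i x *\<^sub>R p k x \<partial>M"]
      dist_triangle[of "\<integral>x. h i x *\<^sub>R p k x \<partial>M" "\<integral>x. f x *\<^sub>R p l x \<partial>M" "\<integral>x. h i x *\<^sub>R p l x \<partial>M"]
    by (simp add: dist_commute)
  then show "\<exists>N. \<forall>k\<ge>N. \<forall>l\<ge>N. dist (\<integral>x. f x *\<^sub>R p k x \<partial>M) (\<integral>x. f x *\<^sub>R p l x \<partial>M) < \<epsilon>"
    by blast
qed

lemma weak_convergence_indicators_imp_all:
  fixes p :: "nat \<Rightarrow> 'a \<Rightarrow> 'b::euclidean_space" and f :: "'a \<Rightarrow> real"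
  assumes p: "\<And>k. p k \<in> L2 M" and C: "\<And>k. L2_norm M (p k) \<le> C"
    and ind: "\<And>E. E \<in> sets M \<Longrightarrow> convergent (\<lambda>k. \<integral>x. indicator E x *\<^sub>R p k x \<partial>M)"
    and f: "f \<in> L2 M"
  shows "convergent (\<lambda>k. \<integral>x. f x *\<^sub>R p k x \<partial>M)"
proof -
  have nonneg: "u \<in> L2 M \<longrightarrow> convergent (\<lambda>k. \<integral>x. u x *\<^sub>R p k x \<partial>M)"
    if "u \<in> borel_measurable M" "\<And>x. 0 \<le> u x" for u :: "'a \<Rightarrow> real"
    using that
  proof (induction rule: borel_measurable_induct_real)
    case (set A)
    then show ?case using ind by blast
  next
    case (mult u c)
    show ?case
    proof (cases "c = 0")
      case False
      have "convergent (\<lambda>k. \<integral>x. (c * u x) *\<^sub>R p k x \<partial>M)" if "(\<lambda>x. c * u x) \<in> L2 M"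
      proof -
        have "(\<lambda>x. inverse c *\<^sub>R (c * u x)) \<in> L2 M" using that by (rule L2_scale)
        moreover have "(\<lambda>x. inverse c *\<^sub>R (c * u x)) = u"
          using False by (simp add: fun_eq_iff flip: mult.assoc)
        ultimately have "u \<in> L2 M" by simp
        then have "convergent (\<lambda>k. c *\<^sub>R (\<integral>x. u x *\<^sub>R p k x \<partial>M))"
          using mult by (intro bounded_linear.convergent[OF bounded_linear_scaleR_right]) blast
        then show ?thesis by (simp flip: scaleR_scaleR)
      qed
      then show ?thesis by blast
    qed (simp add: convergent_const)
  next
    case (add u v)
    show ?case
    proof
      assume uv: "(\<lambda>x. v x + u x) \<in> L2 M"
      have "u \<in> L2 M" "v \<in> L2 M"
        using add.hyps by (auto intro!: L2_bound[OF uv, where c = 1])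
      then show "convergent (\<lambda>k. \<integral>x. (v x + u x) *\<^sub>R p k x \<partial>M)"
        using add L2_integrable_scaleR[OF _ p] by (simp add: scaleR_add_left convergent_add)
    qed
  next
    case (seq U)
    show ?case
    proof
      assume u: "u \<in> L2 M"
      have le: "AE x in M. norm (U i x) \<le> 1 * norm (u x)" for i
      proof (rule AE_I2)
        fix x assume x: "x \<in> space M"
        have "U i x \<le> u x"
          using seq.hyps(3) seq.hyps(4)[OF x] by (intro incseq_le) (auto simp: incseq_def le_fun_def)
        then show "norm (U i x) \<le> 1 * norm (u x)" using seq.hyps(2)[of i x] by simp
      qed
      have U: "U i \<in> L2 M" for i by (rule L2_bound[OF u seq.hyps(1) le])
      have "(\<lambda>i. L2_norm M (\<lambda>x. U i x - u x)) \<longlonglongrightarrow> 0"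
        by (rule L2_dominated_convergence(2)[OF u seq.hyps(1) _ _ le]) (use u seq.hyps(4) in auto)
      then show "convergent (\<lambda>k. \<integral>x. u x *\<^sub>R p k x \<partial>M)"
        by (rule weak_convergence_closed[where h = U and p = p, OF p C u U]) (use seq.IH U in blast)
    qed
  qed
  have max: "(\<lambda>x. max (f x) 0) \<in> L2 M" "(\<lambda>x. max (- f x) 0) \<in> L2 M"
    using f by (auto intro!: L2_bound[OF f, where c = 1])
  have "convergent (\<lambda>k. (\<integral>x. max (f x) 0 *\<^sub>R p k x \<partial>M) - (\<integral>x. max (- f x) 0 *\<^sub>R p k x \<partial>M))"
    using nonneg max by (intro convergent_diff) auto
  also have "(\<lambda>k. (\<integral>x. max (f x) 0 *\<^sub>R p k x \<partial>M) - (\<integral>x. max (- f x) 0 *\<^sub>R p k x \<partial>M)) =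
      (\<lambda>k. \<integral>x. (max (f x) 0 - max (- f x) 0) *\<^sub>R p k x \<partial>M)"
    using L2_integrable_scaleR[OF max(1) p] L2_integrable_scaleR[OF max(2) p]
    by (simp add: scaleR_diff_left)
  also have "\<dots> = (\<lambda>k. \<integral>x. f x *\<^sub>R p k x \<partial>M)"
    by (intro ext Bochner_Integration.integral_cong) (auto simp: max_def)
  finally show ?thesis .
qed

text \<open>A diagonal subsequence makes the integrals over a countable generator converge. Dynkin's argument
extends this to all Borel sets, and approximation by simple functions extends it to all square
integrable weights. The set \<open>\<Omega>\<close> of finite measure serves to make indicators square integrable: since
the functions are supported in it, indicators can be cut off to \<open>\<Omega>\<close>.\<close>

lemma weakly_convergent_subsequence:
  fixes p :: "nat \<Rightarrow> 'a::euclidean_space \<Rightarrow> 'b::euclidean_space"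
  assumes p: "\<And>k. p k \<in> L2 lborel" and C: "\<And>k. L2_norm lborel (p k) \<le> C"
    and \<Omega>: "\<Omega> \<in> sets borel" "emeasure lborel \<Omega> < \<infinity>" and supp: "\<And>k x. x \<notin> \<Omega> \<Longrightarrow> p k x = 0"
  obtains r :: "nat \<Rightarrow> nat" where "strict_mono r"
    "\<And>f. f \<in> L2 lborel \<Longrightarrow> convergent (\<lambda>k. \<integral>x. f x *\<^sub>R p (r k) x \<partial>lborel)"
proof -
  obtain G :: "'a set set" where G: "countable G" "Int_stable G" "UNIV \<in> G" "sigma_sets UNIV G = sets borel"
    by (rule borel_countable_Int_stable_generator)
  define I where "I E k = (\<integral>x. indicator E x *\<^sub>R p k x \<partial>lborel)" for E k
  have I_\<Omega>: "I E k = I (E \<inter> \<Omega>) k" for E k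
    unfolding I_def
    by (intro Bochner_Integration.integral_cong refl) (use supp in \<open>auto simp: indicator_def\<close>)
  have ind: "indicator (E \<inter> \<Omega>) \<in> (L2 lborel :: ('a \<Rightarrow> real) set)" if "E \<in> sets borel" for E
  proof -
    have "integrable lborel (indicat_real (E \<inter> \<Omega>))"
      using that \<Omega> emeasure_mono[of "E \<inter> \<Omega>" \<Omega> lborel] by (intro integrable_real_indicator) auto
    moreover have "(\<lambda>x. (norm (indicat_real (E \<inter> \<Omega>) x))\<^sup>2) = indicat_real (E \<inter> \<Omega>)"
      by (auto simp: indicator_def)
    ultimately show ?thesis
      using that \<Omega> by (simp add: L2_def)
  qed
  have G_borel: "E \<in> sets borel" if "E \<in> G" for E
    using that G(4) by blast
  have I_bound: "norm (I E k) \<le> L2_norm lborel (indicat_real \<Omega>) * C" if "E \<in> G" for E k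
  proof -
    have E: "E \<in> sets borel" using G_borel that .
    have "L2_norm lborel (indicat_real (E \<inter> \<Omega>)) \<le> L2_norm lborel (indicat_real \<Omega>)"
      using ind[OF E] ind[of UNIV] unfolding L2_norm_eq
      by (intro real_sqrt_le_mono integral_mono) (auto dest: L2_integrable_square simp: indicator_def)
    moreover have "norm (I E k) \<le> L2_norm lborel (indicat_real (E \<inter> \<Omega>)) * L2_norm lborel (p k)"
      unfolding I_\<Omega>[of E] unfolding I_def by (rule L2_scaleR_integral_bound[OF ind[OF E] p])
    moreover have "L2_norm lborel (indicat_real (E \<inter> \<Omega>)) * L2_norm lborel (p k)
        \<le> L2_norm lborel (indicat_real \<Omega>) * C"
      using calculation(1) C[of k] L2.nrm_nonneg[OF p[of k]] L2.nrm_nonneg[OF ind[of UNIV]]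
      by (intro mult_mono) auto
    ultimately show ?thesis by linarith
  qed
  obtain r where r: "strict_mono (r :: nat \<Rightarrow> nat)" "\<And>E. E \<in> G \<Longrightarrow> \<exists>l. (\<lambda>k. I E (r k)) \<longlonglongrightarrow> l"
    using function_convergent_subsequence[OF G(1), of "\<lambda>k E. I E k"] I_bound by metis
  have I_int: "integrable lborel (\<lambda>x. indicat_real E x *\<^sub>R p k x)" if "E \<in> sets borel" for E k
  proof -
    have "(\<lambda>x. indicat_real E x *\<^sub>R p k x) = (\<lambda>x. indicat_real (E \<inter> \<Omega>) x *\<^sub>R p k x)"
      using supp by (auto simp: indicator_def)
    then show ?thesis using L2_integrable_scaleR[OF ind[OF that] p] by simp
  qed
  have conv_ind: "convergent (\<lambda>k. I E (r k))" if E: "E \<in> sets borel" for E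
  proof (rule sigma_sets_induct_disjoint[OF G(2), of UNIV E])
    show "E \<in> sigma_sets UNIV G" using E G(4) by simp
  next
    fix A assume "A \<in> G" then show "convergent (\<lambda>k. I A (r k))"
      using r(2) by (auto simp: convergent_def)
  next
    fix A assume "A \<in> sigma_sets UNIV G" and conv: "convergent (\<lambda>k. I A (r k))"
    then have A: "A \<in> sets borel" using G(4) by simp
    have "I (UNIV - A) k = I UNIV k - I A k" for k
    proof -
      have "I UNIV k - I A k = (\<integral>x. indicat_real UNIV x *\<^sub>R p k x - indicat_real A x *\<^sub>R p k x \<partial>lborel)"
        unfolding I_def using I_int[of UNIV k] I_int[OF A, of k] by simp
      also have "\<dots> = I (UNIV - A) k"
        unfolding I_def by (intro Bochner_Integration.integral_cong refl) (auto simp: indicator_def)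
      finally show ?thesis ..
    qed
    moreover have "convergent (\<lambda>k. I UNIV (r k))"
      using r(2)[OF G(3)] by (auto simp: convergent_def)
    ultimately show "convergent (\<lambda>k. I (UNIV - A) (r k))"
      using conv by (simp add: convergent_diff)
  next
    fix A :: "nat \<Rightarrow> 'a set"
    assume disj: "disjoint_family A" and "range A \<subseteq> sigma_sets UNIV G"
      and conv: "\<And>i. convergent (\<lambda>k. I (A i) (r k))"
    then have A: "A i \<in> sets borel" for i using G(4) by auto
    define F where "F i = (\<Union>j<i. A j)" for i
    have F: "F i \<in> sets borel" for i unfolding F_def using A by auto
    have UA: "(\<Union>i. A i) \<in> sets borel" using A by auto
    have conv_F: "convergent (\<lambda>k. I (F i) (r k))" for i
    proof -
      have "I (F i) k = (\<Sum>j<i. I (A j) k)" for k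
      proof -
        have "indicat_real (F i) x = (\<Sum>j<i. indicat_real (A j) x)" for x
          unfolding F_def using disj
          by (intro indicator_UN_disjoint) (auto simp: disjoint_family_on_def)
        then have "I (F i) k = (\<integral>x. (\<Sum>j<i. indicat_real (A j) x *\<^sub>R p k x) \<partial>lborel)"
          unfolding I_def by (simp only: scaleR_sum_left)
        also have "\<dots> = (\<Sum>j<i. I (A j) k)"
          unfolding I_def by (intro Bochner_Integration.integral_sum I_int A)
        finally show ?thesis .
      qed
      then show ?thesis using conv by (simp add: convergent_sum)
    qed
    have "(\<lambda>i. L2_norm lborel (\<lambda>x. indicat_real (F i \<inter> \<Omega>) x - indicat_real ((\<Union>i. A i) \<inter> \<Omega>) x)) \<longlonglongrightarrow> 0"
    proof (rule L2_dominated_convergence(2)[where c = 1 and g = "indicat_real (UNIV \<inter> \<Omega>)"])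
      have "(\<lambda>i. indicat_real (F i) x) \<longlonglongrightarrow> indicat_real (\<Union>i. F i) x" for x
        by (rule LIMSEQ_indicator_incseq) (force simp: F_def incseq_def)
      moreover have "(\<Union>i. F i) = (\<Union>i. A i)" by (auto simp: F_def)
      ultimately have "(\<lambda>i. indicat_real (F i) x * indicat_real \<Omega> x) \<longlonglongrightarrow>
          indicat_real (\<Union>i. A i) x * indicat_real \<Omega> x" for x
        by (intro tendsto_mult tendsto_const) simp
      then show "AE x in lborel. (\<lambda>i. indicat_real (F i \<inter> \<Omega>) x) \<longlonglongrightarrow> indicat_real ((\<Union>i. A i) \<inter> \<Omega>) x"
        by (simp add: indicator_inter_arith)
      show "indicat_real ((\<Union>i. A i) \<inter> \<Omega>) \<in> borel_measurable lborel"
        by (rule L2_measurable[OF ind[OF UA]])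
      show "AE x in lborel. norm (indicat_real (F i \<inter> \<Omega>) x) \<le> 1 * norm (indicat_real (UNIV \<inter> \<Omega>) x)" for i
        by (rule AE_I2) (simp add: indicator_def)
      show "indicat_real (UNIV \<inter> \<Omega>) \<in> L2 lborel" by (rule ind) simp
    qed (rule L2_measurable[OF ind[OF F]])
    then show "convergent (\<lambda>k. I (\<Union>i. A i) (r k))"
      unfolding I_\<Omega>[of "\<Union>i. A i"] unfolding I_def
      by (rule weak_convergence_closed[where p = "\<lambda>k. p (r k)", OF p C ind[OF UA] ind[OF F]])
        (use conv_F I_\<Omega> in \<open>simp add: I_def\<close>)
  next
    show "convergent (\<lambda>k. I {} (r k))" by (simp add: I_def convergent_const)
  qed simp
  show thesis
    by (rule that[OF r(1)], rule weak_convergence_indicators_imp_all[OF p C])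
      (use conv_ind in \<open>simp_all add: I_def\<close>)
qed

section \<open>Hilbert-Schmidt integral operators\<close>

definition integral_operator ::
    "('a::euclidean_space \<times> 'a \<Rightarrow> real) \<Rightarrow> ('a \<Rightarrow> 'b::euclidean_space) \<Rightarrow> 'a \<Rightarrow> 'b" where
  "integral_operator a q x = (\<integral>y. a (x, y) *\<^sub>R q y \<partial>lborel)"

text \<open>This is Fubini's theorem for the square of the kernel. The last equation is what makes the
\<open>L\<^sup>2\<close> norm of the kernel a bound for the norm of the operator.\<close>

lemma L2_sections:
  fixes a :: "'a::euclidean_space \<times> 'a \<Rightarrow> real"
  assumes a: "a \<in> L2 (lborel \<Otimes>\<^sub>M lborel)"
  shows "AE x in lborel. (\<lambda>y. a (x, y)) \<in> L2 lborel"
    and "(\<lambda>x. L2_norm lborel (\<lambda>y. a (x, y))) \<in> L2 lborel"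
    and "L2_norm lborel (\<lambda>x. L2_norm lborel (\<lambda>y. a (x, y))) = L2_norm (lborel \<Otimes>\<^sub>M lborel) a"
proof -
  note int = L2_integrable_square[OF a]
  have am: "a \<in> borel_measurable (lborel \<Otimes>\<^sub>M lborel)" by (rule L2_measurable[OF a])
  have sec: "(\<lambda>y. a (x, y)) \<in> borel_measurable lborel" for x
    using am by measurable
  show "AE x in lborel. (\<lambda>y. a (x, y)) \<in> L2 lborel"
    using lborel_pair.AE_integrable_fst'[OF int] by eventually_elim (use sec in \<open>simp add: L2_def\<close>)
  have sq: "(norm (L2_norm lborel (\<lambda>y. a (x, y))))\<^sup>2 = (\<integral>y. (norm (a (x, y)))\<^sup>2 \<partial>lborel)" for x
    by (simp add: L2_norm_eq integral_nonneg_AE)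
  have "integrable lborel (\<lambda>x. \<integral>y. (norm (a (x, y)))\<^sup>2 \<partial>lborel)"
    by (rule lborel_pair.integrable_fst'[OF int])
  then show "(\<lambda>x. L2_norm lborel (\<lambda>y. a (x, y))) \<in> L2 lborel"
    unfolding L2_def mem_Collect_eq sq
    by (auto simp: L2_norm_eq intro: borel_measurable_sqrt borel_measurable_integrable)
  show "L2_norm lborel (\<lambda>x. L2_norm lborel (\<lambda>y. a (x, y))) = L2_norm (lborel \<Otimes>\<^sub>M lborel) a"
    unfolding L2_norm_eq[of lborel "\<lambda>x. L2_norm lborel (\<lambda>y. a (x, y))"] sq
    by (subst lborel_pair.integral_fst'[OF int]) (simp add: L2_norm_eq)
qed

lemma integral_operator_L2:
  fixes a :: "'a::euclidean_space \<times> 'a \<Rightarrow> real" and q :: "'a \<Rightarrow> 'b::euclidean_space"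
  assumes a: "a \<in> L2 (lborel \<Otimes>\<^sub>M lborel)" and q: "q \<in> L2 lborel"
  shows "integral_operator a q \<in> borel_measurable lborel"
    and "AE x in lborel. norm (integral_operator a q x) \<le>
      L2_norm lborel q * norm (L2_norm lborel (\<lambda>y. a (x, y)))"
    and "integral_operator a q \<in> L2 lborel"
    and "L2_norm lborel (integral_operator a q) \<le> L2_norm (lborel \<Otimes>\<^sub>M lborel) a * L2_norm lborel q"
proof -
  note [measurable] = L2_measurable[OF a] L2_measurable[OF q]
  have "(\<lambda>(x, y). a (x, y) *\<^sub>R q y) \<in> borel_measurable (lborel \<Otimes>\<^sub>M lborel)"
    by measurable
  from lborel.borel_measurable_lebesgue_integral[OF this]
  show m: "integral_operator a q \<in> borel_measurable lborel"
    by (simp add: integral_operator_def[abs_def])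
  show b: "AE x in lborel. norm (integral_operator a q x) \<le>
      L2_norm lborel q * norm (L2_norm lborel (\<lambda>y. a (x, y)))"
    using L2_sections(1)[OF a]
  proof eventually_elim
    case (elim x)
    show ?case
      using L2_scaleR_integral_bound[OF elim q] L2.nrm_nonneg[OF elim]
      by (simp add: integral_operator_def mult.commute)
  qed
  show L: "integral_operator a q \<in> L2 lborel"
    by (rule L2_bound[OF L2_sections(2)[OF a] m b])
  have "L2_norm lborel (integral_operator a q) \<le>
      L2_norm lborel (\<lambda>x. L2_norm lborel q *\<^sub>R L2_norm lborel (\<lambda>y. a (x, y)))"
    unfolding L2_norm_eq[of lborel "integral_operator a q"]
      L2_norm_eq[of lborel "\<lambda>x. L2_norm lborel q *\<^sub>R L2_norm lborel (\<lambda>y. a (x, y))"]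
  proof (intro real_sqrt_le_mono integral_mono_AE)
    show "AE x in lborel. (norm (integral_operator a q x))\<^sup>2 \<le>
        (norm (L2_norm lborel q *\<^sub>R L2_norm lborel (\<lambda>y. a (x, y))))\<^sup>2"
      using b by eventually_elim (use L2.nrm_nonneg[OF q] in \<open>auto intro!: power_mono simp: abs_mult\<close>)
  qed (use L L2_scale[OF L2_sections(2)[OF a], of "L2_norm lborel q"] in
      \<open>auto dest: L2_integrable_square\<close>)
  also have "\<dots> = L2_norm (lborel \<Otimes>\<^sub>M lborel) a * L2_norm lborel q"
    using L2.nrm_scale[OF L2_sections(2)[OF a]] L2.nrm_nonneg[OF q]
    by (simp add: L2_sections(3)[OF a] mult.commute)
  finally show "L2_norm lborel (integral_operator a q) \<le> \<dots>" .
qed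

lemma integral_operator_add:
  assumes a: "a \<in> L2 (lborel \<Otimes>\<^sub>M lborel)" and p: "p \<in> L2 lborel" and q: "q \<in> L2 lborel"
  shows "AE x in lborel. integral_operator a (\<lambda>y. p y + q y) x =
    integral_operator a p x + integral_operator a q x"
  using L2_sections(1)[OF a]
proof eventually_elim
  case (elim x)
  show ?case
    using L2_integrable_scaleR[OF elim p] L2_integrable_scaleR[OF elim q]
    by (simp add: integral_operator_def scaleR_add_right)
qed

lemma integral_operator_scale:
  "integral_operator a (\<lambda>y. c *\<^sub>R q y) x = c *\<^sub>R integral_operator a q x"
proof -
  have "integral_operator a (\<lambda>y. c *\<^sub>R q y) x = (\<integral>y. c *\<^sub>R (a (x, y) *\<^sub>R q y) \<partial>lborel)"
    by (simp add: integral_operator_def mult.commute)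
  then show ?thesis by (simp only: integral_operator_def integral_scaleR_right)
qed

lemma integral_operator_diff:
  assumes "a \<in> L2 (lborel \<Otimes>\<^sub>M lborel)" "p \<in> L2 lborel" "q \<in> L2 lborel"
  shows "AE x in lborel. integral_operator a (\<lambda>y. p y - q y) x =
    integral_operator a p x - integral_operator a q x"
  using integral_operator_add[OF assms(1,2) L2_scale[OF assms(3), of "-1"]]
    integral_operator_scale[of a "-1" q] by simp

text \<open>Weak convergence, tested against the square integrable sections of the kernel, is pointwise
convergence of the images almost everywhere. The norms of the sections, times the common bound \<open>C\<close>,
dominate the images, so the convergence is also in \<open>L\<^sup>2\<close>.\<close>

lemma integral_operator_compact:
  fixes a :: "'a::euclidean_space \<times> 'a \<Rightarrow> real" and p :: "nat \<Rightarrow> 'a \<Rightarrow> 'b::euclidean_space"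
  assumes a: "a \<in> L2 (lborel \<Otimes>\<^sub>M lborel)"
    and p: "\<And>k. p k \<in> L2 lborel" and C: "\<And>k. L2_norm lborel (p k) \<le> C"
    and \<Omega>: "\<Omega> \<in> sets borel" "emeasure lborel \<Omega> < \<infinity>" and supp: "\<And>k x. x \<notin> \<Omega> \<Longrightarrow> p k x = 0"
  obtains r :: "nat \<Rightarrow> nat" and l where "strict_mono r" "l \<in> L2 lborel"
    "(\<lambda>k. L2_norm lborel (\<lambda>x. integral_operator a (p (r k)) x - l x)) \<longlonglongrightarrow> 0"
proof -
  obtain r :: "nat \<Rightarrow> nat" where r: "strict_mono r"
    and conv: "\<And>f. f \<in> L2 lborel \<Longrightarrow> convergent (\<lambda>k. \<integral>x. f x *\<^sub>R p (r k) x \<partial>lborel)"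
    by (rule weakly_convergent_subsequence[OF p C \<Omega> supp]) (assumption | rule that)+
  define l where "l x = lim (\<lambda>k. integral_operator a (p (r k)) x)" for x
  have m: "l \<in> borel_measurable lborel"
    unfolding l_def[abs_def] by (intro borel_measurable_lim_metric integral_operator_L2(1) a p)
  have lim: "AE x in lborel. (\<lambda>k. integral_operator a (p (r k)) x) \<longlonglongrightarrow> l x"
    using L2_sections(1)[OF a]
  proof eventually_elim
    case (elim x)
    show ?case
      using conv[OF elim] unfolding l_def integral_operator_def by (simp add: convergent_LIMSEQ_iff)
  qed
  have le: "AE x in lborel. norm (integral_operator a (p (r k)) x) \<le>
      C * norm (L2_norm lborel (\<lambda>y. a (x, y)))" for k
    using integral_operator_L2(2)[OF a p[of "r k"]]
    by eventually_elim (use C[of "r k"] in \<open>meson mult_right_mono norm_ge_zero order_trans\<close>)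
  note dom = L2_dominated_convergence[OF L2_sections(2)[OF a] integral_operator_L2(1)[OF a p] m lim le]
  show thesis by (rule that[OF r dom])
qed

section \<open>Uniqueness and linearity of weak gradients\<close>

text \<open>Values outside of \<open>\<Omega>\<close> are irrelevant for membership in \<open>L2_on\<close>. Cutting them off turns statements about
\<open>L2_on\<close> into statements about \<open>L2\<close> of the whole space.\<close>

definition zero_ext :: "'a set \<Rightarrow> ('a \<Rightarrow> 'b::real_vector) \<Rightarrow> 'a \<Rightarrow> 'b" where
  "zero_ext \<Omega> f x = indicator \<Omega> x *\<^sub>R f x"

lemma L2_on_zero_ext: "f \<in> L2_on \<Omega> \<longleftrightarrow> zero_ext \<Omega> f \<in> L2 lebesgue"
  by (simp add: L2_on_iff zero_ext_def[abs_def])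

lemma zero_ext_add: "zero_ext \<Omega> (\<lambda>x. f x + g x) = (\<lambda>x. zero_ext \<Omega> f x + zero_ext \<Omega> g x)"
  by (auto simp: zero_ext_def scaleR_add_right)

lemma zero_ext_scale: "zero_ext \<Omega> (\<lambda>x. c *\<^sub>R f x) = (\<lambda>x. c *\<^sub>R zero_ext \<Omega> f x)"
  by (auto simp: zero_ext_def)

lemma zero_ext_diff: "zero_ext \<Omega> (\<lambda>x. f x - g x) = (\<lambda>x. zero_ext \<Omega> f x - zero_ext \<Omega> g x)"
  by (auto simp: zero_ext_def scaleR_diff_right)

lemma L2_on_add: "f \<in> L2_on \<Omega> \<Longrightarrow> g \<in> L2_on \<Omega> \<Longrightarrow> (\<lambda>x. f x + g x) \<in> L2_on \<Omega>"
  by (simp add: L2_on_zero_ext zero_ext_add L2_add)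

lemma L2_on_scale: "f \<in> L2_on \<Omega> \<Longrightarrow> (\<lambda>x. c *\<^sub>R f x) \<in> L2_on \<Omega>"
  by (simp add: L2_on_zero_ext zero_ext_scale L2_scale)

lemma L2_on_bounded_linear:
  assumes h: "bounded_linear h" and f: "f \<in> L2_on \<Omega>"
  shows "(\<lambda>x. h (f x)) \<in> L2_on \<Omega>"
proof -
  interpret h: bounded_linear h by fact
  obtain c where c: "\<And>x. norm (h x) \<le> norm x * c"
    using h.bounded by blast
  have eq: "zero_ext \<Omega> (\<lambda>x. h (f x)) = (\<lambda>x. h (zero_ext \<Omega> f x))"
    by (auto simp: zero_ext_def h.scaleR)
  have "zero_ext \<Omega> f \<in> L2 lebesgue" using f by (simp add: L2_on_zero_ext)
  then have "(\<lambda>x. h (zero_ext \<Omega> f x)) \<in> L2 lebesgue"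
    by (rule L2_bound[where c = c])
      (use c f L2_measurable in \<open>auto simp: L2_on_zero_ext mult.commute
        intro!: borel_measurable_continuous_on[OF h.continuous_on[OF continuous_on_id]]\<close>)
  then show ?thesis by (simp add: L2_on_zero_ext eq)
qed

lemma set_integral_zero_ext: "(LINT x:\<Omega>|M. f x * g x) = (\<integral>x. zero_ext \<Omega> f x * g x \<partial>M)"
  for f g :: "'a \<Rightarrow> real"
  by (simp add: set_lebesgue_integral_def zero_ext_def mult.assoc)

lemma test_function_L2:
  fixes \<phi> :: "'a::euclidean_space \<Rightarrow> 'b::euclidean_space"
  assumes \<phi>: "\<phi> \<in> test_functions \<Omega>"
  shows "\<phi> \<in> L2 lborel"
proof -
  obtain K where K: "compact K" "\<And>x. x \<notin> K \<Longrightarrow> \<phi> x = 0"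
    using \<phi> by (rule test_functionsE) blast
  show ?thesis by (rule compact_support_L2[OF test_functions_continuous[OF \<phi>] K])
qed

lemma integrable_L2_on_test_function:
  fixes f \<phi> :: "'a::euclidean_space \<Rightarrow> real"
  assumes "f \<in> L2_on \<Omega>" "\<phi> \<in> test_functions \<Omega>"
  shows "integrable lebesgue (\<lambda>x. zero_ext \<Omega> f x * \<phi> x)"
  using L2_integrable_inner[of "zero_ext \<Omega> f" lebesgue \<phi>] assms
    L2_lebesgue_borel(1)[OF test_function_L2[OF assms(2)]]
  by (simp add: L2_on_zero_ext)

lemma axis_Basis: "axis m (1::real) \<in> Basis"
  by (auto simp: Basis_vec_def)

lemma is_weak_gradient_add:
  assumes L2: "u \<in> L2_on \<Omega>" "v \<in> L2_on \<Omega>" "G \<in> L2_on \<Omega>" "H \<in> L2_on \<Omega>"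
    and wg: "is_weak_gradient \<Omega> u G" "is_weak_gradient \<Omega> v H"
  shows "is_weak_gradient \<Omega> (\<lambda>x. u x + v x) (\<lambda>x. G x + H x)"
  unfolding is_weak_gradient_def
proof (intro ballI allI)
  fix \<phi> :: "real^'a \<Rightarrow> real" and k m assume \<phi>: "\<phi> \<in> test_functions \<Omega>"
  note int = integrable_L2_on_test_function[OF L2_on_bounded_linear[OF bounded_linear_vec_nth]
      test_functions_partial[OF \<phi> axis_Basis]]
    integrable_L2_on_test_function[OF L2_on_bounded_linear[OF bounded_linear_vec_nth
        L2_on_bounded_linear[OF bounded_linear_vec_nth]] \<phi>]
  show "(LINT x:\<Omega>|lebesgue. (u x + v x) $ k * frechet_derivative \<phi> (at x) (axis m 1)) =
      - (LINT x:\<Omega>|lebesgue. (G x + H x) $ k $ m * \<phi> x)"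
    using wg \<phi> unfolding is_weak_gradient_def set_integral_zero_ext
    using int(1)[OF L2(1), of k m] int(1)[OF L2(2), of k m] int(2)[OF L2(3), of k m] int(2)[OF L2(4), of k m]
    by (simp add: zero_ext_add distrib_right)
qed

lemma is_weak_gradient_scale:
  assumes wg: "is_weak_gradient \<Omega> u G"
  shows "is_weak_gradient \<Omega> (\<lambda>x. c *\<^sub>R u x) (\<lambda>x. c *\<^sub>R G x)"
  using wg unfolding is_weak_gradient_def by (simp add: mult.assoc)

lemma is_weak_gradient_cong:
  assumes L2: "u \<in> L2_on \<Omega>" "v \<in> L2_on \<Omega>" and ae: "AE x in lebesgue. x \<in> \<Omega> \<longrightarrow> u x = v x"
  shows "is_weak_gradient \<Omega> u G \<longleftrightarrow> is_weak_gradient \<Omega> v G"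
proof -
  have "(LINT x:\<Omega>|lebesgue. u x $ k * frechet_derivative \<phi> (at x) (axis m 1)) =
      (LINT x:\<Omega>|lebesgue. v x $ k * frechet_derivative \<phi> (at x) (axis m 1))"
    if \<phi>: "\<phi> \<in> test_functions \<Omega>" for \<phi> :: "real^'a \<Rightarrow> real" and k m
  proof -
    note int = integrable_L2_on_test_function[OF L2_on_bounded_linear[OF bounded_linear_vec_nth]
        test_functions_partial[OF \<phi> axis_Basis], of _ k m]
    show ?thesis
      unfolding set_integral_zero_ext
    proof (rule integral_cong_AE)
      show "AE x in lebesgue. zero_ext \<Omega> (\<lambda>x. u x $ k) x * frechet_derivative \<phi> (at x) (axis m 1) =
          zero_ext \<Omega> (\<lambda>x. v x $ k) x * frechet_derivative \<phi> (at x) (axis m 1)"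
        using ae by eventually_elim (auto simp: zero_ext_def indicator_def)
    qed (use int[OF L2(1)] int[OF L2(2)] in auto)
  qed
  then show ?thesis unfolding is_weak_gradient_def by simp
qed

text \<open>Each component of the difference is orthogonal to all test functions. Boundedness of \<open>\<Omega>\<close> makes it
integrable.\<close>

lemma weak_gradient_unique:
  assumes \<Omega>: "open \<Omega>" "bounded \<Omega>" and L2: "G \<in> L2_on \<Omega>" "H \<in> L2_on \<Omega>"
    and wg: "is_weak_gradient \<Omega> u G" "is_weak_gradient \<Omega> u H"
  shows "AE x in lebesgue. zero_ext \<Omega> G x = zero_ext \<Omega> H x"
proof -
  have comp: "AE x in lebesgue. x \<in> \<Omega> \<longrightarrow> G x $ k $ m = H x $ k $ m" for k m
  proof -
    define g where "g = zero_ext \<Omega> (\<lambda>x. G x $ k $ m - H x $ k $ m)"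
    have comp_L2: "(\<lambda>x. G x $ k $ m) \<in> L2_on \<Omega>" "(\<lambda>x. H x $ k $ m) \<in> L2_on \<Omega>"
      by (intro L2_on_bounded_linear[OF bounded_linear_vec_nth] L2)+
    then have g_L2: "g \<in> L2 lebesgue"
      unfolding g_def zero_ext_diff by (intro L2.diff_mem) (simp_all add: L2_on_zero_ext)
    have "indicat_real \<Omega> \<in> L2 lebesgue"
    proof -
      have "integrable lebesgue (indicat_real \<Omega>)"
        using \<Omega> emeasure_bounded_finite[of \<Omega>] by (intro integrable_real_indicator) auto
      moreover have "(\<lambda>x. (norm (indicat_real \<Omega> x))\<^sup>2) = indicat_real \<Omega>"
        by (auto simp: indicator_def)
      ultimately show ?thesis using \<Omega> by (simp add: L2_def)
    qed
    then have "integrable lebesgue (\<lambda>x. indicat_real \<Omega> x *\<^sub>R g x)"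
      by (rule L2_integrable_scaleR[OF _ g_L2])
    moreover have "(\<lambda>x. indicat_real \<Omega> x *\<^sub>R g x) = g"
      by (auto simp: g_def zero_ext_def indicator_def)
    ultimately have g_int: "integrable lebesgue g" by simp
    have "AE x in lebesgue. x \<in> \<Omega> \<longrightarrow> g x = 0"
    proof (rule test_functions_separate[OF \<Omega>(1) g_int])
      fix \<phi> :: "real^'a \<Rightarrow> real" assume \<phi>: "\<phi> \<in> test_functions \<Omega>"
      have "(LINT x:\<Omega>|lebesgue. G x $ k $ m * \<phi> x) = (LINT x:\<Omega>|lebesgue. H x $ k $ m * \<phi> x)"
        using bspec[OF wg(1)[unfolded is_weak_gradient_def] \<phi>, rule_format, of k m]
          bspec[OF wg(2)[unfolded is_weak_gradient_def] \<phi>, rule_format, of k m] by simp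
      then show "(\<integral>x. g x * \<phi> x \<partial>lebesgue) = 0"
        using integrable_L2_on_test_function[OF comp_L2(1) \<phi>] integrable_L2_on_test_function[OF comp_L2(2) \<phi>]
        unfolding g_def zero_ext_diff set_integral_zero_ext by (simp add: left_diff_distrib)
    qed
    then show ?thesis by eventually_elim (simp add: g_def zero_ext_def)
  qed
  have "AE x in lebesgue. \<forall>k\<in>UNIV. \<forall>m\<in>UNIV. x \<in> \<Omega> \<longrightarrow> G x $ k $ m = H x $ k $ m"
    by (intro AE_ball_countable[THEN iffD2] countable_finite ballI comp) auto
  then show ?thesis
  proof eventually_elim
    case (elim x)
    then show ?case by (cases "x \<in> \<Omega>") (auto simp: zero_ext_def vec_eq_iff)
  qed
qed

definition grad :: "(real^'n) set \<Rightarrow> (real^'n \<Rightarrow> real^'n) \<Rightarrow> real^'n \<Rightarrow> real^'n^'n" where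
  "grad \<Omega> u = zero_ext \<Omega> (weak_gradient \<Omega> u)"

lemma weak_gradient_works:
  assumes "u \<in> H1 \<Omega>"
  shows "weak_gradient \<Omega> u \<in> L2_on \<Omega>" "is_weak_gradient \<Omega> u (weak_gradient \<Omega> u)"
proof -
  have "\<exists>G. G \<in> L2_on \<Omega> \<and> is_weak_gradient \<Omega> u G" using assms by (auto simp: H1_def)
  from someI_ex[OF this]
  show "weak_gradient \<Omega> u \<in> L2_on \<Omega>" "is_weak_gradient \<Omega> u (weak_gradient \<Omega> u)"
    by (simp_all add: weak_gradient_def)
qed

lemma grad_L2: "u \<in> H1 \<Omega> \<Longrightarrow> grad \<Omega> u \<in> L2 lebesgue"
  using weak_gradient_works(1) by (simp add: grad_def L2_on_zero_ext)

lemma H1_I: "u \<in> L2_on \<Omega> \<Longrightarrow> G \<in> L2_on \<Omega> \<Longrightarrow> is_weak_gradient \<Omega> u G \<Longrightarrow> u \<in> H1 \<Omega>"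
  by (auto simp: H1_def)

lemma H1_imp_L2_on: "u \<in> H1 \<Omega> \<Longrightarrow> u \<in> L2_on \<Omega>"
  by (simp add: H1_def)

lemma weak_gradient_add:
  assumes u: "u \<in> H1 \<Omega>" and v: "v \<in> H1 \<Omega>"
  shows "is_weak_gradient \<Omega> (\<lambda>x. u x + v x) (\<lambda>x. weak_gradient \<Omega> u x + weak_gradient \<Omega> v x)"
  by (intro is_weak_gradient_add H1_imp_L2_on weak_gradient_works u v)

lemma H1_add:
  assumes u: "u \<in> H1 \<Omega>" and v: "v \<in> H1 \<Omega>"
  shows "(\<lambda>x. u x + v x) \<in> H1 \<Omega>"
  by (rule H1_I[OF _ _ weak_gradient_add[OF u v]])
    (intro L2_on_add H1_imp_L2_on weak_gradient_works u v)+

lemma H1_scale: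
  assumes u: "u \<in> H1 \<Omega>"
  shows "(\<lambda>x. c *\<^sub>R u x) \<in> H1 \<Omega>"
  by (rule H1_I[OF _ _ is_weak_gradient_scale[OF weak_gradient_works(2)[OF u]]])
    (intro L2_on_scale H1_imp_L2_on weak_gradient_works u)+

lemma L2_norm_grad_le_H1_norm: "L2_norm lebesgue (grad \<Omega> u) \<le> H1_norm \<Omega> u"
proof -
  have "(norm (grad \<Omega> u x))\<^sup>2 = indicator \<Omega> x *\<^sub>R (norm (weak_gradient \<Omega> u x))\<^sup>2" for x
    by (simp add: grad_def zero_ext_def indicator_def)
  then have "L2_norm lebesgue (grad \<Omega> u) = sqrt (LINT x:\<Omega>|lebesgue. (norm (weak_gradient \<Omega> u x))\<^sup>2)"
    by (simp add: L2_norm_eq set_lebesgue_integral_def)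
  also have "\<dots> \<le> H1_norm \<Omega> u"
    unfolding H1_norm_def
    by (intro real_sqrt_le_mono) (simp add: set_lebesgue_integral_def integral_nonneg_AE)
  finally show ?thesis .
qed

definition gradient_approximation ::
    "(real^'n) set \<Rightarrow> (real^'n \<Rightarrow> real^'n) \<Rightarrow> (nat \<Rightarrow> real^'n \<Rightarrow> real^'n) \<Rightarrow> bool" where
  "gradient_approximation \<Omega> u s \<longleftrightarrow> (\<forall>k. s k \<in> test_functions \<Omega>) \<and>
     (\<lambda>k. L2_norm lebesgue (\<lambda>x. jacobian (s k) (at x) - grad \<Omega> u x)) \<longlonglongrightarrow> 0"

context
  fixes \<Omega> :: "(real^'n) set"
  assumes open_\<Omega>: "open \<Omega>" and bounded_\<Omega>: "bounded \<Omega>"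
begin

lemma grad_unique:
  assumes "u \<in> H1 \<Omega>" "G \<in> L2_on \<Omega>" "is_weak_gradient \<Omega> u G"
  shows "AE x in lebesgue. grad \<Omega> u x = zero_ext \<Omega> G x"
  unfolding grad_def
  by (rule weak_gradient_unique[OF open_\<Omega> bounded_\<Omega> weak_gradient_works(1)[OF assms(1)] assms(2)
        weak_gradient_works(2)[OF assms(1)] assms(3)])

lemma grad_add:
  assumes u: "u \<in> H1 \<Omega>" and v: "v \<in> H1 \<Omega>"
  shows "AE x in lebesgue. grad \<Omega> (\<lambda>x. u x + v x) x = grad \<Omega> u x + grad \<Omega> v x"
  using grad_unique[OF H1_add[OF u v] _ weak_gradient_add[OF u v]]
    L2_on_add[OF weak_gradient_works(1)[OF u] weak_gradient_works(1)[OF v]]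
  by (simp add: grad_def zero_ext_add)

lemma grad_scale:
  assumes u: "u \<in> H1 \<Omega>"
  shows "AE x in lebesgue. grad \<Omega> (\<lambda>x. c *\<^sub>R u x) x = c *\<^sub>R grad \<Omega> u x"
  using grad_unique[OF H1_scale[OF u] L2_on_scale[OF weak_gradient_works(1)[OF u]]
      is_weak_gradient_scale[OF weak_gradient_works(2)[OF u]], of c]
  by (simp add: grad_def zero_ext_scale)

lemma grad_diff:
  assumes u: "u \<in> H1 \<Omega>" and v: "v \<in> H1 \<Omega>"
  shows "AE x in lebesgue. grad \<Omega> (\<lambda>x. u x - v x) x = grad \<Omega> u x - grad \<Omega> v x"
  using grad_add[OF u H1_scale[OF v, of "-1"]] grad_scale[OF v, of "-1"]
  by eventually_elim simp

lemma grad_cong: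
  assumes u: "u \<in> H1 \<Omega>" and v: "v \<in> H1 \<Omega>" and ae: "AE x in lebesgue. x \<in> \<Omega> \<longrightarrow> u x = v x"
  shows "AE x in lebesgue. grad \<Omega> u x = grad \<Omega> v x"
proof -
  have "is_weak_gradient \<Omega> u (weak_gradient \<Omega> v)"
    using is_weak_gradient_cong[OF H1_imp_L2_on[OF u] H1_imp_L2_on[OF v] ae]
      weak_gradient_works(2)[OF v] by simp
  from grad_unique[OF u weak_gradient_works(1)[OF v] this] show ?thesis by (simp add: grad_def)
qed

lemma jacobian_zero_ext:
  fixes \<phi> :: "real^'n \<Rightarrow> real^'n"
  assumes "\<phi> \<in> test_functions \<Omega>"
  shows "zero_ext \<Omega> (\<lambda>x. jacobian \<phi> (at x)) = (\<lambda>x. jacobian \<phi> (at x))"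
  using jacobian_test_function(3)[OF assms] by (auto simp: zero_ext_def indicator_def)

lemma test_function_H1:
  fixes \<phi> :: "real^'n \<Rightarrow> real^'n"
  assumes \<phi>: "\<phi> \<in> test_functions \<Omega>"
  shows "\<phi> \<in> H1 \<Omega>"
proof -
  have "zero_ext \<Omega> \<phi> = \<phi>"
    using test_functions_outside[OF \<phi>] by (auto simp: zero_ext_def indicator_def)
  then have "\<phi> \<in> L2_on \<Omega>"
    using L2_lebesgue_borel(1)[OF test_function_L2[OF \<phi>]] by (simp add: L2_on_zero_ext)
  moreover have "(\<lambda>x. jacobian \<phi> (at x)) \<in> L2_on \<Omega>"
    using L2_lebesgue_borel(1)[OF jacobian_test_function(2)[OF \<phi>]]
    by (simp add: L2_on_zero_ext jacobian_zero_ext[OF \<phi>])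
  ultimately show ?thesis by (rule H1_I[OF _ _ jacobian_is_weak_gradient[OF \<phi>]])
qed

lemma grad_test_function:
  fixes \<phi> :: "real^'n \<Rightarrow> real^'n"
  assumes \<phi>: "\<phi> \<in> test_functions \<Omega>"
  shows "AE x in lebesgue. grad \<Omega> \<phi> x = jacobian \<phi> (at x)"
proof -
  have "(\<lambda>x. jacobian \<phi> (at x)) \<in> L2_on \<Omega>"
    using L2_lebesgue_borel(1)[OF jacobian_test_function(2)[OF \<phi>]]
    by (simp add: L2_on_zero_ext jacobian_zero_ext[OF \<phi>])
  from grad_unique[OF test_function_H1[OF \<phi>] this jacobian_is_weak_gradient[OF \<phi>]]
  show ?thesis by (simp add: jacobian_zero_ext[OF \<phi>])
qed

text \<open>The gradient of a difference is the difference of the gradients up to null sets, so convergence in the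
norm of \<open>H1 \<Omega>\<close> yields \<open>L\<^sup>2\<close> convergence of the Jacobian matrices. All further estimates depend on this
convergence alone.\<close>

lemma H10_gradient_approximation:
  assumes "u \<in> H10 \<Omega>"
  obtains s where "gradient_approximation \<Omega> u s"
proof -
  from assms have u: "u \<in> H1 \<Omega>" by (simp add: H10_def)
  obtain s where s: "\<And>k. s k \<in> test_functions \<Omega>"
    and lim: "(\<lambda>k. H1_norm \<Omega> (\<lambda>x. s k x - u x)) \<longlonglongrightarrow> 0"
    using assms by (auto simp: H10_def)
  have mem: "(\<lambda>x. jacobian (s k) (at x)) \<in> L2 lebesgue" for k
    by (rule L2_lebesgue_borel(1)[OF jacobian_test_function(2)[OF s]])
  have "L2_norm lebesgue (\<lambda>x. jacobian (s k) (at x) - grad \<Omega> u x) \<le> H1_norm \<Omega> (\<lambda>x. s k x - u x)" for k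
  proof -
    have "(\<lambda>x. s k x - u x) \<in> H1 \<Omega>"
      using H1_add[OF test_function_H1[OF s[of k]] H1_scale[OF u, of "-1"]] by simp
    then have "L2_norm lebesgue (\<lambda>x. jacobian (s k) (at x) - grad \<Omega> u x) =
        L2_norm lebesgue (grad \<Omega> (\<lambda>x. s k x - u x))"
      using grad_diff[OF test_function_H1[OF s[of k]] u] grad_test_function[OF s[of k]]
      by (intro L2_norm_cong_AE L2.diff_mem mem grad_L2 u) (assumption | force elim: eventually_elim2)+
    then show ?thesis using L2_norm_grad_le_H1_norm by simp
  qed
  then have "(\<lambda>k. L2_norm lebesgue (\<lambda>x. jacobian (s k) (at x) - grad \<Omega> u x)) \<longlonglongrightarrow> 0"
    by (intro L2.nrm_tendsto_zeroI[OF _ _ lim] L2.diff_mem mem grad_L2 u)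
  then show thesis using that[of s] s by (simp add: gradient_approximation_def)
qed

end

section \<open>The kernel inner product\<close>

lemma L2_tensor:
  fixes p q :: "'a::euclidean_space \<Rightarrow> 'b::euclidean_space"
  assumes p: "p \<in> L2 lborel" and q: "q \<in> L2 lborel"
  shows "(\<lambda>(x, y). p x \<bullet> q y) \<in> L2 (lborel \<Otimes>\<^sub>M lborel)"
proof -
  note [measurable] = L2_measurable[OF p] L2_measurable[OF q]
  have "integrable (lborel \<Otimes>\<^sub>M lborel) (\<lambda>(x, y). (norm (p x))\<^sup>2 * (norm (q y))\<^sup>2)"
    by (rule lborel_pair.Fubini_integrable)
      (use L2_integrable_square[OF p] L2_integrable_square[OF q] in \<open>auto simp: abs_mult\<close>)
  then have t: "(\<lambda>(x, y). norm (p x) * norm (q y)) \<in> L2 (lborel \<Otimes>\<^sub>M lborel)"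
    by (simp add: L2_def case_prod_beta' power_mult_distrib)
  show ?thesis
    by (rule L2_bound[OF t, where c = 1]) (auto simp: Cauchy_Schwarz_ineq2 abs_mult)
qed

text \<open>\<open>a\<close> is a Borel version of the kernel, cut off outside of \<open>\<Omega> \<times> \<Omega>\<close>. Integrals of \<open>A\<close> over \<open>\<Omega>\<close> become
integrals of \<open>a\<close> over the whole space, and the product measure is the product of the Borel measures.\<close>

locale kernel_on =
  fixes \<Omega> :: "(real^'n) set" and A :: "real^'n \<Rightarrow> real^'n \<Rightarrow> real" and a :: "(real^'n) \<times> (real^'n) \<Rightarrow> real"
  assumes open_\<Omega>: "open \<Omega>" and bounded_\<Omega>: "bounded \<Omega>"
    and A_commute: "A x y = A y x"
    and spd: "strictly_positive_definite \<Omega> A"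
    and a_L2: "a \<in> L2 (lborel \<Otimes>\<^sub>M lborel)"
    and a_eq: "AE z in lborel \<Otimes>\<^sub>M lborel. indicator (\<Omega> \<times> \<Omega>) z * A (fst z) (snd z) = a z"
begin

abbreviation form :: "(real^'n \<Rightarrow> 'b::euclidean_space) \<Rightarrow> (real^'n \<Rightarrow> 'b) \<Rightarrow> real" where
  "form p q \<equiv> L2_inner lborel p (integral_operator a q)"

text \<open>For almost every \<open>x\<close> the section of \<open>A\<close> agrees almost everywhere with the Borel section of \<open>a\<close>. This also
supplies the measurability of the inner and the outer integrand.\<close>

lemma iterated_integral_eq_form:
  fixes p q :: "real^'n \<Rightarrow> 'b::euclidean_space"
  assumes p: "p \<in> L2 lborel" and q: "q \<in> L2 lborel" and supp: "\<And>x. x \<notin> \<Omega> \<Longrightarrow> p x = 0"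
  shows "(LINT x:\<Omega>|lebesgue. (LINT y:\<Omega>|lebesgue. A x y * (p x \<bullet> q y))) = form p q"
  unfolding L2_inner_def set_lebesgue_integral_def[of lebesgue \<Omega> "\<lambda>x. LINT y:\<Omega>|lebesgue. A x y * (p x \<bullet> q y)"]
proof (rule integral_lebesgue_cong_AE)
  show "(\<lambda>x. p x \<bullet> integral_operator a q x) \<in> borel_measurable borel"
    using borel_measurable_inner[OF L2_measurable[OF p] integral_operator_L2(1)[OF a_L2 q]] by simp
  show "AE x in lborel. indicat_real \<Omega> x *\<^sub>R (LINT y:\<Omega>|lebesgue. A x y * (p x \<bullet> q y)) =
      p x \<bullet> integral_operator a q x"
    using lborel_pair.AE_pair[OF a_eq] L2_sections(1)[OF a_L2]
  proof eventually_elim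
    case (elim x)
    show ?case
    proof (cases "x \<in> \<Omega>")
      case True
      have "(\<lambda>y. a (x, y) * (p x \<bullet> q y)) \<in> borel_measurable lborel"
        by (intro borel_measurable_times L2_measurable[OF elim(2)] borel_measurable_inner
            borel_measurable_const L2_measurable[OF q])
      then have "(LINT y:\<Omega>|lebesgue. A x y * (p x \<bullet> q y)) = (\<integral>y. a (x, y) * (p x \<bullet> q y) \<partial>lborel)"
        unfolding set_lebesgue_integral_def
      proof (intro integral_lebesgue_cong_AE)
        show "AE y in lborel. indicat_real \<Omega> y *\<^sub>R (A x y * (p x \<bullet> q y)) = a (x, y) * (p x \<bullet> q y)"
          using elim(1) by eventually_elim (use True in \<open>auto simp: indicator_def split: if_splits\<close>)
      qed simp
      also have "\<dots> = (\<integral>y. p x \<bullet> (a (x, y) *\<^sub>R q y) \<partial>lborel)" by simp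
      also have "\<dots> = p x \<bullet> integral_operator a q x"
        unfolding integral_operator_def by (intro integral_inner_right L2_integrable_scaleR elim q)
      finally show ?thesis using True by simp
    qed (simp add: supp)
  qed
qed

text \<open>The kernel \<open>A\<close> is symmetric, but \<open>a\<close> only almost everywhere. Swapping the two quantifiers requires a
measurable exceptional set, hence the null set \<open>N\<close>.\<close>

lemma a_commute: "AE x in lborel. AE y in lborel. a (y, x) = a (x, y)"
proof -
  obtain N where N: "N \<in> null_sets (lborel \<Otimes>\<^sub>M lborel)"
    and sub: "{z \<in> space (lborel \<Otimes>\<^sub>M lborel). indicator (\<Omega> \<times> \<Omega>) z * A (fst z) (snd z) \<noteq> a z} \<subseteq> N"
    using a_eq by (auto simp: eventually_ae_filter)
  have "AE z in lborel \<Otimes>\<^sub>M lborel. z \<notin> N" using N by (rule AE_not_in)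
  then have 1: "AE x in lborel. AE y in lborel. (x, y) \<notin> N"
    by (rule lborel_pair.AE_pair)
  have compl: "{z \<in> space (lborel \<Otimes>\<^sub>M lborel). (fst z, snd z) \<notin> N} = space (lborel \<Otimes>\<^sub>M lborel) - N"
    by auto
  have "{z \<in> space (lborel \<Otimes>\<^sub>M lborel). (fst z, snd z) \<notin> N} \<in> sets (lborel \<Otimes>\<^sub>M lborel)"
    unfolding compl by (intro sets.compl_sets null_setsD2[OF N])
  with 1 have 2: "AE x in lborel. AE y in lborel. (y, x) \<notin> N"
    by (subst (asm) lborel_pair.AE_commute) auto
  have eq: "a (x, y) = indicator (\<Omega> \<times> \<Omega>) (x, y) * A x y" if "(x, y) \<notin> N" for x y
    using sub that by (force simp: space_pair_measure)
  show ?thesis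
    using 1 2
  proof eventually_elim
    case (elim x)
    from elim show ?case
      by eventually_elim (auto simp: eq A_commute indicator_def)
  qed
qed

lemma form_eq_iterated:
  assumes p: "p \<in> L2 lborel" and q: "q \<in> L2 lborel"
  shows "form p q = (\<integral>x. (\<integral>y. a (x, y) * (p x \<bullet> q y) \<partial>lborel) \<partial>lborel)"
  unfolding L2_inner_def
proof (rule integral_cong_AE)
  note [measurable] = L2_measurable[OF p] L2_measurable[OF q] L2_measurable[OF a_L2]
  show "(\<lambda>x. p x \<bullet> integral_operator a q x) \<in> borel_measurable lborel"
    by (intro borel_measurable_inner L2_measurable[OF p] integral_operator_L2(1)[OF a_L2 q])
  show "(\<lambda>x. \<integral>y. a (x, y) * (p x \<bullet> q y) \<partial>lborel) \<in> borel_measurable lborel"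
    by measurable
  show "AE x in lborel. p x \<bullet> integral_operator a q x = (\<integral>y. a (x, y) * (p x \<bullet> q y) \<partial>lborel)"
    using L2_sections(1)[OF a_L2]
  proof eventually_elim
    case (elim x)
    have "p x \<bullet> integral_operator a q x = (\<integral>y. p x \<bullet> (a (x, y) *\<^sub>R q y) \<partial>lborel)"
      unfolding integral_operator_def by (intro integral_inner_right[symmetric] L2_integrable_scaleR elim q)
    then show ?case by simp
  qed
qed

lemma form_commute:
  assumes p: "p \<in> L2 lborel" and q: "q \<in> L2 lborel"
  shows "form p q = form q p"
proof -
  note [measurable] = L2_measurable[OF p] L2_measurable[OF q] L2_measurable[OF a_L2]
  have "integrable (lborel \<Otimes>\<^sub>M lborel) (\<lambda>z. a z * (case z of (x, y) \<Rightarrow> p x \<bullet> q y))"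
    using L2_integrable_inner[OF a_L2 L2_tensor[OF p q]] by simp
  then have int: "integrable (lborel \<Otimes>\<^sub>M lborel) (\<lambda>(x, y). a (x, y) * (p x \<bullet> q y))"
    by (simp add: case_prod_beta')
  have "form p q = (\<integral>y. (\<integral>x. a (x, y) * (p x \<bullet> q y) \<partial>lborel) \<partial>lborel)"
    unfolding form_eq_iterated[OF p q] by (rule lborel_pair.Fubini_integral[OF int, symmetric])
  also have "\<dots> = (\<integral>x. (\<integral>y. a (x, y) * (q x \<bullet> p y) \<partial>lborel) \<partial>lborel)"
  proof (rule integral_cong_AE)
    show "AE x in lborel. (\<integral>y. a (y, x) * (p y \<bullet> q x) \<partial>lborel) = (\<integral>y. a (x, y) * (q x \<bullet> p y) \<partial>lborel)"
      using a_commute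
    proof eventually_elim
      case (elim x)
      show ?case
      proof (rule integral_cong_AE)
        show "AE y in lborel. a (y, x) * (p y \<bullet> q x) = a (x, y) * (q x \<bullet> p y)"
          using elim by eventually_elim (simp add: inner_commute)
      qed measurable
    qed
  qed measurable
  also have "\<dots> = form q p" by (rule form_eq_iterated[OF q p, symmetric])
  finally show ?thesis .
qed

lemma form_nonneg_real:
  assumes \<phi>: "\<phi> \<in> test_functions \<Omega>"
  shows "0 \<le> form \<phi> (\<phi> :: real^'n \<Rightarrow> real)"
proof (cases "\<phi> = (\<lambda>x. 0)")
  case True
  then show ?thesis by (simp add: L2_inner_def)
next
  case False
  then have "0 < (LINT x:\<Omega>|lebesgue. (LINT x':\<Omega>|lebesgue. A x x' * \<phi> x * \<phi> x'))"
    using spd \<phi> by (auto simp: strictly_positive_definite_def)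
  also have "\<dots> = form \<phi> \<phi>"
    using iterated_integral_eq_form[OF test_function_L2[OF \<phi>] test_function_L2[OF \<phi>]
        test_functions_outside[OF \<phi>]]
    by (simp add: mult.assoc)
  finally show ?thesis by simp
qed

text \<open>Positivity of the kernel concerns scalar test functions. The form of a Jacobian matrix is the sum of
the forms of its entries, and each entry is a test function.\<close>

lemma form_nonneg:
  fixes u :: "real^'n \<Rightarrow> real^'n"
  assumes u: "u \<in> test_functions \<Omega>"
  shows "0 \<le> form (\<lambda>x. jacobian u (at x)) (\<lambda>x. jacobian u (at x))"
proof -
  define J where "J x = jacobian u (at x)" for x
  have J: "J \<in> L2 lborel" using jacobian_test_function(2)[OF u] by (simp add: J_def[abs_def])
  have Jt: "(\<lambda>x. J x $ k $ m) \<in> test_functions \<Omega>" for k m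
    using jacobian_test_function(4)[OF u] by (simp add: J_def)
  have JL: "(\<lambda>x. J x $ k $ m) \<in> L2 lborel" for k m
    by (rule test_function_L2[OF Jt])
  have int: "integrable lborel (\<lambda>x. J x $ k $ m * integral_operator a (\<lambda>y. J y $ k $ m) x)" for k m
    using L2_integrable_inner[OF JL integral_operator_L2(3)[OF a_L2 JL]] by simp
  have "form J J = (\<integral>x. (\<Sum>k\<in>UNIV. \<Sum>m\<in>UNIV. J x $ k $ m * integral_operator a (\<lambda>y. J y $ k $ m) x) \<partial>lborel)"
    unfolding L2_inner_def
  proof (rule integral_cong_AE)
    show "AE x in lborel. J x \<bullet> integral_operator a J x =
        (\<Sum>k\<in>UNIV. \<Sum>m\<in>UNIV. J x $ k $ m * integral_operator a (\<lambda>y. J y $ k $ m) x)"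
      using L2_sections(1)[OF a_L2]
    proof eventually_elim
      case (elim x)
      have bl: "bounded_linear (\<lambda>M::real^'n^'n. M $ k $ m)" for k m
        using bounded_linear_compose[OF bounded_linear_vec_nth bounded_linear_vec_nth] .
      have "integral_operator a J x $ k $ m = integral_operator a (\<lambda>y. J y $ k $ m) x" for k m
        using integral_bounded_linear[OF bl L2_integrable_scaleR[OF elim J], of k m]
        by (simp add: integral_operator_def)
      then show ?case by (simp add: inner_vec_def)
    qed
    show "(\<lambda>x. J x \<bullet> integral_operator a J x) \<in> borel_measurable lborel"
      using L2_integrable_inner[OF J integral_operator_L2(3)[OF a_L2 J]] by simp
    show "(\<lambda>x. \<Sum>k\<in>UNIV. \<Sum>m\<in>UNIV. J x $ k $ m * integral_operator a (\<lambda>y. J y $ k $ m) x)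
        \<in> borel_measurable lborel"
      using int by (intro borel_measurable_sum borel_measurable_integrable)
  qed
  also have "\<dots> = (\<Sum>k\<in>UNIV. \<Sum>m\<in>UNIV. form (\<lambda>x. J x $ k $ m) (\<lambda>x. J x $ k $ m))"
    using int by (simp add: L2_inner_def)
  also have "\<dots> \<ge> 0" by (intro sum_nonneg form_nonneg_real Jt)
  finally show ?thesis by (simp add: J_def[abs_def])
qed

lemma kernel_inner_eq_form:
  assumes u: "u \<in> test_functions \<Omega>" and v: "v \<in> test_functions \<Omega>"
  shows "kernel_inner \<Omega> A u v = form (\<lambda>x. jacobian u (at x)) (\<lambda>x. jacobian v (at x))"
  unfolding kernel_inner_def
  by (rule iterated_integral_eq_form[OF jacobian_test_function(2)[OF u] jacobian_test_function(2)[OF v]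
        jacobian_test_function(3)[OF u]])

lemma jacobian_add:
  fixes u v :: "real^'n \<Rightarrow> real^'n"
  assumes u: "u \<in> test_functions \<Omega>" and v: "v \<in> test_functions \<Omega>"
  shows "jacobian (\<lambda>x. u x + v x) (at x) = jacobian u (at x) + jacobian v (at x)"
proof -
  have "((\<lambda>x. u x + v x) has_derivative
      (\<lambda>h. frechet_derivative u (at x) h + frechet_derivative v (at x) h)) (at x)"
    by (intro has_derivative_add has_frechet_derivative[OF test_functions_C_k[OF u, of "Suc 0"]]
        has_frechet_derivative[OF test_functions_C_k[OF v, of "Suc 0"]])
  from frechet_derivative_at[OF this, symmetric] show ?thesis
    by (simp add: vec_eq_iff jacobian_nth)
qed

lemma jacobian_scale:
  fixes u :: "real^'n \<Rightarrow> real^'n"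
  assumes u: "u \<in> test_functions \<Omega>"
  shows "jacobian (\<lambda>x. c *\<^sub>R u x) (at x) = c *\<^sub>R jacobian u (at x)"
proof -
  have "((\<lambda>x. c *\<^sub>R u x) has_derivative (\<lambda>h. c *\<^sub>R frechet_derivative u (at x) h)) (at x)"
    by (intro has_derivative_scaleR_right has_frechet_derivative[OF test_functions_C_k[OF u, of "Suc 0"]])
  from frechet_derivative_at[OF this, symmetric] show ?thesis
    by (simp add: vec_eq_iff jacobian_nth)
qed

sublocale V: semi_inner_space "test_functions \<Omega>" "kernel_inner \<Omega> A"
proof
  fix u v w :: "real^'n \<Rightarrow> real^'n" and c :: real
  assume u: "u \<in> test_functions \<Omega>" and v: "v \<in> test_functions \<Omega>"
  note J = jacobian_test_function(2)
  show add: "(\<lambda>x. u x + v x) \<in> test_functions \<Omega>" by (rule test_functions_add[OF u v])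
  show "kernel_inner \<Omega> A u v = kernel_inner \<Omega> A v u"
    by (simp add: kernel_inner_eq_form u v form_commute J[OF u] J[OF v])
  show "kernel_inner \<Omega> A (\<lambda>x. u x + v x) w = kernel_inner \<Omega> A u w + kernel_inner \<Omega> A v w"
    if w: "w \<in> test_functions \<Omega>"
    by (simp add: kernel_inner_eq_form u v w add jacobian_add[OF u v]
        L2.ip_add_left[OF J[OF u] J[OF v] integral_operator_L2(3)[OF a_L2 J[OF w]]])
  have "(\<lambda>x. c *\<^sub>R u x) \<in> test_functions \<Omega>"
    by (rule test_functions_bounded_linear[OF bounded_linear_scaleR_right u])
  then show "kernel_inner \<Omega> A (\<lambda>x. c *\<^sub>R u x) v = c * kernel_inner \<Omega> A u v"
    by (simp add: kernel_inner_eq_form u v jacobian_scale[OF u]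
        L2.ip_scale_left[OF J[OF u] integral_operator_L2(3)[OF a_L2 J[OF v]]])
next
  fix u :: "real^'n \<Rightarrow> real^'n" and c :: real
  assume u: "u \<in> test_functions \<Omega>"
  show "(\<lambda>x. c *\<^sub>R u x) \<in> test_functions \<Omega>"
    by (rule test_functions_bounded_linear[OF bounded_linear_scaleR_right u])
  show "0 \<le> kernel_inner \<Omega> A u u"
    by (simp add: kernel_inner_eq_form u form_nonneg)
qed

lemma jacobian_diff:
  fixes u v :: "real^'n \<Rightarrow> real^'n"
  assumes u: "u \<in> test_functions \<Omega>" and v: "v \<in> test_functions \<Omega>"
  shows "jacobian (\<lambda>x. u x - v x) (at x) = jacobian u (at x) - jacobian v (at x)"
  using jacobian_add[OF u V.scale_mem[OF v, of "-1"], of x] jacobian_scale[OF v, of "-1" x] by simp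

lemma V_nrm_le:
  assumes u: "u \<in> test_functions \<Omega>"
  shows "V.nrm u \<le> sqrt (L2_norm (lborel \<Otimes>\<^sub>M lborel) a) * L2_norm lebesgue (\<lambda>x. jacobian u (at x))"
proof -
  let ?J = "\<lambda>x. jacobian u (at x)"
  note J = jacobian_test_function(2)[OF u]
  have "kernel_inner \<Omega> A u u \<le> L2_norm lborel ?J * L2_norm lborel (integral_operator a ?J)"
    unfolding kernel_inner_eq_form[OF u u]
    using L2.Cauchy_Schwarz[OF J integral_operator_L2(3)[OF a_L2 J]] by linarith
  also have "\<dots> \<le> L2_norm lborel ?J * (L2_norm (lborel \<Otimes>\<^sub>M lborel) a * L2_norm lborel ?J)"
    by (intro mult_left_mono integral_operator_L2(4) a_L2 J L2.nrm_nonneg)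
  also have "\<dots> = L2_norm (lborel \<Otimes>\<^sub>M lborel) a * (L2_norm lborel ?J)\<^sup>2"
    by (simp add: power2_eq_square)
  finally have "sqrt (kernel_inner \<Omega> A u u) \<le> sqrt (L2_norm (lborel \<Otimes>\<^sub>M lborel) a * (L2_norm lborel ?J)\<^sup>2)"
    by (rule real_sqrt_le_mono)
  also have "\<dots> = sqrt (L2_norm (lborel \<Otimes>\<^sub>M lborel) a) * L2_norm lborel ?J"
    using L2.nrm_nonneg[OF J] by (simp add: real_sqrt_mult)
  finally show ?thesis by (simp add: ip_norm_def[of "kernel_inner \<Omega> A"] L2_lebesgue_borel(2)[OF J])
qed

text \<open>Let \<open>d\<close> be the difference of two Jacobian matrices of the subsequence. The squared norm is at most the
\<open>L\<^sup>2\<close> norm of \<open>d\<close>, which is at most \<open>2 * C\<close>, times that of its image, and the images converge in \<open>L\<^sup>2\<close>.\<close>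

lemma V_nrm_compact:
  fixes \<phi> :: "nat \<Rightarrow> real^'n \<Rightarrow> real^'n"
  assumes \<phi>: "\<And>k. \<phi> k \<in> test_functions \<Omega>" and C: "\<And>k. L2_norm lebesgue (\<lambda>x. jacobian (\<phi> k) (at x)) \<le> C"
  obtains r :: "nat \<Rightarrow> nat" where "strict_mono r" "(\<lambda>k. \<phi> (r k)) \<in> V.CS"
proof -
  define J where "J k x = jacobian (\<phi> k) (at x)" for k x
  have J: "J k \<in> L2 lborel" for k
    using jacobian_test_function(2)[OF \<phi>] by (simp add: J_def[abs_def])
  have JC: "L2_norm lborel (J k) \<le> C" for k
    using C[of k] L2_lebesgue_borel(2)[OF J[of k]] by (simp add: J_def[abs_def])
  have J0: "J k x = 0" if "x \<notin> \<Omega>" for k x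
    using jacobian_test_function(3)[OF \<phi> that] by (simp add: J_def)
  have \<Omega>: "\<Omega> \<in> sets borel" "emeasure lborel \<Omega> < \<infinity>"
    using open_\<Omega> emeasure_bounded_finite[OF bounded_\<Omega>] by auto
  obtain r l where r: "strict_mono r" and l: "l \<in> L2 lborel"
    and lim: "(\<lambda>k. L2_norm lborel (\<lambda>x. integral_operator a (J (r k)) x - l x)) \<longlonglongrightarrow> 0"
    by (rule integral_operator_compact[OF a_L2 J JC \<Omega> J0]) (assumption | rule that)+
  define e where "e k = L2_norm lborel (\<lambda>x. integral_operator a (J (r k)) x - l x)" for k
  have C0: "0 \<le> C" using JC[of 0] L2.nrm_nonneg[OF J[of 0]] by linarith
  note K = integral_operator_L2(3)[OF a_L2 J]
  have e0: "0 \<le> e k" for k unfolding e_def by (intro L2.nrm_nonneg L2.diff_mem K l)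
  have "(\<lambda>k. \<phi> (r k)) \<in> V.CS"
  proof (rule V.cauchyI)
    show "(\<lambda>k. sqrt (2 * C * e k)) \<longlonglongrightarrow> 0"
      using tendsto_real_sqrt[OF tendsto_mult_right_zero[OF lim, of "2 * C"]] by (simp add: e_def)
    show "V.nrm (\<lambda>x. \<phi> (r i) x - \<phi> (r j) x) \<le> sqrt (2 * C * e i) + sqrt (2 * C * e j)" for i j
    proof -
      let ?d = "\<lambda>x. J (r i) x - J (r j) x"
      have d: "?d \<in> L2 lborel" by (intro L2.diff_mem J)
      have "L2_norm lborel (integral_operator a ?d) =
          L2_norm lborel (\<lambda>x. integral_operator a (J (r i)) x - integral_operator a (J (r j)) x)"
        by (intro L2_norm_cong_AE integral_operator_diff a_L2 J integral_operator_L2(3) L2.diff_mem K)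
      also have "\<dots> \<le> e i + e j"
        using L2.nrm_diff_triangle[OF K l K, of "r i" "r j"] L2.nrm_commute[OF l K, of "r j"]
        by (simp add: e_def)
      finally have Kd: "L2_norm lborel (integral_operator a ?d) \<le> e i + e j" .
      have "L2_norm lborel ?d \<le> 2 * C"
        using L2.nrm_triangle[OF J[of "r i"] L2_scale[OF J[of "r j"], of "-1"]]
          L2.nrm_scale[OF J[of "r j"], of "-1"] JC[of "r i"] JC[of "r j"] by simp
      then have "L2_norm lborel ?d * L2_norm lborel (integral_operator a ?d) \<le> 2 * C * (e i + e j)"
        using Kd C0 by (intro mult_mono) (auto intro: L2.nrm_nonneg integral_operator_L2(3) a_L2 d)
      moreover have "form ?d ?d \<le> L2_norm lborel ?d * L2_norm lborel (integral_operator a ?d)"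
        using L2.Cauchy_Schwarz[OF d integral_operator_L2(3)[OF a_L2 d]] by linarith
      moreover have "kernel_inner \<Omega> A (\<lambda>x. \<phi> (r i) x - \<phi> (r j) x) (\<lambda>x. \<phi> (r i) x - \<phi> (r j) x) = form ?d ?d"
        by (subst kernel_inner_eq_form) (simp_all add: V.diff_mem \<phi> jacobian_diff J_def)
      ultimately have "V.nrm (\<lambda>x. \<phi> (r i) x - \<phi> (r j) x) \<le> sqrt (2 * C * e i + 2 * C * e j)"
        unfolding ip_norm_def[of "kernel_inner \<Omega> A"] by (intro real_sqrt_le_mono) (simp add: distrib_left)
      also have "\<dots> \<le> sqrt (2 * C * e i) + sqrt (2 * C * e j)"
        using C0 e0 by (intro sqrt_add_le_add_sqrt) auto
      finally show ?thesis .
    qed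
  qed (rule \<phi>)
  then show thesis using r that by blast
qed

section \<open>The embedding\<close>

abbreviation approximates :: "(nat \<Rightarrow> real^'n \<Rightarrow> real^'n) \<Rightarrow> (real^'n \<Rightarrow> real^'n) \<Rightarrow> bool" where
  "approximates s u \<equiv> gradient_approximation \<Omega> u s"

definition form_bound :: real where "form_bound = sqrt (L2_norm (lborel \<Otimes>\<^sub>M lborel) a)"

lemma form_bound_nonneg: "0 \<le> form_bound"
  using L2.nrm_nonneg[OF a_L2] by (simp add: form_bound_def)

lemma approximatesD:
  assumes "approximates s u"
  shows "s k \<in> test_functions \<Omega>" "(\<lambda>x. jacobian (s k) (at x)) \<in> L2 lebesgue"
    "(\<lambda>k. L2_norm lebesgue (\<lambda>x. jacobian (s k) (at x) - grad \<Omega> u x)) \<longlonglongrightarrow> 0"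
proof -
  show s: "s k \<in> test_functions \<Omega>"
    "(\<lambda>k. L2_norm lebesgue (\<lambda>x. jacobian (s k) (at x) - grad \<Omega> u x)) \<longlonglongrightarrow> 0"
    using assms by (simp_all add: gradient_approximation_def)
  show "(\<lambda>x. jacobian (s k) (at x)) \<in> L2 lebesgue"
    by (rule L2_lebesgue_borel(1)[OF jacobian_test_function(2)[OF s(1)]])
qed

text \<open>\<open>G\<close> is the common limit of the gradients. It need not be the gradient of a test function, so the
triangle inequality through it is the one of \<open>L\<^sup>2\<close>.\<close>

lemma V_nrm_diff_le:
  assumes f: "f \<in> test_functions \<Omega>" and g: "g \<in> test_functions \<Omega>" and G: "G \<in> L2 lebesgue"
  shows "V.nrm (\<lambda>x. f x - g x) \<le> form_bound * L2_norm lebesgue (\<lambda>x. jacobian f (at x) - G x) +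
    form_bound * L2_norm lebesgue (\<lambda>x. jacobian g (at x) - G x)"
proof -
  have J: "(\<lambda>x. jacobian h (at x)) \<in> L2 lebesgue" if "h \<in> test_functions \<Omega>" for h :: "real^'n \<Rightarrow> real^'n"
    by (rule L2_lebesgue_borel(1)[OF jacobian_test_function(2)[OF that]])
  have "V.nrm (\<lambda>x. f x - g x) \<le> form_bound * L2_norm lebesgue (\<lambda>x. jacobian f (at x) - jacobian g (at x))"
    using V_nrm_le[OF V.diff_mem[OF f g]] by (simp add: form_bound_def jacobian_diff[OF f g])
  also have "\<dots> \<le> form_bound * (L2_norm lebesgue (\<lambda>x. jacobian f (at x) - G x) +
      L2_norm lebesgue (\<lambda>x. jacobian g (at x) - G x))"
    using L2.nrm_diff_triangle[OF J[OF f] G J[OF g]] L2.nrm_commute[OF G J[OF g]]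
    by (intro mult_left_mono form_bound_nonneg) simp
  finally show ?thesis by (simp add: distrib_left)
qed

lemma approximates_cauchy:
  assumes u: "u \<in> H1 \<Omega>" and s: "approximates s u"
  shows "s \<in> V.CS"
  by (rule V.cauchyI[OF approximatesD(1)[OF s] tendsto_mult_right_zero[OF approximatesD(3)[OF s]]])
    (rule V_nrm_diff_le[OF approximatesD(1)[OF s] approximatesD(1)[OF s] grad_L2[OF u]])

text \<open>This is what makes the choice in the following definition harmless.\<close>

lemma approximates_unique:
  assumes u: "u \<in> H1 \<Omega>" and s: "approximates s u" and t: "approximates t u"
  shows "V.cls s = V.cls t"
proof -
  have "(\<lambda>k. V.nrm (\<lambda>x. s k x - t k x)) \<longlonglongrightarrow> 0"
  proof (rule V.nrm_tendsto_zeroI)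
    show "(\<lambda>k. form_bound * L2_norm lebesgue (\<lambda>x. jacobian (s k) (at x) - grad \<Omega> u x) +
        form_bound * L2_norm lebesgue (\<lambda>x. jacobian (t k) (at x) - grad \<Omega> u x)) \<longlonglongrightarrow> 0"
      by (intro tendsto_add_zero tendsto_mult_right_zero approximatesD(3) s t)
    show "(\<lambda>x. s k x - t k x) \<in> test_functions \<Omega>" for k
      by (intro V.diff_mem approximatesD(1)[OF s] approximatesD(1)[OF t])
    show "V.nrm (\<lambda>x. s k x - t k x) \<le> form_bound * L2_norm lebesgue (\<lambda>x. jacobian (s k) (at x) - grad \<Omega> u x) +
        form_bound * L2_norm lebesgue (\<lambda>x. jacobian (t k) (at x) - grad \<Omega> u x)" for k
      by (rule V_nrm_diff_le[OF approximatesD(1)[OF s] approximatesD(1)[OF t] grad_L2[OF u]])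
  qed
  then show ?thesis
    using V.cls_eq_iff[OF approximates_cauchy[OF u s] approximates_cauchy[OF u t]] by simp
qed

definition embedding :: "(real^'n \<Rightarrow> real^'n) \<Rightarrow> (real^'n, real^'n) completion_point" where
  "embedding u = V.cls (SOME s. approximates s u)"

lemma embedding_eq:
  assumes "u \<in> H1 \<Omega>" and "approximates s u"
  shows "embedding u = V.cls s"
  unfolding embedding_def
  by (rule approximates_unique[OF assms(1) someI[of "\<lambda>s. approximates s u", OF assms(2)] assms(2)])

lemma H10_approximates:
  assumes "u \<in> H10 \<Omega>"
  obtains s where "u \<in> H1 \<Omega>" "approximates s u"
proof -
  obtain s where "approximates s u"
    by (rule H10_gradient_approximation[OF open_\<Omega> bounded_\<Omega> assms])
  then show thesis using assms that by (simp add: H10_def)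
qed

lemma approximates_cong:
  assumes u: "u \<in> H1 \<Omega>" and v: "v \<in> H1 \<Omega>" and s: "approximates s u"
    and ae: "AE x in lebesgue. x \<in> \<Omega> \<longrightarrow> u x = v x"
  shows "approximates s v"
proof -
  have "L2_norm lebesgue (\<lambda>x. jacobian (s k) (at x) - grad \<Omega> u x) =
      L2_norm lebesgue (\<lambda>x. jacobian (s k) (at x) - grad \<Omega> v x)" for k
    using grad_cong[OF open_\<Omega> bounded_\<Omega> u v ae]
    by (intro L2_norm_cong_AE L2.diff_mem approximatesD(2)[OF s] grad_L2 u v) (auto elim: eventually_mono)
  then show ?thesis using s by (simp add: gradient_approximation_def)
qed

lemma approximates_add:
  assumes u: "u \<in> H1 \<Omega>" and v: "v \<in> H1 \<Omega>" and s: "approximates s u" and t: "approximates t v"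
  shows "approximates (\<lambda>k x. s k x + t k x) (\<lambda>x. u x + v x)"
  unfolding gradient_approximation_def
proof (intro conjI allI)
  note st = approximatesD(1)[OF s] approximatesD(1)[OF t]
  note J = approximatesD(2)[OF s] approximatesD(2)[OF t]
  show add: "(\<lambda>x. s k x + t k x) \<in> test_functions \<Omega>" for k
    by (rule V.add_mem[OF st])
  note G = grad_L2[OF u] grad_L2[OF v]
  have Js: "(\<lambda>x. jacobian (\<lambda>x. s k x + t k x) (at x)) \<in> L2 lebesgue" for k
    by (rule L2_lebesgue_borel(1)[OF jacobian_test_function(2)[OF add]])
  have le: "L2_norm lebesgue (\<lambda>x. jacobian (\<lambda>x. s k x + t k x) (at x) - grad \<Omega> (\<lambda>x. u x + v x) x) \<le>
      L2_norm lebesgue (\<lambda>x. jacobian (s k) (at x) - grad \<Omega> u x) +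
      L2_norm lebesgue (\<lambda>x. jacobian (t k) (at x) - grad \<Omega> v x)" for k
  proof -
    have "L2_norm lebesgue (\<lambda>x. jacobian (\<lambda>x. s k x + t k x) (at x) - grad \<Omega> (\<lambda>x. u x + v x) x) =
        L2_norm lebesgue (\<lambda>x. (jacobian (s k) (at x) - grad \<Omega> u x) + (jacobian (t k) (at x) - grad \<Omega> v x))"
    proof (intro L2_norm_cong_AE L2.diff_mem L2_add Js J G grad_L2 H1_add u v)
      show "AE x in lebesgue. jacobian (\<lambda>x. s k x + t k x) (at x) - grad \<Omega> (\<lambda>x. u x + v x) x =
          (jacobian (s k) (at x) - grad \<Omega> u x) + (jacobian (t k) (at x) - grad \<Omega> v x)"
        using grad_add[OF open_\<Omega> bounded_\<Omega> u v] by eventually_elim (simp add: jacobian_add[OF st])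
    qed
    also have "\<dots> \<le> L2_norm lebesgue (\<lambda>x. jacobian (s k) (at x) - grad \<Omega> u x) +
        L2_norm lebesgue (\<lambda>x. jacobian (t k) (at x) - grad \<Omega> v x)"
      by (intro L2.nrm_triangle L2.diff_mem J G)
    finally show ?thesis .
  qed
  show "(\<lambda>k. L2_norm lebesgue (\<lambda>x. jacobian (\<lambda>x. s k x + t k x) (at x) - grad \<Omega> (\<lambda>x. u x + v x) x))
      \<longlonglongrightarrow> 0"
    by (rule L2.nrm_tendsto_zeroI[OF _ le tendsto_add_zero[OF approximatesD(3)[OF s] approximatesD(3)[OF t]]])
      (intro L2.diff_mem Js grad_L2 H1_add u v)
qed

lemma approximates_scale:
  assumes u: "u \<in> H1 \<Omega>" and s: "approximates s u"
  shows "approximates (\<lambda>k x. c *\<^sub>R s k x) (\<lambda>x. c *\<^sub>R u x)"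
  unfolding gradient_approximation_def
proof (intro conjI allI)
  note st = approximatesD(1)[OF s]
  note J = approximatesD(2)[OF s]
  show sc: "(\<lambda>x. c *\<^sub>R s k x) \<in> test_functions \<Omega>" for k
    by (rule V.scale_mem[OF st])
  have Js: "(\<lambda>x. jacobian (\<lambda>x. c *\<^sub>R s k x) (at x)) \<in> L2 lebesgue" for k
    by (rule L2_lebesgue_borel(1)[OF jacobian_test_function(2)[OF sc]])
  have "L2_norm lebesgue (\<lambda>x. jacobian (\<lambda>x. c *\<^sub>R s k x) (at x) - grad \<Omega> (\<lambda>x. c *\<^sub>R u x) x) =
      \<bar>c\<bar> * L2_norm lebesgue (\<lambda>x. jacobian (s k) (at x) - grad \<Omega> u x)" for k
  proof -
    have "L2_norm lebesgue (\<lambda>x. jacobian (\<lambda>x. c *\<^sub>R s k x) (at x) - grad \<Omega> (\<lambda>x. c *\<^sub>R u x) x) =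
        L2_norm lebesgue (\<lambda>x. c *\<^sub>R (jacobian (s k) (at x) - grad \<Omega> u x))"
    proof (intro L2_norm_cong_AE L2.diff_mem L2_scale Js J grad_L2 H1_scale u)
      show "AE x in lebesgue. jacobian (\<lambda>x. c *\<^sub>R s k x) (at x) - grad \<Omega> (\<lambda>x. c *\<^sub>R u x) x =
          c *\<^sub>R (jacobian (s k) (at x) - grad \<Omega> u x)"
        using grad_scale[OF open_\<Omega> bounded_\<Omega> u, of c]
        by eventually_elim (simp add: jacobian_scale[OF st] scaleR_diff_right)
    qed
    then show ?thesis
      using L2.nrm_scale[OF L2.diff_mem[OF J grad_L2[OF u]]] by simp
  qed
  then show "(\<lambda>k. L2_norm lebesgue (\<lambda>x. jacobian (\<lambda>x. c *\<^sub>R s k x) (at x) - grad \<Omega> (\<lambda>x. c *\<^sub>R u x) x))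
      \<longlonglongrightarrow> 0"
    using tendsto_mult_right_zero[OF approximatesD(3)[OF s], of "\<bar>c\<bar>"] by simp
qed

lemma approximates_test_function:
  assumes \<phi>: "\<phi> \<in> test_functions \<Omega>"
  shows "approximates (\<lambda>k. \<phi>) \<phi>"
proof -
  have J: "(\<lambda>x. jacobian \<phi> (at x)) \<in> L2 lebesgue"
    by (rule L2_lebesgue_borel(1)[OF jacobian_test_function(2)[OF \<phi>]])
  note G = grad_L2[OF test_function_H1[OF open_\<Omega> bounded_\<Omega> \<phi>]]
  have "L2_norm lebesgue (\<lambda>x. jacobian \<phi> (at x) - grad \<Omega> \<phi> x) = L2_norm lebesgue (\<lambda>x :: real^'n. 0 :: real^'n^'n)"
    using grad_test_function[OF open_\<Omega> bounded_\<Omega> \<phi>]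
    by (intro L2_norm_cong_AE L2.diff_mem J G) (auto simp: L2_def elim: eventually_mono)
  then show ?thesis using \<phi> by (simp add: gradient_approximation_def L2_norm_eq)
qed

lemma embedding_norm_le:
  assumes u: "u \<in> H10 \<Omega>"
  shows "V_norm \<Omega> A (embedding u) \<le> form_bound * H1_norm \<Omega> u"
proof -
  obtain s where u1: "u \<in> H1 \<Omega>" and s: "approximates s u"
    using u by (rule H10_approximates)
  note cs = approximates_cauchy[OF u1 s]
  have "V_norm \<Omega> A (embedding u) \<le> form_bound * L2_norm lebesgue (grad \<Omega> u)"
    unfolding embedding_eq[OF u1 s]
  proof (rule LIMSEQ_le[OF V.norm_cls[OF cs]])
    show "(\<lambda>k. form_bound * (L2_norm lebesgue (\<lambda>x. jacobian (s k) (at x) - grad \<Omega> u x) +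
        L2_norm lebesgue (grad \<Omega> u))) \<longlonglongrightarrow> form_bound * L2_norm lebesgue (grad \<Omega> u)"
      using tendsto_mult_left[OF tendsto_add[OF approximatesD(3)[OF s] tendsto_const]] by simp
    have "V.nrm (s k) \<le> form_bound * (L2_norm lebesgue (\<lambda>x. jacobian (s k) (at x) - grad \<Omega> u x) +
        L2_norm lebesgue (grad \<Omega> u))" for k
    proof -
      have "V.nrm (s k) \<le> form_bound * L2_norm lebesgue (\<lambda>x. jacobian (s k) (at x))"
        using V_nrm_le[OF approximatesD(1)[OF s]] by (simp add: form_bound_def)
      also have "\<dots> \<le> form_bound * (L2_norm lebesgue (\<lambda>x. jacobian (s k) (at x) - grad \<Omega> u x) +
          L2_norm lebesgue (grad \<Omega> u))"
        using L2.nrm_triangle[OF L2.diff_mem[OF approximatesD(2)[OF s] grad_L2[OF u1]] grad_L2[OF u1], of k]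
        by (intro mult_left_mono form_bound_nonneg) simp
      finally show ?thesis .
    qed
    then show "\<exists>N. \<forall>k\<ge>N. V.nrm (s k) \<le> form_bound * (L2_norm lebesgue (\<lambda>x. jacobian (s k) (at x) - grad \<Omega> u x) +
        L2_norm lebesgue (grad \<Omega> u))" by blast
  qed
  also have "\<dots> \<le> form_bound * H1_norm \<Omega> u"
    by (intro mult_left_mono form_bound_nonneg L2_norm_grad_le_H1_norm)
  finally show ?thesis .
qed

lemma bounded_linear_embedding: "bounded_linear_H10_V \<Omega> A embedding"
  unfolding bounded_linear_H10_V_def
proof (intro conjI ballI allI impI)
  fix u assume u: "u \<in> H10 \<Omega>"
  obtain s where u1: "u \<in> H1 \<Omega>" and s: "approximates s u"
    using u by (rule H10_approximates)
  note cs = approximates_cauchy[OF u1 s]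
  show "embedding u \<in> V_space \<Omega> A"
    unfolding V_space_def embedding_eq[OF u1 s] by (rule V.cls_in_completion[OF cs])
  show "embedding (\<lambda>x. c *\<^sub>R u x) = V_scale \<Omega> A c (embedding u)" for c
    unfolding embedding_eq[OF H1_scale[OF u1] approximates_scale[OF u1 s]] embedding_eq[OF u1 s]
    by (rule V.scale_cls[OF cs, symmetric])
  fix v assume v: "v \<in> H10 \<Omega>"
  obtain t where v1: "v \<in> H1 \<Omega>" and t: "approximates t v"
    using v by (rule H10_approximates)
  show "embedding (\<lambda>x. u x + v x) = V_add \<Omega> A (embedding u) (embedding v)"
    unfolding embedding_eq[OF H1_add[OF u1 v1] approximates_add[OF u1 v1 s t]]
      embedding_eq[OF u1 s] embedding_eq[OF v1 t]
    by (rule V.add_cls[OF cs approximates_cauchy[OF v1 t], symmetric])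
  show "embedding u = embedding v" if "AE x in lebesgue. x \<in> \<Omega> \<longrightarrow> u x = v x"
    unfolding embedding_eq[OF u1 s] embedding_eq[OF v1 approximates_cong[OF u1 v1 s that]] ..
next
  show "\<exists>C. \<forall>u\<in>H10 \<Omega>. V_norm \<Omega> A (embedding u) \<le> C * H1_norm \<Omega> u"
    using embedding_norm_le by blast
qed

text \<open>Each \<open>u k\<close> is replaced by one of its approximating test functions, \<open>\<phi> k\<close>, whose gradient is
\<open>1 / Suc k\<close>-close. A subsequence of the \<open>\<phi> k\<close> is Cauchy, and its class is the limit \<open>X\<close>. The distance
between the images of \<open>u (r k)\<close> and \<open>X\<close> is a limit over \<open>i\<close>, estimated through \<open>\<phi> (r k)\<close>.\<close>

lemma embedding_compact:
  fixes u :: "nat \<Rightarrow> real^'n \<Rightarrow> real^'n"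
  assumes u: "\<And>k. u k \<in> H10 \<Omega>" and C: "\<And>k. H1_norm \<Omega> (u k) \<le> C"
  shows "\<exists>X\<in>V_space \<Omega> A. \<exists>r. strict_mono r \<and> (\<lambda>k. V_dist \<Omega> A (embedding (u (r k))) X) \<longlonglongrightarrow> 0"
proof -
  have u1: "u k \<in> H1 \<Omega>" for k using u by (simp add: H10_def)
  have "\<forall>k. \<exists>s. approximates s (u k)"
    using H10_approximates[OF u] by metis
  then obtain s where s: "\<And>k. approximates (s k) (u k)" by metis
  define err where "err k j = L2_norm lebesgue (\<lambda>x. jacobian (s k j) (at x) - grad \<Omega> (u k) x)" for k j
  have "\<forall>k. \<exists>j. err k j < inverse (real (Suc k))"
  proof
    fix k
    have "\<forall>\<^sub>F j in sequentially. err k j < inverse (real (Suc k))"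
      unfolding err_def by (rule order_tendstoD(2)[OF approximatesD(3)[OF s]]) simp
    then show "\<exists>j. err k j < inverse (real (Suc k))" by (auto simp: eventually_sequentially)
  qed
  then obtain j where j: "\<And>k. err k (j k) < inverse (real (Suc k))" by metis
  define \<phi> where "\<phi> k = s k (j k)" for k
  have \<phi>: "\<phi> k \<in> test_functions \<Omega>" for k unfolding \<phi>_def by (rule approximatesD(1)[OF s])
  have \<phi>_close: "L2_norm lebesgue (\<lambda>x. jacobian (\<phi> k) (at x) - grad \<Omega> (u k) x) \<le> inverse (real (Suc k))" for k
    using j[of k] by (simp add: err_def \<phi>_def)
  have J: "(\<lambda>x. jacobian (\<phi> k) (at x)) \<in> L2 lebesgue" for k
    by (rule L2_lebesgue_borel(1)[OF jacobian_test_function(2)[OF \<phi>]])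
  have "L2_norm lebesgue (\<lambda>x. jacobian (\<phi> k) (at x)) \<le> 1 + C" for k
  proof -
    have "L2_norm lebesgue (\<lambda>x. jacobian (\<phi> k) (at x)) \<le>
        L2_norm lebesgue (\<lambda>x. jacobian (\<phi> k) (at x) - grad \<Omega> (u k) x) + L2_norm lebesgue (grad \<Omega> (u k))"
      using L2.nrm_triangle[OF L2.diff_mem[OF J grad_L2[OF u1]] grad_L2[OF u1], of k k k] by simp
    moreover have "inverse (real (Suc k)) \<le> 1" by (simp add: inverse_le_1_iff)
    ultimately show ?thesis
      using \<phi>_close[of k] L2_norm_grad_le_H1_norm[of \<Omega> "u k"] C[of k] by linarith
  qed
  then obtain r :: "nat \<Rightarrow> nat" where r: "strict_mono r" and cs: "(\<lambda>k. \<phi> (r k)) \<in> V.CS"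
    by (rule V_nrm_compact[OF \<phi>]) (assumption | rule that)+
  define X where "X = V.cls (\<lambda>k. \<phi> (r k))"
  have dist_lim: "(\<lambda>i. V.nrm (\<lambda>x. s (r k) i x - \<phi> (r i) x)) \<longlonglongrightarrow> V_dist \<Omega> A (embedding (u (r k))) X" for k
    unfolding X_def embedding_eq[OF u1 s]
    by (rule V.dist_cls[OF approximates_cauchy[OF u1 s] cs])
  have dist_nonneg: "0 \<le> V_dist \<Omega> A (embedding (u (r k))) X" for k
    by (rule LIMSEQ_le_const[OF dist_lim])
      (auto intro!: V.nrm_nonneg V.diff_mem approximatesD(1)[OF s] \<phi>)
  have "(\<lambda>k. V_dist \<Omega> A (embedding (u (r k))) X) \<longlonglongrightarrow> 0"
  proof (rule LIMSEQ_I)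
    fix \<epsilon> :: real assume \<epsilon>: "0 < \<epsilon>"
    obtain N where N: "\<And>i k. i \<ge> N \<Longrightarrow> k \<ge> N \<Longrightarrow> V.nrm (\<lambda>x. \<phi> (r i) x - \<phi> (r k) x) < \<epsilon> / 4"
      using V.cauchyD[OF cs, of "\<epsilon> / 4"] \<epsilon> by auto
    have "(\<lambda>k. form_bound * inverse (real (Suc k))) \<longlonglongrightarrow> 0"
      by (rule tendsto_mult_right_zero[OF LIMSEQ_inverse_real_of_nat])
    then have "\<forall>\<^sub>F k in sequentially. form_bound * inverse (real (Suc k)) < \<epsilon> / 4"
      using \<epsilon> by (intro order_tendstoD(2)) auto
    then obtain N' where N': "\<And>k. k \<ge> N' \<Longrightarrow> form_bound * inverse (real (Suc k)) < \<epsilon> / 4"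
      by (auto simp: eventually_sequentially)
    have "V_dist \<Omega> A (embedding (u (r k))) X \<le> 3 * (\<epsilon> / 4)" if k: "k \<ge> max N N'" for k
    proof (rule LIMSEQ_le_const2[OF dist_lim])
      have "(\<lambda>i. form_bound * err (r k) i) \<longlonglongrightarrow> 0"
        unfolding err_def by (rule tendsto_mult_right_zero[OF approximatesD(3)[OF s]])
      then have "\<forall>\<^sub>F i in sequentially. form_bound * err (r k) i < \<epsilon> / 4"
        using \<epsilon> by (intro order_tendstoD(2)) auto
      then obtain M where M: "\<And>i. i \<ge> M \<Longrightarrow> form_bound * err (r k) i < \<epsilon> / 4"
        by (auto simp: eventually_sequentially)
      have "V.nrm (\<lambda>x. s (r k) i x - \<phi> (r i) x) \<le> 3 * (\<epsilon> / 4)" if i: "i \<ge> max M N" for i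
      proof -
        have "k \<le> r k" using r by (rule seq_suble)
        then have "form_bound * inverse (real (Suc (r k))) < \<epsilon> / 4" using k by (intro N') auto
        moreover have "V.nrm (\<lambda>x. s (r k) i x - \<phi> (r k) x) \<le> form_bound * err (r k) i + form_bound * inverse (real (Suc (r k)))"
          using V_nrm_diff_le[OF approximatesD(1)[OF s] \<phi> grad_L2[OF u1], of "r k" i "r k" "r k"]
            mult_left_mono[OF \<phi>_close[of "r k"] form_bound_nonneg]
          by (simp add: err_def)
        moreover have "form_bound * err (r k) i < \<epsilon> / 4" using i by (intro M) auto
        moreover have "V.nrm (\<lambda>x. \<phi> (r k) x - \<phi> (r i) x) < \<epsilon> / 4"
          using i k by (intro N) auto
        moreover have "V.nrm (\<lambda>x. s (r k) i x - \<phi> (r i) x) \<le>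
            V.nrm (\<lambda>x. s (r k) i x - \<phi> (r k) x) + V.nrm (\<lambda>x. \<phi> (r k) x - \<phi> (r i) x)"
          by (intro V.nrm_diff_triangle approximatesD(1)[OF s] \<phi>)
        ultimately show ?thesis by linarith
      qed
      then show "\<exists>M. \<forall>i\<ge>M. V.nrm (\<lambda>x. s (r k) i x - \<phi> (r i) x) \<le> 3 * (\<epsilon> / 4)" by blast
    qed
    then have "norm (V_dist \<Omega> A (embedding (u (r k))) X - 0) < \<epsilon>" if "k \<ge> max N N'" for k
      using dist_nonneg[of k] that \<epsilon> by fastforce
    then show "\<exists>N. \<forall>k\<ge>N. norm (V_dist \<Omega> A (embedding (u (r k))) X - 0) < \<epsilon>" by blast
  qed
  moreover have "X \<in> V_space \<Omega> A"
    unfolding X_def V_space_def by (rule V.cls_in_completion[OF cs])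
  ultimately show ?thesis using r by blast
qed

theorem compact_embedding: "H10_compactly_embedded_in_V \<Omega> A"
  unfolding H10_compactly_embedded_in_V_def
proof (intro exI conjI ballI)
  show "compact_operator_H10_V \<Omega> A embedding"
    unfolding compact_operator_H10_V_def
    using bounded_linear_embedding embedding_compact by blast
  show "embedding \<phi> = V_embed \<Omega> A \<phi>" if "\<phi> \<in> test_functions \<Omega>" for \<phi>
    using embedding_eq[OF test_function_H1[OF open_\<Omega> bounded_\<Omega> that] approximates_test_function[OF that]]
    by (simp add: compl_embed_def)
qed

end

theorem proposition4:
  fixes \<Omega> :: "(real^'n) set"
    and A_tilde :: "real \<Rightarrow> real"
    and A :: "real^'n \<Rightarrow> real^'n \<Rightarrow> real"
  assumes dim: "CARD('n) \<in> {1, 2, 3}"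
    and "bounded \<Omega>" and "open \<Omega>" and "connected \<Omega>" and "lipschitz_boundary \<Omega>"
    and even: "\<And>r. A_tilde (- r) = A_tilde r"
    and A_def: "\<And>x x'. A x x' = A_tilde (norm (x - x'))"
    and "strictly_positive_definite \<Omega> A"
    and "(\<lambda>(x, x'). A x x') \<in> L2_on (\<Omega> \<times> \<Omega>)"
  shows "H10_compactly_embedded_in_V \<Omega> A"
proof -
  let ?f = "zero_ext (\<Omega> \<times> \<Omega>) (\<lambda>(x, x'). A x x')"
  have f: "?f \<in> L2 lebesgue" using assms(9) by (simp add: L2_on_zero_ext)
  obtain a where a: "a \<in> borel_measurable lborel" and ae: "AE z in lborel. ?f z = a z"
    using completion_ex_borel_measurable_real[of ?f lborel] L2_measurable[OF f] by blast
  have a': "a \<in> borel_measurable borel" using a by simp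
  have "a \<in> L2 lebesgue"
    by (rule L2_bound[OF f, where c = 1]) (use a AE_completion[OF ae] in \<open>auto intro: measurable_completion elim: eventually_mono\<close>)
  then have "integrable lborel (\<lambda>z. (norm (a z))\<^sup>2)"
    using a' by (auto dest!: L2_integrable_square simp: integrable_lebesgue_borel)
  then have aL2: "a \<in> L2 lborel" using a by (simp add: L2_def)
  interpret kernel_on \<Omega> A a
  proof
    show "A x y = A y x" for x y by (simp add: A_def norm_minus_commute)
    show "a \<in> L2 (lborel \<Otimes>\<^sub>M lborel)" using aL2 by (simp add: lborel_prod)
    show "AE z in lborel \<Otimes>\<^sub>M lborel. indicator (\<Omega> \<times> \<Omega>) z * A (fst z) (snd z) = a z"
      unfolding lborel_prod using ae by (simp add: zero_ext_def case_prod_beta)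
  qed (use assms in auto)
  show ?thesis by (rule compact_embedding)
qed

end
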